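(* There exists $c'\in(0,c_0]$ such that for every $\delta>0$ there are $N_0(\delta)$ and $C_\delta>0$ for which the following holds for all $N\ge N_0(\delta)$. The zeros of $\beta\mapsto Z_{\beta,N}$ in $\delta<|\beta-1|<c'$ lie in $\operatorname{Re}\beta>1$, and for any such zero $\beta$ of $Z_{\beta,N}$ there exists a unique zero $\beta'$ of $\Psi_N$ such that $|\beta-\beta'|<\frac{C_\delta}{N^2}$. Vice versa, for any zero $\beta'$ of $\Psi_N$ with $\delta<|\beta'-1|<c'$ there exists a unique zero $\beta$ of $Z_{\beta,N}$ with $|\beta-\beta'|<\frac{C_\delta}{N^2}$. In particular, the zeros of $Z_{\beta,N}$ in $\delta<|\beta-1|<c'$ lie within distance $C_\delta N^{-1}$ from the critical curve $\Gamma$.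
   Context: For an integer $N\ge1$ and $\beta\in\mathbb{C}$, the Curie–Weiss partition function is $$Z_{\beta,N}=\frac1{2^N}\sum_{\sigma\in\{-1,+1\}^N}\exp(-\beta H_N(\sigma)),\qquad H_N(\sigma)=-\frac1{2N}\sum_{i,j=1}^N\sigma_i\sigma_j .$$ For $\beta\ne0$ let $h_\beta(u)=\frac{u^2}{2\beta}-\log\cosh u$, an even function analytic on $\mathbb{C}\setminus\bigl((-i\infty,-i\pi/2]\cup[i\pi/2,+i\infty)\bigr)$, with $\log\cosh0=0$. Fix a sufficiently small $c_0>0$ such that for $0<|\beta-1|\le c_0$ the function $h_\beta'(u)=\frac u\beta-\tanh u$ has exactly three zeros in $|u|\le10\sqrt{c_0}$, denoted $0,\pm u_\beta$ (the choice of sign is irrelevant below). Define, for $\operatorname{Re}\beta\ge1$ and $0<|\beta-1|\le c_0$, $$\Psi_N(\beta)=\frac1{\sqrt{1-\beta}}+2\sqrt{\frac{\beta}{\beta-\beta^2+u_\beta^2}}\;e^{-Nh_\beta(u_\beta)},$$ with principal branches of the square roots. Critical curve: there exist $c,C>0$ and a smooth function $R_0$ on $[-c,c]$ with $|R_0(\epsilon)-\epsilon|\le C\epsilon^2$ such that, for $\beta=1+\epsilon+iR$ with $|\epsilon|\le c$ in a small punctured neighbourhood of $1$, $\operatorname{Re}h_\beta(\pm u_\beta)$ is negative, zero, or positive according to whether $|R|<|R_0(\epsilon)|$, $|R|=|R_0(\epsilon)|$, or $|R|>|R_0(\epsilon)|$. Fix such $c$ and $R_0$ and set $\Gamma=\{\beta=1+\epsilon+iR:\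 0\le\epsilon\le c,\ R=\pm R_0(\epsilon)\}$. *)

theory Defs
  imports "HOL-Complex_Analysis.Complex_Analysis"
begin

definition cw_hamiltonian :: "nat \<Rightarrow> (nat \<Rightarrow> real) \<Rightarrow> real" where
  "cw_hamiltonian N \<sigma> = - (1 / (2 * real N)) * (\<Sum>i\<in>{1..N}. \<Sum>j\<in>{1..N}. \<sigma> i * \<sigma> j)"

definition cw_partition :: "nat \<Rightarrow> complex \<Rightarrow> complex" where
  "cw_partition N \<beta> =
     1 / 2 ^ N * (\<Sum>\<sigma>\<in>{1..N} \<rightarrow>\<^sub>E {-1, 1}. exp (- \<beta> * complex_of_real (cw_hamiltonian N \<sigma>)))"

definition slit_plane :: "complex set" where
  "slit_plane = UNIV - {z. Re z = 0 \<and> pi / 2 \<le> \<bar>Im z\<bar>}"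

text \<open>The analytic branch of \<open>log cosh\<close> on the slit plane. It is not \<open>Ln \<circ> cosh\<close>, since \<open>cosh\<close> takes
  negative values there (e.g. at \<open>1 + \<i> * pi\<close>). On the slit plane the branch exists
  and is unique (lemmas below); on the slits the value is unspecified.\<close>
definition log_cosh :: "complex \<Rightarrow> complex" where
  "log_cosh = (SOME f. f holomorphic_on slit_plane \<and> f 0 = 0 \<and> (\<forall>u\<in>slit_plane. exp (f u) = cosh u))"

lemma open_slit_plane: "open slit_plane"
proof -
  have "closed {z. Re z = 0 \<and> pi / 2 \<le> \<bar>Im z\<bar>}"
    by (intro closed_Collect_conj closed_Collect_eq closed_Collect_le continuous_intros)
  then show ?thesis
    by (simp add: slit_plane_def open_Diff)
qed

lemma zero_in_slit_plane: "0 \<in> slit_plane"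
  by (simp add: slit_plane_def not_le)

lemma starlike_slit_plane: "starlike slit_plane"
  unfolding starlike_def
proof (rule bexI[where x = 0], rule ballI)
  fix x assume x: "x \<in> slit_plane"
  show "closed_segment 0 x \<subseteq> slit_plane"
  proof
    fix y assume "y \<in> closed_segment 0 x"
    then obtain t where t: "0 \<le> t" "t \<le> 1" and y: "y = t *\<^sub>R x"
      by (auto simp: in_segment)
    have "\<bar>t * Im x\<bar> \<le> \<bar>Im x\<bar>"
      using t by (simp add: abs_mult mult_left_le_one_le)
    then show "y \<in> slit_plane"
      using x by (cases "t = 0") (auto simp: slit_plane_def y not_le)
  qed
qed (rule zero_in_slit_plane)

lemma cosh_nonzero_on_slit_plane:
  assumes "u \<in> slit_plane"
  shows "cosh u \<noteq> 0"
proof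
  assume "cosh u = 0"
  then obtain n :: int where n: "\<i> * u = of_real (of_int n * pi) + of_real pi / 2"
    by (auto simp: cosh_conv_cos cos_eq_0)
  have "Re u = 0"
    using arg_cong[OF n, of Im] by simp
  moreover have "- Im u = (of_int n + 1 / 2) * pi"
    using arg_cong[OF n, of Re] by (simp add: algebra_simps)
  then have "\<bar>Im u\<bar> = \<bar>of_int n + 1 / 2\<bar> * pi"
    by (metis abs_minus_cancel abs_mult abs_of_pos pi_gt_zero)
  moreover have "1 / 2 \<le> \<bar>of_int n + 1 / 2 :: real\<bar>"
  proof (cases "0 \<le> n")
    case False
    then have "of_int n \<le> (- 1 :: real)" by linarith
    then show ?thesis by linarith
  qed simp
  then have "1 / 2 * pi \<le> \<bar>of_int n + 1 / 2\<bar> * pi"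
    by (rule mult_right_mono) simp
  ultimately show False
    using assms by (simp add: slit_plane_def)
qed

lemma log_cosh_exists:
  "\<exists>f. f holomorphic_on slit_plane \<and> f 0 = 0 \<and> (\<forall>u\<in>slit_plane. exp (f u) = cosh u)"
proof -
  have "(cosh :: complex \<Rightarrow> complex) holomorphic_on slit_plane"
    unfolding holomorphic_on_def field_differentiable_def
    by (auto intro!: derivative_eq_intros)
  then obtain g where g: "g holomorphic_on slit_plane" "\<And>u. u \<in> slit_plane \<Longrightarrow> cosh u = exp (g u)"
    using contractible_imp_holomorphic_log[OF _ starlike_imp_contractible[OF starlike_slit_plane]]
      cosh_nonzero_on_slit_plane by metis
  have "exp (g 0) = 1"
    using g(2)[OF zero_in_slit_plane] by simp
  then have "exp (g u - g 0) = cosh u" if "u \<in> slit_plane" for u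
    using g(2)[OF that] by (simp add: exp_diff)
  moreover have "(\<lambda>u. g u - g 0) holomorphic_on slit_plane"
    by (intro holomorphic_intros g)
  ultimately show ?thesis
    by (intro exI[of _ "\<lambda>u. g u - g 0"]) auto
qed

lemma log_cosh:
  shows holomorphic_on_log_cosh: "log_cosh holomorphic_on slit_plane"
    and log_cosh_0: "log_cosh 0 = 0"
    and exp_log_cosh: "u \<in> slit_plane \<Longrightarrow> exp (log_cosh u) = cosh u"
  using someI_ex[OF log_cosh_exists] unfolding log_cosh_def by blast+

lemma has_field_derivative_log_branch:
  assumes "f holomorphic_on slit_plane" "\<And>u. u \<in> slit_plane \<Longrightarrow> exp (f u) = cosh u"
    and u: "u \<in> slit_plane"
  shows "(f has_field_derivative tanh u) (at u)"
proof -
  have f: "(f has_field_derivative deriv f u) (at u)"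
    using assms(1) open_slit_plane u by (rule holomorphic_derivI)
  have "((\<lambda>u. exp (f u)) has_field_derivative exp (f u) * deriv f u) (at u)"
    by (rule DERIV_chain2[OF DERIV_exp f])
  moreover have "((\<lambda>u. exp (f u)) has_field_derivative sinh u) (at u)"
    by (rule has_field_derivative_transform_within_open[where f = cosh and S = slit_plane])
      (use assms(2) u open_slit_plane in \<open>auto intro!: derivative_eq_intros\<close>)
  ultimately have "exp (f u) * deriv f u = sinh u"
    by (rule DERIV_unique)
  then have "deriv f u = tanh u"
    using assms(2)[OF u] cosh_nonzero_on_slit_plane[OF u] by (simp add: tanh_def field_simps)
  with f show ?thesis by simp
qed

lemma log_cosh_unique:
  assumes f: "f holomorphic_on slit_plane" "f 0 = 0" "\<And>u. u \<in> slit_plane \<Longrightarrow> exp (f u) = cosh u"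
    and u: "u \<in> slit_plane"
  shows "f u = log_cosh u"
proof -
  have "((\<lambda>v. f v - log_cosh v) has_field_derivative 0) (at v)" if "v \<in> slit_plane" for v
    using DERIV_diff[OF has_field_derivative_log_branch[OF f(1,3) that]
        has_field_derivative_log_branch[OF holomorphic_on_log_cosh exp_log_cosh that]]
    by simp
  moreover have "connected slit_plane"
    using starlike_slit_plane by (rule starlike_imp_connected)
  ultimately have "(\<lambda>v. f v - log_cosh v) constant_on slit_plane"
    using open_slit_plane by (rule has_field_derivative_0_imp_constant_on)
  then have "f u - log_cosh u = f 0 - log_cosh 0"
    using u zero_in_slit_plane unfolding constant_on_def by metis
  then show ?thesis
    by (simp add: f(2) log_cosh_0)
qed

definition cw_h :: "complex \<Rightarrow> complex \<Rightarrow> complex" where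
  "cw_h \<beta> u = u\<^sup>2 / (2 * \<beta>) - log_cosh u"

definition cw_h_deriv :: "complex \<Rightarrow> complex \<Rightarrow> complex" where
  "cw_h_deriv \<beta> u = u / \<beta> - tanh u"

lemma has_field_derivative_cw_h:
  assumes "\<beta> \<noteq> 0" "u \<in> slit_plane"
  shows "(cw_h \<beta> has_field_derivative cw_h_deriv \<beta> u) (at u)"
proof -
  have "((\<lambda>u. u\<^sup>2 / (2 * \<beta>) - log_cosh u) has_field_derivative u / \<beta> - tanh u) (at u)"
    using assms
    by (auto intro!: derivative_eq_intros exp_log_cosh
        has_field_derivative_log_branch[OF holomorphic_on_log_cosh] simp: field_simps)
  then show ?thesis
    by (simp add: cw_h_def[abs_def] cw_h_deriv_def)
qed

text \<open>\<open>ub \<beta>\<close> is \<open>u\<^sub>\<beta>\<close>, with an arbitrary choice of sign for each \<open>\<beta>\<close>; three distinct zeros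
  means \<open>ub \<beta> \<noteq> 0\<close>. Nothing is required of \<open>ub\<close> outside \<open>0 < \<bar>\<beta> - 1\<bar> \<le> c\<^sub>0\<close>.\<close>
definition saddle_points :: "real \<Rightarrow> (complex \<Rightarrow> complex) \<Rightarrow> bool" where
  "saddle_points c0 ub \<longleftrightarrow>
     (\<forall>\<beta>. 0 < cmod (\<beta> - 1) \<and> cmod (\<beta> - 1) \<le> c0 \<longrightarrow>
        ub \<beta> \<noteq> 0 \<and> {u. cmod u \<le> 10 * sqrt c0 \<and> cw_h_deriv \<beta> u = 0} = {0, ub \<beta>, - ub \<beta>})"

definition cw_Psi :: "(complex \<Rightarrow> complex) \<Rightarrow> nat \<Rightarrow> complex \<Rightarrow> complex" where
  "cw_Psi ub N \<beta> = 1 / csqrt (1 - \<beta>)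
     + 2 * csqrt (\<beta> / (\<beta> - \<beta>\<^sup>2 + (ub \<beta>)\<^sup>2)) * exp (- of_nat N * cw_h \<beta> (ub \<beta>))"

text \<open>The function \<open>\<Psi>\<^sub>N\<close> is only defined for \<open>Re \<beta> \<ge> 1\<close> and \<open>0 < \<bar>\<beta> - 1\<bar> \<le> c\<^sub>0\<close>, so its zeros are
  understood to lie in this set.\<close>
definition cw_Psi_zeros :: "real \<Rightarrow> (complex \<Rightarrow> complex) \<Rightarrow> nat \<Rightarrow> complex set" where
  "cw_Psi_zeros c0 ub N =
     {\<beta>. 1 \<le> Re \<beta> \<and> 0 < cmod (\<beta> - 1) \<and> cmod (\<beta> - 1) \<le> c0 \<and> cw_Psi ub N \<beta> = 0}"

text \<open>Infinitely differentiable, with one-sided derivatives at the end points of an interval.\<close>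
definition smooth_on :: "real set \<Rightarrow> (real \<Rightarrow> real) \<Rightarrow> bool" where
  "smooth_on S f \<longleftrightarrow>
     (\<exists>D :: nat \<Rightarrow> real \<Rightarrow> real. (\<forall>x\<in>S. D 0 x = f x) \<and>
        (\<forall>k. \<forall>x\<in>S. (D k has_real_derivative D (Suc k) x) (at x within S)))"

definition critical_curve_fun ::
  "real \<Rightarrow> (complex \<Rightarrow> complex) \<Rightarrow> real \<Rightarrow> (real \<Rightarrow> real) \<Rightarrow> bool" where
  "critical_curve_fun c0 ub c R0 \<longleftrightarrow>
     c > 0 \<and> smooth_on {-c..c} R0 \<and>
     (\<exists>C>0. \<forall>\<epsilon>\<in>{-c..c}. \<bar>R0 \<epsilon> - \<epsilon>\<bar> \<le> C * \<epsilon>\<^sup>2) \<and>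
     (\<exists>\<rho>>0. \<rho> \<le> c0 \<and>
        (\<forall>\<epsilon>\<in>{-c..c}. \<forall>R \<beta>. \<beta> = Complex (1 + \<epsilon>) R \<and> 0 < cmod (\<beta> - 1) \<and> cmod (\<beta> - 1) < \<rho> \<longrightarrow>
           (\<forall>v\<in>{ub \<beta>, - ub \<beta>}.
              (\<bar>R\<bar> < \<bar>R0 \<epsilon>\<bar> \<longrightarrow> Re (cw_h \<beta> v) < 0) \<and>
              (\<bar>R\<bar> = \<bar>R0 \<epsilon>\<bar> \<longrightarrow> Re (cw_h \<beta> v) = 0) \<and>
              (\<bar>R\<bar> > \<bar>R0 \<epsilon>\<bar> \<longrightarrow> Re (cw_h \<beta> v) > 0))))"

definition critical_curve :: "real \<Rightarrow> (real \<Rightarrow> real) \<Rightarrow> complex set" where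
  "critical_curve c R0 =
     {\<beta>. \<exists>\<epsilon> R. 0 \<le> \<epsilon> \<and> \<epsilon> \<le> c \<and> (R = R0 \<epsilon> \<or> R = - R0 \<epsilon>) \<and> \<beta> = Complex (1 + \<epsilon>) R}"

end

theory Submission
  imports Defs "HOL-Probability.Characteristic_Functions"
begin

text \<open>A Gaussian (Hubbard--Stratonovich) integral turns the partition function into an integral of
  \<open>exp (- N h\<^sub>\<beta>)\<close> over the real line. Near \<open>\<beta> = 1\<close> and off the real axis the line is deformed
  through the saddles \<open>0\<close> and \<open>u\<^sub>\<beta>\<close>. In the coordinate \<open>z = u\<^sup>2\<close> the function \<open>h\<^sub>\<beta>\<close> is nearly quadratic
  around \<open>z\<^sub>\<beta> = u\<^sub>\<beta>\<^sup>2\<close>, so the horizontal line through \<open>z\<^sub>\<beta>\<close> serves as a path of descent, uniformly in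
  \<open>\<beta>\<close>. Laplace's method then gives \<open>Z = \<Psi> + O(1/N) (1 + \<bar>exp (- N h\<^sub>\<beta>(u\<^sub>\<beta>))\<bar>)\<close>, whereas only the
  saddle \<open>0\<close> contributes when \<open>Re (\<beta> - 1)\<close> is small against \<open>\<bar>Im \<beta>\<bar>\<close>, and there is no zero there.
  At a zero of \<open>Z\<close> or of \<open>\<Psi>\<close> the real part of \<open>N h\<^sub>\<beta>(u\<^sub>\<beta>)\<close> is therefore bounded, which confines the
  zero to the directions \<open>\<bar>Im \<beta>\<bar> \<approx> Re (\<beta> - 1)\<close>. On discs of radius \<open>1/N\<close> around it both functions
  are bounded and have a derivative of order \<open>N\<close>, and they are \<open>O(1/N)\<close> at the centre, so each has
  exactly one zero within \<open>O(1/N\<^sup>2)\<close>.\<close>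

text \<open>The obstacle is that the three saddles merge as \<beta> tends to 1: u_\<beta> behaves
  like the square root of 3 (\<beta> - 1), and in the variable u the second derivative at every
  saddle degenerates. In z the pair of nonzero saddles becomes one point, where the second
  derivative stays near 1/6, so all radii can be fixed before \<delta>. What \<delta> controls is
  the distance of z_\<beta> from 0, where du/dz is singular, and the decay at the saddle 0; both
  affect constants only. The value h_\<beta>(u_\<beta>) is about - 3/4 (\<beta> - 1)^2. Its real
  part changes sign near |Im \<beta>| = Re (\<beta> - 1), and its derivative has size 3/2 |\<beta> -
  1|, which explains the order N of the derivative of \<Psi>. As exp (- N h) is entire, each
  deformation is a comparison of endpoint values of one primitive F. By conjugation symmetry Im
  \<beta> > 0 may be assumed, and then the line through z_\<beta> avoids the cut of the square
  root.\<close>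

section \<open>Cauchy estimates and zeros of slightly perturbed holomorphic functions\<close>

text \<open>Cauchy's inequality on a circle of radius R/4 about z, which fits into
  \<open>ball w R\<close> because z is within R/2 of the centre.\<close>

lemma higher_deriv_bound_ball:
  assumes f: "f holomorphic_on ball w R" and M: "\<And>z. z \<in> ball w R \<Longrightarrow> cmod (f z) \<le> M"
    and R: "0 < R" and z: "z \<in> ball w (R / 2)"
  shows "cmod ((deriv ^^ n) f z) \<le> fact n * M * (4 / R) ^ n"
proof -
  have sub: "cball z (R / 4) \<subseteq> ball w R"
  proof
    fix y assume "y \<in> cball z (R / 4)"
    then have "dist w y < R / 2 + R / 4" using z dist_triangle[of w y z] by (simp add: mem_cball)
    then show "y \<in> ball w R" using R by simp
  qed
  have "cmod ((deriv ^^ n) f z) \<le> fact n * M / (R / 4) ^ n"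
  proof (rule Cauchy_inequality)
    show "f holomorphic_on ball z (R / 4)"
      using sub by (intro holomorphic_on_subset[OF f]) (auto intro: less_imp_le)
    show "continuous_on (cball z (R / 4)) f"
      using sub by (intro holomorphic_on_imp_continuous_on holomorphic_on_subset[OF f])
    fix x assume "cmod (z - x) = R / 4"
    then have "x \<in> cball z (R / 4)" by (simp add: dist_norm)
    then show "cmod (f x) \<le> M" using sub M by blast
  qed (use R in auto)
  then show ?thesis by (simp add: power_divide)
qed

text \<open>\<open>complex_Taylor\<close> divides by \<open>fact n\<close>, whereas Cauchy's bound
  for the next derivative carries \<open>fact (Suc n)\<close>; this leaves the factor
  \<open>Suc n\<close>. The bound involves M and R only, which makes the later expansions uniform in
  \<beta>.\<close>

lemma taylor_remainder_ball:
  assumes f: "f holomorphic_on ball w R" and M: "\<And>z. z \<in> ball w R \<Longrightarrow> cmod (f z) \<le> M"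
    and R: "0 < R" and z: "z \<in> ball w (R / 2)"
  shows "cmod (f z - (\<Sum>k\<le>n. (deriv ^^ k) f w * (z - w) ^ k / fact k))
           \<le> real (Suc n) * M * (4 / R) ^ Suc n * cmod (z - w) ^ Suc n"
proof -
  have "cmod ((deriv ^^ 0) f z - (\<Sum>k\<le>n. (deriv ^^ k) f w * (z - w) ^ k / fact k))
      \<le> (fact (Suc n) * M * (4 / R) ^ Suc n) * cmod (z - w) ^ Suc n / fact n"
  proof (rule complex_Taylor[where S = "ball w (R / 2)"])
    fix i x assume "x \<in> ball w (R / 2)"
    then have "x \<in> ball w R" using R by (simp add: mem_ball)
    then have "((deriv ^^ i) f has_field_derivative deriv ((deriv ^^ i) f) x) (at x)"
      using holomorphic_derivI[OF holomorphic_higher_deriv[OF f open_ball] open_ball] by blast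
    then show "((deriv ^^ i) f has_field_derivative (deriv ^^ Suc i) f x) (at x within ball w (R / 2))"
      by (simp add: has_field_derivative_at_within)
  next
    fix x assume "x \<in> ball w (R / 2)"
    then show "cmod ((deriv ^^ Suc n) f x) \<le> fact (Suc n) * M * (4 / R) ^ Suc n"
      using higher_deriv_bound_ball[OF f M R] by blast
  qed (use R z in auto)
  also have "\<dots> = real (Suc n) * M * (4 / R) ^ Suc n * cmod (z - w) ^ Suc n"
    by (simp add: fact_Suc del: power_Suc)
  finally show ?thesis by simp
qed

text \<open>Newton's iteration z - F z / m with frozen slope m: the bound on F' makes it a
  contraction with factor 1/2, so Banach's theorem gives existence and uniqueness together. The
  fixed point is found in the closed disc; the strict bound on F b puts it into the open
  one.\<close>

lemma unique_zero_near:
  assumes F: "F holomorphic_on ball b s" and m: "m \<noteq> 0"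
    and F': "\<And>z. z \<in> ball b s \<Longrightarrow> cmod (deriv F z - m) \<le> cmod m / 2"
    and \<rho>: "0 < \<rho>" "\<rho> < s" and Fb: "cmod (F b) < cmod m * \<rho> / 2"
  shows "\<exists>!z. F z = 0 \<and> cmod (b - z) < \<rho>"
proof -
  define \<phi> where "\<phi> z = z - F z / m" for z
  have lip: "cmod (\<phi> x - \<phi> y) \<le> 1 / 2 * cmod (x - y)" if "x \<in> ball b s" "y \<in> ball b s" for x y
  proof (rule field_differentiable_bound[OF convex_ball _ _ that])
    fix z assume z: "z \<in> ball b s"
    have "(F has_field_derivative deriv F z) (at z within ball b s)"
      using holomorphic_derivI[OF F open_ball z] by (simp add: has_field_derivative_at_within)
    then show "(\<phi> has_field_derivative (1 - deriv F z / m)) (at z within ball b s)"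
      unfolding \<phi>_def by (auto intro!: derivative_eq_intros simp: m)
    have "1 - deriv F z / m = - ((deriv F z - m) / m)" using m by (simp add: field_simps)
    then show "cmod (1 - deriv F z / m) \<le> 1 / 2"
      using F'[OF z] m by (simp add: norm_divide divide_le_eq norm_minus_commute)
  qed
  have sub: "cball b \<rho> \<subseteq> ball b s" using \<rho> by auto
  have fb: "cmod (\<phi> b - b) < \<rho> / 2"
    using Fb m by (simp add: \<phi>_def norm_divide field_simps)
  have bs: "b \<in> ball b s" using \<rho> by simp
  have close: "cmod (\<phi> x - b) < \<rho> / 2 + cmod (x - b) / 2" if "x \<in> cball b \<rho>" for x
  proof -
    have "x \<in> ball b s" using that sub by blast
    then show ?thesis using lip[OF _ bs, of x] fb norm_triangle_ineq[of "\<phi> x - \<phi> b" "\<phi> b - b"] by simp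
  qed
  have "\<exists>!x. x \<in> cball b \<rho> \<and> \<phi> x = x"
  proof (rule Banach_fix)
    show "complete (cball b \<rho>)" by (simp add: compact_imp_complete)
    show "\<phi> ` cball b \<rho> \<subseteq> cball b \<rho>"
      using close by (force simp: dist_norm norm_minus_commute)
    fix x y assume "x \<in> cball b \<rho>" "y \<in> cball b \<rho>"
    then have "x \<in> ball b s" "y \<in> ball b s" using sub by blast+
    then show "dist (\<phi> x) (\<phi> y) \<le> 1 / 2 * dist x y"
      using lip by (simp add: dist_norm)
  qed (use \<rho> in auto)
  then obtain x where x: "x \<in> cball b \<rho>" "\<phi> x = x" and uniq: "\<And>y. y \<in> cball b \<rho> \<Longrightarrow> \<phi> y = y \<Longrightarrow> y = x"
    by blast
  have fix_iff: "\<phi> y = y \<longleftrightarrow> F y = 0" for y using m by (simp add: \<phi>_def)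
  show ?thesis
  proof (rule ex1I[of _ x])
    show "F x = 0 \<and> cmod (b - x) < \<rho>"
      using close[OF x(1)] x fix_iff by (simp add: norm_minus_commute)
  next
    fix y assume "F y = 0 \<and> cmod (b - y) < \<rho>"
    then show "y = x" using uniq[of y] fix_iff by (simp add: dist_norm)
  qed
qed

lemma unique_zero_rescaled:
  fixes M k :: real
  assumes M: "0 < M" and k: "0 < k"
  shows "\<exists>C0>0. \<forall>C\<ge>C0. \<exists>N0\<ge>1. \<forall>N\<ge>N0. \<forall>F b.
    F holomorphic_on ball b (1 / real N) \<and> (\<forall>z\<in>ball b (1 / real N). cmod (F z) \<le> M) \<and>
    cmod (F b) \<le> M / real N \<and> k * real N \<le> cmod (deriv F b) \<longrightarrow>
    (\<exists>!z. F z = 0 \<and> cmod (b - z) < C / (real N)\<^sup>2)"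
proof (intro exI conjI allI impI)
  show "0 < 4 * M / k" using M k by simp
  fix C assume C: "4 * M / k \<le> C"
  have C0: "0 < C" using C M k by (meson \<open>0 < 4 * M / k\<close> less_le_trans)
  \<comment> \<open>The change of F' is at most 32 M N^2 times \<theta>/N, which must stay below k N
    / 2; \<theta> \<le> 1/2 keeps the disc where Cauchy's bound applies.\<close>
  define \<theta> where "\<theta> = min (1 / 2) (k / (64 * M))"
  have \<theta>: "0 < \<theta>" "\<theta> \<le> 1 / 2" "64 * M * \<theta> \<le> k"
    using M k by (auto simp: \<theta>_def min_def field_simps)
  define N0 where "N0 = nat \<lceil>C / \<theta>\<rceil> + 1"
  show "1 \<le> N0" by (simp add: N0_def)
  fix N F b assume N: "N0 \<le> N" and
    "F holomorphic_on ball b (1 / real N) \<and> (\<forall>z\<in>ball b (1 / real N). cmod (F z) \<le> M) \<and>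
    cmod (F b) \<le> M / real N \<and> k * real N \<le> cmod (deriv F b)"
  then have F: "F holomorphic_on ball b (1 / real N)"
    and FM: "\<And>z. z \<in> ball b (1 / real N) \<Longrightarrow> cmod (F z) \<le> M"
    and Fb: "cmod (F b) \<le> M / real N" and F'b: "k * real N \<le> cmod (deriv F b)" by auto
  have N1: "0 < real N" using N by (simp add: N0_def)
  have NC: "C < \<theta> * real N"
  proof -
    have "C / \<theta> < real N" using N unfolding N0_def by linarith
    then show ?thesis using \<theta> by (simp add: field_simps)
  qed
  have kN: "0 < cmod (deriv F b)" using F'b k N1 by (meson less_le_trans mult_pos_pos)
  show "\<exists>!z. F z = 0 \<and> cmod (b - z) < C / (real N)\<^sup>2"
  proof (rule unique_zero_near[where m = "deriv F b" and s = "\<theta> / real N"])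
    have sub: "ball b (\<theta> / real N) \<subseteq> ball b (1 / real N / 2)"
      using \<theta> N1 by (intro subset_ball) (simp add: field_simps)
    also have "\<dots> \<subseteq> ball b (1 / real N)" using N1 by (intro subset_ball) (simp add: field_simps)
    finally have sub1: "ball b (\<theta> / real N) \<subseteq> ball b (1 / real N)" .
    show "F holomorphic_on ball b (\<theta> / real N)" by (rule holomorphic_on_subset[OF F sub1])
    show "deriv F b \<noteq> 0" using kN by auto
    show "0 < C / (real N)\<^sup>2" using C0 N1 by simp
    show "C / (real N)\<^sup>2 < \<theta> / real N" using NC N1 by (simp add: field_simps power2_eq_square)
    have "cmod (F b) * real N \<le> M" using Fb N1 by (simp add: field_simps)
    also have "4 * M \<le> k * C" using C k by (simp add: field_simps)
    then have "M < k * C / 2" using M by simp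
    also have "\<dots> = k * real N * (C / real N) / 2" using N1 by simp
    also have "\<dots> \<le> cmod (deriv F b) * (C / real N) / 2"
      using F'b C0 N1 by (intro divide_right_mono mult_right_mono) auto
    finally show "cmod (F b) < cmod (deriv F b) * (C / (real N)\<^sup>2) / 2"
      using N1 by (simp add: field_simps power2_eq_square)
    fix z assume z: "z \<in> ball b (\<theta> / real N)"
    have d2: "cmod (deriv F z - deriv F b) \<le> (32 * M * (real N)\<^sup>2) * cmod (z - b)"
    proof (rule field_differentiable_bound[where S = "ball b (\<theta> / real N)"])
      fix y assume y: "y \<in> ball b (\<theta> / real N)"
      have "(deriv F has_field_derivative deriv (deriv F) y) (at y)"
        using holomorphic_derivI[OF holomorphic_deriv[OF F open_ball] open_ball] y sub1 by blast
      then show "(deriv F has_field_derivative deriv (deriv F) y) (at y within ball b (\<theta> / real N))"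
        by (rule has_field_derivative_at_within)
      have "cmod ((deriv ^^ 2) F y) \<le> fact 2 * M * (4 / (1 / real N)) ^ 2"
        by (rule higher_deriv_bound_ball[OF F FM]) (use y sub N1 in auto)
      then show "cmod (deriv (deriv F) y) \<le> 32 * M * (real N)\<^sup>2"
        by (simp add: numeral_2_eq_2 power2_eq_square field_simps)
    qed (use z \<theta> N1 in auto)
    also have "\<dots> \<le> (32 * M * (real N)\<^sup>2) * (\<theta> / real N)"
      using z M N1 by (intro mult_left_mono) (auto simp: dist_norm norm_minus_commute)
    also have "\<dots> = (64 * M * \<theta>) * real N / 2" using N1 by (simp add: power2_eq_square)
    also have "\<dots> \<le> k * real N / 2" using \<theta> N1 by (intro divide_right_mono mult_right_mono) auto
    also have "\<dots> \<le> cmod (deriv F b) / 2" using F'b by simp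
    finally show "cmod (deriv F z - deriv F b) \<le> cmod (deriv F b) / 2" .
  qed
qed

section \<open>Gaussian integrals and Laplace's method with uniform error\<close>

text \<open>For x \<ge> X \<ge> 0 one has x^2 \<ge> X^2 + (x - X)^2, so the tail is at most exp (-
  X^2) times a half-line Gaussian integral, and that is at most 1.\<close>

lemma gauss_half_line_tail:
  assumes X: "0 \<le> X"
  shows "\<bar>integral {0..X} (\<lambda>x. exp (- x\<^sup>2)) - sqrt pi / 2\<bar> \<le> exp (- X\<^sup>2)"
proof -
  let ?g = "\<lambda>x::real. exp (- x\<^sup>2)"
  have G: "has_bochner_integral lborel (\<lambda>x. indicator {0..} x *\<^sub>R ?g x) (sqrt pi / 2)"
    by (rule gaussian_moment_0)
  have G': "has_bochner_integral lborel (\<lambda>x. indicator {X..} x *\<^sub>R exp (- (x - X)\<^sup>2)) (sqrt pi / 2)"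
  proof -
    have "has_bochner_integral lborel (\<lambda>x. indicator {0..} (- X + 1 * x) *\<^sub>R ?g (- X + 1 * x)) (sqrt pi / 2 /\<^sub>R \<bar>1\<bar>)"
      using lborel_has_bochner_integral_real_affine_iff[of 1 "\<lambda>x. indicator {0..} x *\<^sub>R ?g x" "sqrt pi / 2" "- X"] G
      by simp
    then show ?thesis
      by (simp add: indicator_def)
  qed
  have 1: "set_integrable lborel {0..X} ?g"
    by (intro borel_integrable_atLeastAtMost') (auto intro!: continuous_intros)
  have 2: "integrable lborel (\<lambda>x. indicator {X<..} x *\<^sub>R ?g x)"
    by (rule Bochner_Integration.integrable_bound[OF has_bochner_integral_iff[THEN iffD1, OF G, THEN conjunct1]])
       (use X in \<open>auto simp: indicator_def\<close>)
  have eq: "(\<lambda>x. indicator {0..} x *\<^sub>R ?g x) = (\<lambda>x. indicator {0..X} x *\<^sub>R ?g x + indicator {X<..} x *\<^sub>R ?g x)"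
    using X by (auto simp: indicator_def fun_eq_iff)
  have "sqrt pi / 2 = (LINT x|lborel. indicator {0..} x *\<^sub>R ?g x)"
    using G by (simp add: has_bochner_integral_iff)
  also have "\<dots> = (LINT x:{0..X}|lborel. ?g x) + (LINT x|lborel. indicator {X<..} x *\<^sub>R ?g x)"
    unfolding eq set_lebesgue_integral_def
    by (rule Bochner_Integration.integral_add[OF 1[unfolded set_integrable_def] 2])
  also have "(LINT x:{0..X}|lborel. ?g x) = integral {0..X} ?g"
    by (rule set_borel_integral_eq_integral(2)[OF 1])
  finally have split: "sqrt pi / 2 - integral {0..X} ?g = (LINT x|lborel. indicator {X<..} x *\<^sub>R ?g x)" by linarith
  have "(LINT x|lborel. indicator {X<..} x *\<^sub>R ?g x)
      \<le> (LINT x|lborel. exp (- X\<^sup>2) * (indicator {X..} x *\<^sub>R exp (- (x - X)\<^sup>2)))"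
  proof (rule integral_mono[OF 2])
    show "integrable lborel (\<lambda>x. exp (- X\<^sup>2) * (indicator {X..} x *\<^sub>R exp (- (x - X)\<^sup>2)))"
      using G' by (intro integrable_mult_right) (simp add: has_bochner_integral_iff)
    fix x :: real
    show "indicator {X<..} x *\<^sub>R ?g x \<le> exp (- X\<^sup>2) * (indicator {X..} x *\<^sub>R exp (- (x - X)\<^sup>2))"
    proof (cases "X < x")
      case True
      have "0 \<le> X * (x - X)" using True X by simp
      then have "- x\<^sup>2 \<le> - X\<^sup>2 + - (x - X)\<^sup>2" by (simp add: power2_eq_square algebra_simps)
      then have "exp (- x\<^sup>2) \<le> exp (- X\<^sup>2) * exp (- (x - X)\<^sup>2)" by (simp flip: exp_add)
      then show ?thesis using True by (simp add: indicator_def)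
    qed (auto simp: indicator_def)
  qed
  also have "\<dots> = exp (- X\<^sup>2) * (sqrt pi / 2)"
    using G' by (simp add: has_bochner_integral_iff)
  also have "\<dots> \<le> exp (- X\<^sup>2) * 1"
  proof (rule mult_left_mono)
    have "sqrt pi \<le> sqrt 4" using pi_less_4 by (intro real_sqrt_le_mono) simp
    then show "sqrt pi / 2 \<le> 1" by simp
  qed simp
  finally have "sqrt pi / 2 - integral {0..X} ?g \<le> exp (- X\<^sup>2)" using split by simp
  moreover have "0 \<le> sqrt pi / 2 - integral {0..X} ?g"
    unfolding split by (intro integral_nonneg_AE) auto
  ultimately show ?thesis by linarith
qed

text \<open>With s = \<open>csqrt a\<close> and \<Phi> the primitive of exp (- w^2) vanishing at 0,
  the integral is 2 \<Phi>(s T) / s. The point s T is joined to the real point with the same real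
  part by a vertical segment, on which |exp (- w^2)| is at most exp (- Re a T^2); the rest is the
  real tail, with the same exponential bound because (Re s)^2 \<ge> Re a.\<close>

lemma integral_cgauss:
  assumes a: "0 < Re a" and T: "0 < T"
  shows "cmod (integral {-T..T} (\<lambda>t. exp (- a * (of_real t)\<^sup>2)) - of_real (sqrt pi) / csqrt a)
    \<le> (2 * T + 2 / sqrt (cmod a)) * exp (- Re a * T\<^sup>2)"
proof -
  define s where "s = csqrt a"
  define x where "x = Re s" define y where "y = Im s"
  have s2: "s\<^sup>2 = a" by (simp add: s_def)
  have xy: "x\<^sup>2 - y\<^sup>2 = Re a" using arg_cong[OF s2, of Re] by (simp add: x_def y_def Re_power2)
  have s0: "s \<noteq> 0" using a by (auto simp: s_def)
  have xpos: "0 \<le> x" using csqrt_principal[of a] by (auto simp: x_def s_def)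
  have cs: "cmod s = sqrt (cmod a)" using s2 by (metis norm_power norm_ge_zero real_sqrt_unique)
  have "(\<lambda>w::complex. exp (- w\<^sup>2)) holomorphic_on UNIV" by (intro holomorphic_intros)
  then obtain \<Phi>0 :: "complex \<Rightarrow> complex" where "\<And>w. w \<in> UNIV \<Longrightarrow> (\<Phi>0 has_field_derivative exp (- w\<^sup>2)) (at w within UNIV)"
    using holomorphic_convex_primitive'[OF convex_UNIV open_UNIV] by blast
  then have \<Phi>0: "\<And>w. (\<Phi>0 has_field_derivative exp (- w\<^sup>2)) (at w)" by simp
  define \<Phi> where "\<Phi> w = \<Phi>0 w - \<Phi>0 0" for w
  have \<Phi>: "(\<Phi> has_field_derivative exp (- w\<^sup>2)) (at w)" for w
    unfolding \<Phi>_def using \<Phi>0[of w] by (auto intro!: derivative_eq_intros)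
  have \<Phi>z: "\<Phi> 0 = 0" by (simp add: \<Phi>_def)
  have odd: "\<Phi> (- w) = - \<Phi> w" for w
  proof -
    have "((\<lambda>w. \<Phi> w + \<Phi> (- w)) has_field_derivative 0) (at w within UNIV)" for w
    proof -
      have "((\<lambda>w. \<Phi> (- w)) has_field_derivative exp (- (- w)\<^sup>2) * (- 1)) (at w)"
        by (rule DERIV_chain2[OF \<Phi>]) (auto intro!: derivative_eq_intros)
      from DERIV_add[OF \<Phi> this] show ?thesis by simp
    qed
    then obtain c where c: "\<And>w. \<Phi> w + \<Phi> (- w) = c"
      using has_field_derivative_zero_constant[OF convex_UNIV, of "\<lambda>w. \<Phi> w + \<Phi> (- w)"] by auto
    have "c = 0" using c[of 0] \<Phi>z by simp
    then show ?thesis using c[of w] by (simp add: eq_neg_iff_add_eq_0 add.commute)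
  qed
  have "((\<lambda>t. exp (- a * (of_real t)\<^sup>2)) has_integral (\<Phi> (s * of_real T) / s - \<Phi> (s * of_real (-T)) / s)) {-T..T}"
  proof (rule fundamental_theorem_of_calculus)
    fix t
    have "((\<lambda>t. \<Phi> (s * t) / s) has_field_derivative exp (- a * (of_real t)\<^sup>2)) (at (of_real t))"
    proof -
      have "((\<lambda>t. \<Phi> (s * t)) has_field_derivative exp (- (s * of_real t)\<^sup>2) * s) (at (of_real t))"
        by (rule DERIV_chain2[OF \<Phi>]) (auto intro!: derivative_eq_intros)
      from DERIV_cdivide[OF this, of s] show ?thesis using s0 by (simp add: power_mult_distrib s2)
    qed
    from has_vector_derivative_real_field[OF this]
    show "((\<lambda>t. \<Phi> (s * complex_of_real t) / s) has_vector_derivative exp (- a * (complex_of_real t)\<^sup>2))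
        (at t within {-T..T})"
      by (rule has_vector_derivative_at_within)
  qed (use T in auto)
  then have int: "integral {-T..T} (\<lambda>t. exp (- a * (of_real t)\<^sup>2)) = 2 * \<Phi> (s * of_real T) / s"
    by (simp add: integral_unique odd)
  have "((\<lambda>t. complex_of_real (exp (- t\<^sup>2))) has_integral (\<Phi> (of_real (x * T)) - \<Phi> (of_real 0))) {0..x * T}"
  proof (rule fundamental_theorem_of_calculus)
    fix t
    show "((\<lambda>t. \<Phi> (of_real t)) has_vector_derivative complex_of_real (exp (- t\<^sup>2))) (at t within {0..x * T})"
      using has_vector_derivative_real_field[OF \<Phi>[of "of_real t"]]
      by (auto intro: has_vector_derivative_at_within simp: exp_of_real[symmetric])
  qed (use T xpos in auto)
  moreover have "((\<lambda>t. complex_of_real (exp (- t\<^sup>2))) has_integral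
      of_real (integral {0..x * T} (\<lambda>t. exp (- t\<^sup>2)))) {0..x * T}"
    by (intro has_integral_of_real integrable_integral integrable_continuous_real continuous_intros)
  ultimately have "\<Phi> (of_real (x * T)) - \<Phi> (of_real 0) = of_real (integral {0..x * T} (\<lambda>t. exp (- t\<^sup>2)))"
    by (rule has_integral_unique)
  then have \<Phi>x: "\<Phi> (of_real (x * T)) - of_real (sqrt pi / 2)
      = of_real (integral {0..x * T} (\<lambda>t. exp (- t\<^sup>2)) - sqrt pi / 2)"
    by (simp add: \<Phi>z)
  have xT: "0 \<le> x * T" using xpos T by simp
  have "(x * T)\<^sup>2 \<ge> Re a * T\<^sup>2"
    unfolding power_mult_distrib using xy by (intro mult_right_mono) (auto simp: algebra_simps)
  then have "exp (- (x * T)\<^sup>2) \<le> exp (- Re a * T\<^sup>2)" by simp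
  then have A: "cmod (\<Phi> (of_real (x * T)) - of_real (sqrt pi / 2)) \<le> exp (- Re a * T\<^sup>2)"
    unfolding \<Phi>x norm_of_real using gauss_half_line_tail[OF xT] by linarith
  have B: "cmod (\<Phi> (s * of_real T) - \<Phi> (of_real (x * T))) \<le> exp (- Re a * T\<^sup>2) * cmod (s * of_real T - of_real (x * T))"
  proof (rule field_differentiable_bound[where S = "{w. Re w = x * T \<and> \<bar>Im w\<bar> \<le> \<bar>y\<bar> * T}"])
    have "{w. Re w = x * T \<and> \<bar>Im w\<bar> \<le> \<bar>y\<bar> * T}
        = {w. Re w \<le> x * T} \<inter> {w. Re w \<ge> x * T} \<inter> {w. Im w \<le> \<bar>y\<bar> * T} \<inter> {w. Im w \<ge> - (\<bar>y\<bar> * T)}"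
      by auto
    then show "convex {w. Re w = x * T \<and> \<bar>Im w\<bar> \<le> \<bar>y\<bar> * T}"
      by (simp only: convex_Int convex_halfspace_Re_le convex_halfspace_Re_ge convex_halfspace_Im_le convex_halfspace_Im_ge)
    show "s * of_real T \<in> {w. Re w = x * T \<and> \<bar>Im w\<bar> \<le> \<bar>y\<bar> * T}"
      using T by (simp add: x_def y_def abs_mult)
    show "of_real (x * T) \<in> {w. Re w = x * T \<and> \<bar>Im w\<bar> \<le> \<bar>y\<bar> * T}" using T by simp
    fix w assume w: "w \<in> {w. Re w = x * T \<and> \<bar>Im w\<bar> \<le> \<bar>y\<bar> * T}"
    show "(\<Phi> has_field_derivative exp (- w\<^sup>2)) (at w within {w. Re w = x * T \<and> \<bar>Im w\<bar> \<le> \<bar>y\<bar> * T})"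
      using \<Phi> by (rule has_field_derivative_at_within)
    have "(Im w)\<^sup>2 \<le> (y * T)\<^sup>2" using w T by (simp add: abs_le_square_iff[symmetric] abs_mult)
    then have "(x * T)\<^sup>2 - (y * T)\<^sup>2 \<le> Re (w\<^sup>2)" using w by (simp add: Re_power2)
    moreover have "(x * T)\<^sup>2 - (y * T)\<^sup>2 = Re a * T\<^sup>2"
      unfolding xy[symmetric] by (simp add: power_mult_distrib algebra_simps)
    ultimately have "Re a * T\<^sup>2 \<le> Re (w\<^sup>2)" by simp
    then show "cmod (exp (- w\<^sup>2)) \<le> exp (- Re a * T\<^sup>2)" by simp
  qed
  have "cmod (s * of_real T - of_real (x * T)) \<le> cmod s * T"
  proof -
    have "s * of_real T - of_real (x * T) = \<i> * of_real (y * T)"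
      by (simp add: complex_eq_iff x_def y_def)
    then have "cmod (s * of_real T - of_real (x * T)) = \<bar>y\<bar> * T" using T by (simp add: norm_mult)
    also have "\<dots> \<le> cmod s * T" using T by (intro mult_right_mono) (auto simp: y_def abs_Im_le_cmod)
    finally show ?thesis .
  qed
  then have B: "cmod (\<Phi> (s * of_real T) - \<Phi> (of_real (x * T))) \<le> exp (- Re a * T\<^sup>2) * (cmod s * T)"
    using B by (meson exp_ge_zero mult_left_mono order_trans)
  have "integral {-T..T} (\<lambda>t. exp (- a * (of_real t)\<^sup>2)) - of_real (sqrt pi) / csqrt a
      = 2 / s * ((\<Phi> (s * of_real T) - \<Phi> (of_real (x * T))) + (\<Phi> (of_real (x * T)) - of_real (sqrt pi / 2)))"
    unfolding int s_def[symmetric] using s0 by (simp add: field_simps)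
  then have "cmod (integral {-T..T} (\<lambda>t. exp (- a * (of_real t)\<^sup>2)) - of_real (sqrt pi) / csqrt a)
     = 2 / cmod s * cmod ((\<Phi> (s * of_real T) - \<Phi> (of_real (x * T))) + (\<Phi> (of_real (x * T)) - of_real (sqrt pi / 2)))"
    by (simp only: norm_mult norm_divide norm_numeral)
  also have "\<dots> \<le> 2 / cmod s * (exp (- Re a * T\<^sup>2) * (cmod s * T) + exp (- Re a * T\<^sup>2))"
    by (intro mult_left_mono norm_triangle_le add_mono A B) auto
  also have "\<dots> = (2 * T + 2 / sqrt (cmod a)) * exp (- Re a * T\<^sup>2)"
    using s0 by (simp add: cs[symmetric] field_simps)
  finally show ?thesis .
qed

text \<open>The factor \<open>max 1 (exp (- Re q))\<close> is the largest modulus of exp on the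
  segment from 0 to - q. Unlike exp |q| it can be absorbed into the Gaussian factor in Laplace's
  method.\<close>

lemma exp_taylor_1_2:
  fixes q :: complex
  shows "cmod (exp (- q) - 1) \<le> cmod q * max 1 (exp (- Re q))"
    and "cmod (exp (- q) - 1 + q) \<le> (cmod q)\<^sup>2 * max 1 (exp (- Re q))"
proof -
  have B: "cmod (exp x) \<le> max 1 (exp (- Re q))" if "x \<in> closed_segment 0 (- q)" for x
  proof -
    have "\<exists>u. 0 \<le> u \<and> u \<le> 1 \<and> x = - (u *\<^sub>R q)"
      using that by (auto simp: in_segment)
    then obtain u where u: "0 \<le> u" "u \<le> 1" "x = - (u *\<^sub>R q)" by blast
    have "Re x \<le> max 0 (- Re q)"
    proof (cases "Re q \<le> 0")
      case True
      then have "u * (- Re q) \<le> 1 * (- Re q)" using u by (intro mult_right_mono) auto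
      then show ?thesis using u True by simp
    next
      case False
      then have "0 \<le> u * Re q" using u by simp
      then show ?thesis using u False by simp
    qed
    then have "exp (Re x) \<le> exp (max 0 (- Re q))" by simp
    then show ?thesis by (auto simp: max_def split: if_splits)
  qed
  have D: "(exp has_field_derivative exp x) (at x within S)" for x :: complex and S
    by (auto intro!: derivative_eq_intros)
  have "cmod (exp (- q) - (\<Sum>i\<le>n. exp 0 * (- q - 0) ^ i / fact i))
      \<le> max 1 (exp (- Re q)) * cmod (- q - 0) ^ Suc n / fact n" for n
    by (rule complex_Taylor[where S = "closed_segment 0 (- q)" and f = "\<lambda>_. exp"]) (use B D in auto)
  from this[of 0] this[of 1]
  show "cmod (exp (- q) - 1) \<le> cmod q * max 1 (exp (- Re q))"
    and "cmod (exp (- q) - 1 + q) \<le> (cmod q)\<^sup>2 * max 1 (exp (- Re q))"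
    by (simp_all add: mult.commute power2_eq_square algebra_simps)
qed

lemma power_le_fact_exp:
  assumes "0 < c" "0 \<le> y"
  shows "y ^ k \<le> fact k * (1 / c) ^ k * exp (c * y :: real)"
proof -
  have "(c * y) ^ k / fact k \<le> exp (c * y)"
  proof -
    have "(c * y) ^ k / fact k = (\<Sum>i\<in>{k}. (c * y) ^ i / fact i)" by simp
    also have "\<dots> \<le> (\<Sum>i. (c * y) ^ i / fact i)"
      by (rule sum_le_suminf) (use assms summable_exp_generic[of "c * y"] in \<open>auto simp: field_simps\<close>)
    also have "\<dots> = exp (c * y)" by (simp add: exp_def field_simps)
    finally show ?thesis .
  qed
  then show ?thesis using assms by (simp add: field_simps)
qed

lemma integral_odd_eq_0:
  fixes f :: "real \<Rightarrow> complex"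
  assumes odd: "\<And>t. f (- t) = - f t" and f: "f integrable_on {-T..T}"
  shows "integral {-T..T} f = 0"
proof -
  have 1: "(f has_integral integral {-T..T} f) {-T..T}" using f by (rule integrable_integral)
  then have "((\<lambda>x. f (- x)) has_integral integral {-T..T} f) {-T..- (-T)}"
    by (simp only: has_integral_reflect_real)
  then have "((\<lambda>x. - f x) has_integral integral {-T..T} f) {-T..T}" by (simp add: odd)
  then have "integral {-T..T} f = - integral {-T..T} f"
    using has_integral_neg[OF 1] by (rule has_integral_unique)
  then show ?thesis by (simp add: equal_neg_zero complex_eq_iff)
qed

text \<open>In \<open>integral_cgauss\<close> the main term is at most 2 / sqrt c and the error at
  most 4 / sqrt c, its factor T being absorbed by y \<le> exp (y^2) with y = sqrt c * T. The
  resulting bound is free of T.\<close>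

lemma integral_gauss_le:
  assumes c: "0 < c" and T: "0 < T"
  shows "integral {-T..T} (\<lambda>t. exp (- c * t\<^sup>2)) \<le> 6 / sqrt c"
proof -
  have "((\<lambda>t. exp (- c * t\<^sup>2)) has_integral integral {-T..T} (\<lambda>t. exp (- c * t\<^sup>2))) {-T..T}"
    by (intro integrable_integral integrable_continuous_real continuous_intros)
  from has_integral_of_real[OF this]
  have "((\<lambda>t. complex_of_real (exp (- c * t\<^sup>2))) has_integral
      complex_of_real (integral {-T..T} (\<lambda>t. exp (- c * t\<^sup>2)))) {-T..T}" .
  moreover have "(\<lambda>t. complex_of_real (exp (- c * t\<^sup>2))) = (\<lambda>t. exp (- of_real c * (of_real t)\<^sup>2))"
    by (simp add: exp_of_real fun_eq_iff flip: of_real_power of_real_mult of_real_minus)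
  ultimately have eq: "integral {-T..T} (\<lambda>t. exp (- of_real c * (of_real t)\<^sup>2)) =
      complex_of_real (integral {-T..T} (\<lambda>t. exp (- c * t\<^sup>2)))"
    by (intro integral_unique) simp
  have cs: "csqrt (of_real c) = of_real (sqrt c)" using c by simp
  have "\<bar>integral {-T..T} (\<lambda>t. exp (- c * t\<^sup>2)) - sqrt pi / sqrt c\<bar> \<le> (2 * T + 2 / sqrt c) * exp (- c * T\<^sup>2)"
    using integral_cgauss[of "of_real c" T] c T unfolding eq cs
    by (simp flip: of_real_divide of_real_diff add: norm_of_real del: of_real_diff of_real_divide)
  also have "\<dots> \<le> 4 / sqrt c"
  proof -
    have "(sqrt c * T) ^ 1 \<le> fact 1 * (1 / 1) ^ 1 * exp (1 * (sqrt c * T))"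
      by (rule power_le_fact_exp) (use c T in auto)
    have "sqrt c * T \<le> exp ((sqrt c * T)\<^sup>2)"
    proof -
      have "2 * (sqrt c * T) \<le> 1 + (sqrt c * T)\<^sup>2"
        using zero_le_power2[of "sqrt c * T - 1"] by (simp add: power2_eq_square algebra_simps)
      moreover have "1 + (sqrt c * T)\<^sup>2 \<le> exp ((sqrt c * T)\<^sup>2)" by (rule exp_ge_add_one_self)
      moreover have "0 \<le> sqrt c * T" using c T by simp
      ultimately show ?thesis by linarith
    qed
    then have 1: "T * exp (- c * T\<^sup>2) \<le> 1 / sqrt c"
      using c by (simp add: power_mult_distrib exp_minus field_simps)
    have "exp (- c * T\<^sup>2) \<le> 1" using c by simp
    then have 2: "exp (- c * T\<^sup>2) / sqrt c \<le> 1 / sqrt c" using c by (intro divide_right_mono) auto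
    show ?thesis using 1 2 by (simp add: algebra_simps)
  qed
  finally have "integral {-T..T} (\<lambda>t. exp (- c * t\<^sup>2)) \<le> sqrt pi / sqrt c + 4 / sqrt c" by linarith
  moreover have "sqrt pi \<le> sqrt 4" using pi_less_4 by (intro real_sqrt_le_mono) simp
  then have "sqrt pi / sqrt c \<le> 2 / sqrt c" using c by (intro divide_right_mono) auto
  ultimately have "integral {-T..T} (\<lambda>t. exp (- c * t\<^sup>2)) \<le> 2 / sqrt c + 4 / sqrt c" by linarith
  then show ?thesis by simp
qed

text \<open>Write n f = p + q with p = n a t^2. The factor exp (- q) is expanded only so far that
  the terms kept besides g0 are odd in t and will integrate to 0. What is dropped is a Gaussian
  times 1/n times a polynomial in n t^2, so integration gains another 1 / sqrt n.\<close>

lemma laplace_pointwise: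
  fixes f g a b g0 g1 :: complex and n t :: real
  assumes n: "1 \<le> n" and T: "\<bar>t\<bar> \<le> T"
    and f1: "\<kappa> * t\<^sup>2 \<le> Re f" and f2: "cmod (f - a * t\<^sup>2 - b * t ^ 3) \<le> M * t ^ 4"
    and g: "cmod (g - g0 - g1 * t) \<le> M * t\<^sup>2"
    and bds: "cmod b \<le> M" "cmod g0 \<le> M" "cmod g1 \<le> M" and a: "\<kappa> \<le> Re a" and \<kappa>: "0 < \<kappa>"
  shows "cmod (exp (- n * f) * g - exp (- n * a * t\<^sup>2) * (g0 + g1 * t - n * b * g0 * t ^ 3))
    \<le> exp (- n * \<kappa> * t\<^sup>2) / n * ((1 + M + M\<^sup>2 + M ^ 3) * (1 + T)\<^sup>2) * ((n * t\<^sup>2) + 2 * (n * t\<^sup>2)\<^sup>2 + (n * t\<^sup>2) ^ 3)"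
proof -
  define p where "p = n * a * t\<^sup>2"
  define q where "q = n * (f - a * t\<^sup>2)"
  define E where "E = exp (- n * \<kappa> * t\<^sup>2)"
  have M0: "0 \<le> M" using bds norm_ge_zero order_trans by blast
  have T0: "0 \<le> T" using T by linarith
  have E0: "0 \<le> E" by (simp add: E_def)
  have pq: "- n * f = - p + - q" by (simp add: p_def q_def algebra_simps)
  have ep: "cmod (exp (- p)) \<le> E"
  proof -
    have "n * (\<kappa> * t\<^sup>2) \<le> n * (Re a * t\<^sup>2)" using a n by (intro mult_left_mono mult_right_mono) auto
    then show ?thesis by (simp add: p_def E_def mult.assoc flip: of_real_power)
  qed
  have epq: "cmod (exp (- p)) * exp (- Re q) \<le> E"
  proof -
    have "cmod (exp (- p)) * exp (- Re q) = cmod (exp (- p + - q))"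
      by (simp add: exp_add[symmetric])
    also have "\<dots> = cmod (exp (- n * f))" by (simp only: pq)
    also have "\<dots> \<le> E"
      using mult_left_mono[OF f1, of n] n by (simp add: E_def mult.assoc)
    finally show ?thesis .
  qed
  \<comment> \<open>Both |exp (- p)| and |exp (- p - q)| lie below the Gaussian E, the first by
    \<kappa> \<le> Re a, the second by the lower bound on Re f; so the maximum from the Taylor
    bounds costs nothing.\<close>
  have epm: "cmod (exp (- p)) * max 1 (exp (- Re q)) \<le> E"
    using ep epq by (simp add: max_def)
  have qb: "cmod (q - n * b * t ^ 3) \<le> n * M * t ^ 4"
  proof -
    have "q - n * b * t ^ 3 = n * (f - a * t\<^sup>2 - b * t ^ 3)" by (simp add: q_def algebra_simps)
    then have "cmod (q - n * b * t ^ 3) = n * cmod (f - a * t\<^sup>2 - b * t ^ 3)" using n by (simp add: norm_mult)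
    also have "\<dots> \<le> n * (M * t ^ 4)" using n f2 by (intro mult_left_mono) auto
    finally show ?thesis by simp
  qed
  have q3: "cmod q \<le> n * M * (1 + T) * \<bar>t\<bar> ^ 3"
  proof -
    have "cmod q \<le> cmod (q - n * b * t ^ 3) + cmod (n * b * t ^ 3)"
      using norm_triangle_ineq[of "q - n * b * t ^ 3" "n * b * t ^ 3"] by simp
    also have "cmod (n * b * t ^ 3) \<le> n * M * \<bar>t\<bar> ^ 3"
      using n bds by (simp add: norm_mult norm_power mult_right_mono)
    also have "t ^ 4 = \<bar>t\<bar> * \<bar>t\<bar> ^ 3" by (simp add: power_even_abs[symmetric, of 4] power_numeral_reduce)
    have "n * M * t ^ 4 \<le> n * M * (T * \<bar>t\<bar> ^ 3)"
      unfolding \<open>t ^ 4 = _\<close> using n M0 T by (intro mult_left_mono mult_right_mono) auto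
    then have "cmod (q - n * b * t ^ 3) + n * M * \<bar>t\<bar> ^ 3 \<le> n * M * (T * \<bar>t\<bar> ^ 3) + n * M * \<bar>t\<bar> ^ 3"
      using qb by linarith
    finally show ?thesis by (simp add: algebra_simps)
  qed
  have t6: "(\<bar>t\<bar> ^ 3)\<^sup>2 = t ^ 6" by (simp add: power_mult[symmetric] power_even_abs)
  have t4: "\<bar>t\<bar> * \<bar>t\<bar> ^ 3 = t ^ 4" by (simp add: power_even_abs[symmetric, of 4] power_numeral_reduce)
  \<comment> \<open>Exact splitting of the error: the remainder of g, the second-order remainder of
    exp, the quartic remainder of f, and the linear term of g times exp (- q) - 1.\<close>
  have eq: "exp (- n * f) * g - exp (- n * a * t\<^sup>2) * (g0 + g1 * t - n * b * g0 * t ^ 3)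
    = exp (- n * f) * (g - g0 - g1 * t) + g0 * exp (- p) * (exp (- q) - 1 + q)
      - g0 * exp (- p) * (q - n * b * t ^ 3) + g1 * t * exp (- p) * (exp (- q) - 1)"
    unfolding pq exp_add by (simp add: p_def algebra_simps)
  have 1: "cmod (exp (- n * f) * (g - g0 - g1 * t)) \<le> E * (M * t\<^sup>2)"
  proof -
    have "cmod (exp (- n * f)) \<le> E" using mult_left_mono[OF f1, of n] n by (simp add: E_def mult.assoc)
    then show ?thesis unfolding norm_mult using g E0 by (intro mult_mono) auto
  qed
  have 2: "cmod (g0 * exp (- p) * (exp (- q) - 1 + q)) \<le> M * (E * (n * M * (1 + T))\<^sup>2 * t ^ 6)"
  proof -
    have "cmod (exp (- p)) * cmod (exp (- q) - 1 + q) \<le> cmod (exp (- p)) * ((cmod q)\<^sup>2 * max 1 (exp (- Re q)))"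
      by (intro mult_left_mono exp_taylor_1_2) auto
    also have "\<dots> = (cmod (exp (- p)) * max 1 (exp (- Re q))) * (cmod q)\<^sup>2" by simp
    also have "\<dots> \<le> E * (n * M * (1 + T) * \<bar>t\<bar> ^ 3)\<^sup>2"
      using E0 q3 by (intro mult_mono epm power_mono) auto
    also have "\<dots> = E * (n * M * (1 + T))\<^sup>2 * t ^ 6" by (simp add: power_mult_distrib t6)
    finally have *: "cmod (exp (- p)) * cmod (exp (- q) - 1 + q) \<le> E * (n * M * (1 + T))\<^sup>2 * t ^ 6" .
    have "cmod g0 * (cmod (exp (- p)) * cmod (exp (- q) - 1 + q)) \<le> M * (E * (n * M * (1 + T))\<^sup>2 * t ^ 6)"
      by (rule mult_mono[OF bds(2) * M0]) simp
    then show ?thesis by (simp only: norm_mult mult.assoc)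
  qed
  have 3: "cmod (g0 * exp (- p) * (q - n * b * t ^ 3)) \<le> M * (E * (n * M * t ^ 4))"
  proof -
    have "cmod g0 * (cmod (exp (- p)) * cmod (q - n * b * t ^ 3)) \<le> M * (E * (n * M * t ^ 4))"
      by (rule mult_mono[OF bds(2) mult_mono[OF ep qb E0] M0]) auto
    then show ?thesis by (simp only: norm_mult mult.assoc)
  qed
  have 4: "cmod (g1 * t * exp (- p) * (exp (- q) - 1)) \<le> M * (E * (n * M * (1 + T) * t ^ 4))"
  proof -
    have "cmod (exp (- p)) * cmod (exp (- q) - 1) \<le> cmod (exp (- p)) * (cmod q * max 1 (exp (- Re q)))"
      by (intro mult_left_mono exp_taylor_1_2) auto
    also have "\<dots> = (cmod (exp (- p)) * max 1 (exp (- Re q))) * cmod q" by simp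
    also have "\<dots> \<le> E * (n * M * (1 + T) * \<bar>t\<bar> ^ 3)"
      using E0 q3 by (intro mult_mono epm) auto
    finally have "cmod (exp (- p)) * cmod (exp (- q) - 1) * \<bar>t\<bar> \<le> E * (n * M * (1 + T) * \<bar>t\<bar> ^ 3) * \<bar>t\<bar>"
      by (intro mult_right_mono) auto
    also have "\<dots> = E * (n * M * (1 + T) * t ^ 4)" using t4 by (simp add: mult_ac)
    finally have *: "cmod (exp (- p)) * cmod (exp (- q) - 1) * \<bar>t\<bar> \<le> E * (n * M * (1 + T) * t ^ 4)" .
    have "cmod g1 * (cmod (exp (- p)) * cmod (exp (- q) - 1) * \<bar>t\<bar>) \<le> M * (E * (n * M * (1 + T) * t ^ 4))"
      by (rule mult_mono[OF bds(3) * M0]) simp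
    then show ?thesis by (simp add: norm_mult mult_ac)
  qed
  define y where "y = n * t\<^sup>2"
  have y0: "0 \<le> y" using n by (simp add: y_def)
  define K where "K = (1 + M + M\<^sup>2 + M ^ 3) * (1 + T)\<^sup>2"
  have T1: "1 \<le> (1 + T)\<^sup>2" "1 + T \<le> (1 + T)\<^sup>2"
    using T0 by (auto simp: power2_eq_square algebra_simps)
  have K1: "M \<le> K" "M\<^sup>2 \<le> K" "M ^ 3 * (1 + T)\<^sup>2 \<le> K" "M\<^sup>2 * (1 + T) \<le> K"
  proof -
    have "M \<le> (1 + M + M\<^sup>2 + M ^ 3) * 1" using M0 by simp
    also have "\<dots> \<le> K" unfolding K_def using M0 T1 by (intro mult_left_mono) auto
    finally show "M \<le> K" .
    have "M\<^sup>2 \<le> (1 + M + M\<^sup>2 + M ^ 3) * 1" using M0 by simp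
    also have "\<dots> \<le> K" unfolding K_def using M0 T1 by (intro mult_left_mono) auto
    finally show "M\<^sup>2 \<le> K" .
    show "M ^ 3 * (1 + T)\<^sup>2 \<le> K" unfolding K_def using M0 by (intro mult_right_mono) auto
    show "M\<^sup>2 * (1 + T) \<le> K" unfolding K_def using M0 T0 T1 by (intro mult_mono) auto
  qed
  have e1: "E * (M * t\<^sup>2) \<le> E / n * K * y"
  proof -
    have "E * (M * t\<^sup>2) = E / n * M * y" using n by (simp add: y_def)
    also have "\<dots> \<le> E / n * K * y" using n E0 y0 K1 by (intro mult_right_mono mult_left_mono) auto
    finally show ?thesis .
  qed
  have e2: "M * (E * (n * M * (1 + T))\<^sup>2 * t ^ 6) \<le> E / n * K * y ^ 3"
  proof -
    have "M * (E * (n * M * (1 + T))\<^sup>2 * t ^ 6) = E / n * (M ^ 3 * (1 + T)\<^sup>2) * y ^ 3"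
      using n by (simp add: y_def power_mult_distrib power_mult[symmetric] field_simps power2_eq_square power_numeral_reduce)
    also have "\<dots> \<le> E / n * K * y ^ 3" using n E0 y0 K1 by (intro mult_right_mono mult_left_mono) auto
    finally show ?thesis .
  qed
  have e3: "M * (E * (n * M * t ^ 4)) \<le> E / n * K * y\<^sup>2"
  proof -
    have "M * (E * (n * M * t ^ 4)) = E / n * M\<^sup>2 * y\<^sup>2"
      using n by (simp add: y_def power_mult_distrib power_mult[symmetric] field_simps power2_eq_square power_numeral_reduce)
    also have "\<dots> \<le> E / n * K * y\<^sup>2" using n E0 y0 K1 by (intro mult_right_mono mult_left_mono) auto
    finally show ?thesis .
  qed
  have e4: "M * (E * (n * M * (1 + T) * t ^ 4)) \<le> E / n * K * y\<^sup>2"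
  proof -
    have "M * (E * (n * M * (1 + T) * t ^ 4)) = E / n * (M\<^sup>2 * (1 + T)) * y\<^sup>2"
      using n by (simp add: y_def power_mult_distrib power_mult[symmetric] field_simps power2_eq_square power_numeral_reduce)
    also have "\<dots> \<le> E / n * K * y\<^sup>2" using n E0 y0 K1 by (intro mult_right_mono mult_left_mono) auto
    finally show ?thesis .
  qed
  have "cmod (exp (- n * f) * g - exp (- n * a * t\<^sup>2) * (g0 + g1 * t - n * b * g0 * t ^ 3))
      \<le> E * (M * t\<^sup>2) + M * (E * (n * M * (1 + T))\<^sup>2 * t ^ 6) + M * (E * (n * M * t ^ 4))
        + M * (E * (n * M * (1 + T) * t ^ 4))"
    unfolding eq using 1 2 3 4 by (intro norm_triangle_le norm_triangle_le_diff) (auto intro!: add_mono norm_triangle_le norm_triangle_le_diff)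
  also have "\<dots> \<le> E / n * K * y + E / n * K * y ^ 3 + E / n * K * y\<^sup>2 + E / n * K * y\<^sup>2"
    using e1 e2 e3 e4 by linarith
  also have "\<dots> = E / n * K * (y + 2 * y\<^sup>2 + y ^ 3)" by (simp add: algebra_simps)
  finally show ?thesis by (simp add: E_def K_def y_def)
qed

text \<open>The constant depends on \<kappa>, T and M only, so one constant serves all \<beta> in a
  region. The error is smaller by 1/n than the leading term of order n^(-1/2); the prefactor sqrt N
  of the partition function later turns it into O(1/N).\<close>

lemma laplace_method:
  fixes \<kappa> T M :: real
  assumes \<kappa>: "0 < \<kappa>" and T: "0 < T" and M: "0 \<le> M"
  obtains C where "0 < C" and "\<And>n f g a b g0 g1. 1 \<le> n \<Longrightarrow> continuous_on {-T..T} f \<Longrightarrow> continuous_on {-T..T} g \<Longrightarrow>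
     (\<forall>t\<in>{-T..T}. \<kappa> * t\<^sup>2 \<le> Re (f t) \<and> cmod (f t - a * of_real (t\<^sup>2) - b * of_real (t ^ 3)) \<le> M * t ^ 4
        \<and> cmod (g t - g0 - g1 * of_real t) \<le> M * t\<^sup>2) \<Longrightarrow>
     cmod b \<le> M \<Longrightarrow> cmod g0 \<le> M \<Longrightarrow> cmod g1 \<le> M \<Longrightarrow> \<kappa> \<le> Re a \<Longrightarrow>
     cmod (integral {-T..T} (\<lambda>t. exp (- of_real n * f t) * g t) - g0 * of_real (sqrt pi) / csqrt (of_real n * a))
       \<le> C / (n * sqrt n)"
proof -
  \<comment> \<open>Against exp (\<kappa> y / 2) the powers y, 2 y^2 and y^3 cost 1! (2/\<kappa>), 2
    times 2! (2/\<kappa>)^2, and 3! (2/\<kappa>)^3; half of the Gaussian decay is left for the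
    integration.\<close>
  define K where "K = (1 + M + M\<^sup>2 + M ^ 3) * (1 + T)\<^sup>2 * (2 / \<kappa> + 16 / \<kappa>\<^sup>2 + 48 / \<kappa> ^ 3)"
  define C where "C = K * (6 / sqrt (\<kappa> / 2)) + M * (2 * T + 2 / sqrt \<kappa>) * (2 / (\<kappa> * T\<^sup>2)\<^sup>2) + 1"
  have K0: "0 \<le> K" using \<kappa> M T by (simp add: K_def)
  have "0 \<le> K * (6 / sqrt (\<kappa> / 2))" "0 \<le> M * (2 * T + 2 / sqrt \<kappa>) * (2 / (\<kappa> * T\<^sup>2)\<^sup>2)"
    using K0 \<kappa> M T by auto
  then have "0 < C" unfolding C_def by linarith
  then show thesis
  proof (rule that)
    fix n :: real and f g :: "real \<Rightarrow> complex" and a b g0 g1 :: complex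
    assume n: "1 \<le> n" and cf: "continuous_on {-T..T} f" and cg: "continuous_on {-T..T} g"
      and h: "\<forall>t\<in>{-T..T}. \<kappa> * t\<^sup>2 \<le> Re (f t) \<and> cmod (f t - a * of_real (t\<^sup>2) - b * of_real (t ^ 3)) \<le> M * t ^ 4
          \<and> cmod (g t - g0 - g1 * of_real t) \<le> M * t\<^sup>2"
      and bds: "cmod b \<le> M" "cmod g0 \<le> M" "cmod g1 \<le> M" and a: "\<kappa> \<le> Re a"
    define G where "G t = exp (- n * a * t\<^sup>2) * (g0 + g1 * t - n * b * g0 * t ^ 3)" for t :: real
    define G0 where "G0 t = exp (- (n * a) * (complex_of_real t)\<^sup>2)" for t :: real
    define Go where "Go t = exp (- n * a * t\<^sup>2) * (g1 * t - n * b * g0 * t ^ 3)" for t :: real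
    have cont: "continuous_on {-T..T} (\<lambda>t. exp (- of_real n * f t) * g t)" "continuous_on {-T..T} G"
      "continuous_on {-T..T} G0" "continuous_on {-T..T} Go"
      unfolding G_def G0_def Go_def by (intro continuous_intros cf cg)+
    note int = cont[THEN integrable_continuous_real]
    have "G = (\<lambda>t. g0 * G0 t + Go t)"
      by (simp add: G_def G0_def Go_def algebra_simps fun_eq_iff)
    then have "integral {-T..T} G = integral {-T..T} (\<lambda>t. g0 * G0 t + Go t)" by simp
    also have "\<dots> = g0 * integral {-T..T} G0 + integral {-T..T} Go"
    proof -
      have "((\<lambda>t. g0 * G0 t + Go t) has_integral (g0 * integral {-T..T} G0 + integral {-T..T} Go)) {-T..T}"
        by (intro has_integral_add has_integral_mult_right integrable_integral int)
      then show ?thesis by (rule integral_unique)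
    qed
    also have "integral {-T..T} Go = 0"
      by (rule integral_odd_eq_0) (use int in \<open>auto simp: Go_def algebra_simps\<close>)
    finally have IG: "integral {-T..T} G = g0 * integral {-T..T} G0" by simp
    have "cmod (integral {-T..T} (\<lambda>t. exp (- of_real n * f t) * g t) - integral {-T..T} G)
        = cmod (integral {-T..T} (\<lambda>t. exp (- of_real n * f t) * g t - G t))"
      using int by (simp add: Henstock_Kurzweil_Integration.integral_diff)
    also have "\<dots> \<le> integral {-T..T} (\<lambda>t. K / n * exp (- (n * \<kappa> / 2) * t\<^sup>2))"
    proof (rule integral_norm_bound_integral)
      show "(\<lambda>t. exp (- of_real n * f t) * g t - G t) integrable_on {-T..T}"
        using int by (intro integrable_diff)
      show "(\<lambda>t. K / n * exp (- (n * \<kappa> / 2) * t\<^sup>2)) integrable_on {-T..T}"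
        by (intro integrable_continuous_real continuous_intros)
      fix t assume t: "t \<in> {-T..T}"
      define y where "y = n * t\<^sup>2"
      have y0: "0 \<le> y" using n by (simp add: y_def)
      have "cmod (exp (- of_real n * f t) * g t - G t)
         \<le> exp (- n * \<kappa> * t\<^sup>2) / n * ((1 + M + M\<^sup>2 + M ^ 3) * (1 + T)\<^sup>2) * (y + 2 * y\<^sup>2 + y ^ 3)"
      proof -
        have tT: "\<bar>t\<bar> \<le> T" using t by auto
        have "\<kappa> * t\<^sup>2 \<le> Re (f t)" "cmod (f t - a * of_real (t\<^sup>2) - b * of_real (t ^ 3)) \<le> M * t ^ 4"
          "cmod (g t - g0 - g1 * of_real t) \<le> M * t\<^sup>2" using h t by auto
        from laplace_pointwise[OF n tT this bds a \<kappa>] show ?thesis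
          by (simp add: G_def y_def)
      qed
      also have "\<dots> \<le> exp (- n * \<kappa> * t\<^sup>2) / n * ((1 + M + M\<^sup>2 + M ^ 3) * (1 + T)\<^sup>2) *
          ((2 / \<kappa> + 16 / \<kappa>\<^sup>2 + 48 / \<kappa> ^ 3) * exp (\<kappa> / 2 * y))"
      proof (rule mult_left_mono)
        have k2: "0 < \<kappa> / 2" using \<kappa> by simp
        have "y \<le> 2 / \<kappa> * exp (\<kappa> / 2 * y)" "y\<^sup>2 \<le> 8 / \<kappa>\<^sup>2 * exp (\<kappa> / 2 * y)" "y ^ 3 \<le> 48 / \<kappa> ^ 3 * exp (\<kappa> / 2 * y)"
          using power_le_fact_exp[OF k2 y0, of 1] power_le_fact_exp[OF k2 y0, of 2] power_le_fact_exp[OF k2 y0, of 3]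
          by (simp_all add: power_divide fact_numeral)
        then show "y + 2 * y\<^sup>2 + y ^ 3 \<le> (2 / \<kappa> + 16 / \<kappa>\<^sup>2 + 48 / \<kappa> ^ 3) * exp (\<kappa> / 2 * y)"
          by (simp add: algebra_simps)
        show "0 \<le> exp (- n * \<kappa> * t\<^sup>2) / n * ((1 + M + M\<^sup>2 + M ^ 3) * (1 + T)\<^sup>2)" using n M T by auto
      qed
      also have "\<dots> = K / n * (exp (- n * \<kappa> * t\<^sup>2) * exp (\<kappa> / 2 * y))" by (simp add: K_def)
      also have "exp (- n * \<kappa> * t\<^sup>2) * exp (\<kappa> / 2 * y) = exp (- (n * \<kappa> / 2) * t\<^sup>2)"
        by (simp add: exp_add[symmetric] y_def algebra_simps)
      finally show "cmod (exp (- of_real n * f t) * g t - G t) \<le> K / n * exp (- (n * \<kappa> / 2) * t\<^sup>2)" .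
    qed
    also have "\<dots> = K / n * integral {-T..T} (\<lambda>t. exp (- (n * \<kappa> / 2) * t\<^sup>2))" by simp
    also have "\<dots> \<le> K / n * (6 / sqrt (n * \<kappa> / 2))"
      using K0 n \<kappa> T by (intro mult_left_mono integral_gauss_le) auto
    also have "\<dots> = K * (6 / sqrt (\<kappa> / 2)) / (n * sqrt n)" using n \<kappa> by (simp add: real_sqrt_mult real_sqrt_divide)
    finally have A: "cmod (integral {-T..T} (\<lambda>t. exp (- of_real n * f t) * g t) - g0 * integral {-T..T} G0)
        \<le> K * (6 / sqrt (\<kappa> / 2)) / (n * sqrt n)" unfolding IG .
    have ra: "0 < Re a" using a \<kappa> by linarith
    have nk: "\<kappa> \<le> cmod (n * a)"
    proof -
      have "\<kappa> \<le> cmod a" using a complex_Re_le_cmod[of a] by linarith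
      also have "\<dots> \<le> n * cmod a" using n by (simp add: mult_le_cancel_right1)
      finally show ?thesis using n by (simp add: norm_mult)
    qed
    have "cmod (integral {-T..T} G0 - of_real (sqrt pi) / csqrt (n * a))
        \<le> (2 * T + 2 / sqrt (cmod (n * a))) * exp (- Re (n * a) * T\<^sup>2)"
      unfolding G0_def by (rule integral_cgauss) (use n ra T in auto)
    also have "\<dots> \<le> (2 * T + 2 / sqrt \<kappa>) * (2 / (\<kappa> * T\<^sup>2)\<^sup>2 / (n * sqrt n))"
    proof (rule mult_mono)
      show "2 * T + 2 / sqrt (cmod (n * a)) \<le> 2 * T + 2 / sqrt \<kappa>"
        using nk \<kappa> less_le_trans[OF \<kappa> nk]
        by (intro add_left_mono divide_left_mono real_sqrt_le_mono mult_pos_pos) auto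
      have kT: "0 < \<kappa> * T\<^sup>2" using \<kappa> T by simp
      have "exp (- Re (n * a) * T\<^sup>2) \<le> exp (- (n * (\<kappa> * T\<^sup>2)))"
        using a n by (simp add: mult_left_mono mult_right_mono)
      also have "\<dots> \<le> 2 / (\<kappa> * T\<^sup>2)\<^sup>2 / n\<^sup>2"
      proof -
        define c where "c = \<kappa> * T\<^sup>2"
        have "n\<^sup>2 \<le> 2 / c\<^sup>2 * exp (n * c)"
          using power_le_fact_exp[OF kT, of n 2] n by (simp add: c_def power_divide mult.commute)
        then have "n\<^sup>2 * exp (- (n * c)) \<le> 2 / c\<^sup>2" by (simp add: exp_minus field_simps)
        moreover have "0 < n\<^sup>2" using n by simp
        ultimately have "exp (- (n * c)) \<le> 2 / c\<^sup>2 / n\<^sup>2"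
          by (simp only: pos_le_divide_eq mult.commute)
        then show ?thesis by (simp add: c_def)
      qed
      also have "\<dots> \<le> 2 / (\<kappa> * T\<^sup>2)\<^sup>2 / (n * sqrt n)"
      proof (rule divide_left_mono)
        have "sqrt n \<le> n" using n by (intro real_le_lsqrt self_le_power) auto
        then show "n * sqrt n \<le> n\<^sup>2" using n by (simp add: power2_eq_square)
      qed (use n kT in auto)
      finally show "exp (- Re (n * a) * T\<^sup>2) \<le> 2 / (\<kappa> * T\<^sup>2)\<^sup>2 / (n * sqrt n)" .
    qed (use \<kappa> T in auto)
    finally have B: "cmod (integral {-T..T} G0 - of_real (sqrt pi) / csqrt (n * a))
        \<le> (2 * T + 2 / sqrt \<kappa>) * (2 / (\<kappa> * T\<^sup>2)\<^sup>2 / (n * sqrt n))" .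
    have "cmod (g0 * (integral {-T..T} G0 - of_real (sqrt pi) / csqrt (n * a)))
        \<le> M * ((2 * T + 2 / sqrt \<kappa>) * (2 / (\<kappa> * T\<^sup>2)\<^sup>2 / (n * sqrt n)))"
      unfolding norm_mult using B bds M by (intro mult_mono) auto
    with A have "cmod ((integral {-T..T} (\<lambda>t. exp (- of_real n * f t) * g t) - g0 * integral {-T..T} G0)
        + g0 * (integral {-T..T} G0 - of_real (sqrt pi) / csqrt (n * a)))
      \<le> K * (6 / sqrt (\<kappa> / 2)) / (n * sqrt n) + M * ((2 * T + 2 / sqrt \<kappa>) * (2 / (\<kappa> * T\<^sup>2)\<^sup>2 / (n * sqrt n)))"
      by (intro norm_triangle_le add_mono)
    also have "\<dots> = (C - 1) / (n * sqrt n)" 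
      by (simp only: C_def add_diff_cancel_right' add_divide_distrib times_divide_eq_right mult.assoc)
    also have "\<dots> \<le> C / (n * sqrt n)" using n by (intro divide_right_mono) auto
    finally show "cmod (integral {-T..T} (\<lambda>t. exp (- of_real n * f t) * g t) - g0 * of_real (sqrt pi) / csqrt (of_real n * a))
         \<le> C / (n * sqrt n)" by (simp add: algebra_simps)
  qed
qed

section \<open>The function log cosh in the variable z = u^2\<close>

lemma small_in_slit_plane: "cmod u < 1 \<Longrightarrow> u \<in> slit_plane"
  using abs_Im_le_cmod[of u] pi_gt3 by (auto simp: slit_plane_def)

lemma uminus_slit_plane: "u \<in> slit_plane \<Longrightarrow> - u \<in> slit_plane"
  and cnj_slit_plane: "u \<in> slit_plane \<Longrightarrow> cnj u \<in> slit_plane"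
  by (auto simp: slit_plane_def)

text \<open>\<open>log_cosh\<close> is known only through its characterisation, so its symmetries
  come from uniqueness: the reflected function meets the same conditions. Conjugation below is
  handled alike.\<close>

lemma log_cosh_minus:
  assumes "u \<in> slit_plane"
  shows "log_cosh (- u) = log_cosh u"
proof (rule log_cosh_unique[where f = "\<lambda>u. log_cosh (- u)", OF _ _ _ assms])
  have "(log_cosh \<circ> uminus) holomorphic_on slit_plane"
    by (rule holomorphic_on_compose_gen[OF _ holomorphic_on_log_cosh])
       (auto intro!: holomorphic_intros uminus_slit_plane)
  then show "(\<lambda>u. log_cosh (- u)) holomorphic_on slit_plane" by (simp add: o_def)
qed (auto simp: log_cosh_0 exp_log_cosh uminus_slit_plane)

lemma log_cosh_cnj:
  assumes "u \<in> slit_plane"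
  shows "log_cosh (cnj u) = cnj (log_cosh u)"
proof -
  have "log_cosh holomorphic_on cnj ` slit_plane"
    by (rule holomorphic_on_subset[OF holomorphic_on_log_cosh]) (auto intro: cnj_slit_plane)
  then have h: "(\<lambda>u. cnj (log_cosh (cnj u))) holomorphic_on slit_plane"
    using holomorphic_on_compose_cnj_cnj[OF _ open_slit_plane] by (simp add: o_def)
  have cosh: "cosh (cnj v) = cnj (cosh v)" for v :: complex
    by (simp add: cosh_def exp_cnj flip: complex_cnj_minus)
  have "cnj (log_cosh (cnj u)) = log_cosh u"
    by (rule log_cosh_unique[where f = "\<lambda>u. cnj (log_cosh (cnj u))", OF h _ _ assms])
       (auto simp: log_cosh_0 exp_cnj[symmetric] exp_log_cosh cnj_slit_plane cosh)
  then show ?thesis by (metis complex_cnj_cnj)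
qed

text \<open>Since log cosh is even, the choice of the root is immaterial and the cut of
  \<open>csqrt\<close> leaves no trace; near 0 the function is z/2 - z^2/12 + ...\<close>

definition lc :: "complex \<Rightarrow> complex" where
  "lc z = log_cosh (csqrt z)"

lemma lc_power2:
  assumes "u \<in> slit_plane"
  shows "lc (u\<^sup>2) = log_cosh u"
proof -
  have "(csqrt (u\<^sup>2))\<^sup>2 = u\<^sup>2" by simp
  then have "csqrt (u\<^sup>2) = u \<or> csqrt (u\<^sup>2) = - u" by (rule power2_eq_iff[THEN iffD1])
  then show ?thesis using log_cosh_minus[OF assms] by (auto simp: lc_def)
qed

lemma norm_csqrt_less_1: "cmod z < 1 \<Longrightarrow> cmod (csqrt z) < 1"
  by (simp add: norm_csqrt)

text \<open>\<open>csqrt\<close> serves the complement of the negative axis, and the other root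
  \<open>\<i> * csqrt (- z)\<close> the complement of the positive axis; evenness makes both give
  the same function. The origin, the only point missed, is removable by continuity.\<close>

lemma lc_holomorphic: "lc holomorphic_on ball 0 1"
proof (rule no_isolated_singularity'[where K = "{0}"])
  fix z :: complex assume "z \<in> {0}"
  then have z: "z = 0" by simp
  have "isCont csqrt 0" unfolding isCont_def
  proof (rule tendsto_norm_zero_cancel[THEN tendsto_eq_rhs])
    have "((\<lambda>w. sqrt (cmod w)) \<longlongrightarrow> sqrt (cmod 0)) (at (0::complex))" by (intro tendsto_intros)
    then show "((\<lambda>w. cmod (csqrt w)) \<longlongrightarrow> 0) (at 0)" by (simp add: norm_csqrt)
  qed simp
  moreover have "isCont log_cosh (csqrt 0)"
    using holomorphic_on_imp_differentiable_at[OF holomorphic_on_log_cosh open_slit_plane, of 0]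
    by (simp add: zero_in_slit_plane field_differentiable_imp_continuous_at)
  ultimately have "isCont lc 0" unfolding lc_def[abs_def] by (rule isCont_o2)
  then show "(lc \<longlongrightarrow> lc z) (at z within ball 0 1)"
    unfolding z isCont_def by (rule tendsto_within_subset) simp
next
  show "lc holomorphic_on ball 0 1 - {0}"
  proof (rule holomorphic_on_subset[of _ "(ball 0 1 - \<real>\<^sub>\<le>\<^sub>0) \<union> (ball 0 1 - \<real>\<^sub>\<ge>\<^sub>0)"])
    have 1: "lc holomorphic_on (ball 0 1 - \<real>\<^sub>\<le>\<^sub>0)"
    proof -
      have "(log_cosh \<circ> csqrt) holomorphic_on (ball 0 1 - \<real>\<^sub>\<le>\<^sub>0)"
        by (rule holomorphic_on_compose_gen[OF _ holomorphic_on_log_cosh])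
           (auto intro!: holomorphic_intros small_in_slit_plane norm_csqrt_less_1)
      then show ?thesis by (simp add: o_def lc_def[abs_def])
    qed
    have 2: "lc holomorphic_on (ball 0 1 - \<real>\<^sub>\<ge>\<^sub>0)"
    proof -
      have sl: "\<i> * csqrt (- z) \<in> slit_plane" if "cmod z < 1" for z
        using norm_csqrt_less_1[of "- z"] that by (intro small_in_slit_plane) (simp add: norm_mult)
      have "(log_cosh \<circ> (\<lambda>z. \<i> * csqrt (- z))) holomorphic_on (ball 0 1 - \<real>\<^sub>\<ge>\<^sub>0)"
        by (rule holomorphic_on_compose_gen[OF _ holomorphic_on_log_cosh])
           (auto intro!: holomorphic_intros sl)
      moreover have "(log_cosh \<circ> (\<lambda>z. \<i> * csqrt (- z))) z = lc z" if "z \<in> ball 0 1 - \<real>\<^sub>\<ge>\<^sub>0" for z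
        using lc_power2[OF sl[of z]] that by (simp add: power_mult_distrib)
      ultimately show ?thesis by (rule holomorphic_transform)
    qed
    have "open (ball 0 1 - \<real>\<^sub>\<le>\<^sub>0 :: complex set)" "open (ball 0 1 - \<real>\<^sub>\<ge>\<^sub>0 :: complex set)"
      by (auto intro!: open_Diff)
    with 1 2 show "lc holomorphic_on (ball 0 1 - \<real>\<^sub>\<le>\<^sub>0) \<union> (ball 0 1 - \<real>\<^sub>\<ge>\<^sub>0)"
      by (intro holomorphic_on_Un) auto
    show "ball 0 1 - {0} \<subseteq> (ball 0 1 - \<real>\<^sub>\<le>\<^sub>0) \<union> (ball 0 1 - \<real>\<^sub>\<ge>\<^sub>0 :: complex set)"
      by (auto simp: complex_nonneg_Reals_iff complex_nonpos_Reals_iff complex_eq_iff)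
  qed
qed auto

lemma lc_cnj:
  assumes "cmod z < 1"
  shows "lc (cnj z) = cnj (lc z)"
proof -
  have s: "csqrt z \<in> slit_plane" using assms by (intro small_in_slit_plane norm_csqrt_less_1)
  have "lc (cnj z) = lc ((cnj (csqrt z))\<^sup>2)" by (simp flip: complex_cnj_power)
  also have "\<dots> = log_cosh (cnj (csqrt z))" by (rule lc_power2[OF cnj_slit_plane[OF s]])
  also have "\<dots> = cnj (lc z)" by (simp add: log_cosh_cnj[OF s] lc_def)
  finally show ?thesis .
qed

lemma DERIV_lc: "cmod z < 1 \<Longrightarrow> (lc has_field_derivative deriv lc z) (at z)"
  by (rule holomorphic_derivI[OF lc_holomorphic open_ball]) simp

lemma DERIV_lc1: "cmod z < 1 \<Longrightarrow> (deriv lc has_field_derivative deriv (deriv lc) z) (at z)"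
  by (rule holomorphic_derivI[OF holomorphic_deriv[OF lc_holomorphic open_ball] open_ball]) simp

lemma deriv_lc_power2:
  assumes "cmod u < 1"
  shows "2 * u * deriv lc (u\<^sup>2) = tanh u"
proof -
  have u2: "cmod (u\<^sup>2) < 1" using assms by (simp add: norm_power power_less_one_iff)
  have "((\<lambda>u. lc (u\<^sup>2)) has_field_derivative deriv lc (u\<^sup>2) * (2 * u)) (at u)"
    by (rule DERIV_chain2[where f = lc and g = "\<lambda>u. u\<^sup>2" and x = u, OF DERIV_lc[OF u2]]) (auto intro!: derivative_eq_intros)
  moreover have "((\<lambda>u. lc (u\<^sup>2)) has_field_derivative tanh u) (at u)"
  proof (rule has_field_derivative_transform_within_open)
    show "(log_cosh has_field_derivative tanh u) (at u)"
      by (rule has_field_derivative_log_branch[OF holomorphic_on_log_cosh])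
         (auto intro: exp_log_cosh small_in_slit_plane[OF assms])
    show "open slit_plane" by (rule open_slit_plane)
  qed (auto simp: lc_power2 small_in_slit_plane[OF assms])
  ultimately show ?thesis using DERIV_unique by fastforce
qed

text \<open>From \<open>tanh' = 1 - tanh\<^sup>2\<close> in the variable \<open>z = u\<^sup>2\<close>, where \<open>lc' z = tanh u / (2 u)\<close>.\<close>
lemma lc_ode:
  assumes "cmod z < 1"
  shows "2 * deriv lc z + 4 * z * deriv (deriv lc) z + 4 * z * (deriv lc z)\<^sup>2 = 1"
proof -
  define u where "u = csqrt z"
  have u: "cmod u < 1" and z: "u\<^sup>2 = z" using assms by (auto simp: u_def norm_csqrt_less_1)
  have u2: "cmod (u\<^sup>2) < 1" using assms z by simp
  have "((\<lambda>u. deriv lc (u\<^sup>2)) has_field_derivative deriv (deriv lc) (u\<^sup>2) * (2 * u)) (at u)"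
    by (rule DERIV_chain2[where f = "deriv lc" and g = "\<lambda>u. u\<^sup>2" and x = u, OF DERIV_lc1[OF u2]]) (auto intro!: derivative_eq_intros)
  then have "((\<lambda>u. 2 * u * deriv lc (u\<^sup>2)) has_field_derivative
      (2 * deriv lc (u\<^sup>2) + 2 * u * (deriv (deriv lc) (u\<^sup>2) * (2 * u)))) (at u)"
    by (auto intro!: derivative_eq_intros)
  moreover have "((\<lambda>u. 2 * u * deriv lc (u\<^sup>2)) has_field_derivative (1 - (tanh u)\<^sup>2)) (at u)"
  proof (rule has_field_derivative_transform_within_open[where S = "ball 0 1"])
    have "cosh u \<noteq> 0" using cosh_nonzero_on_slit_plane[OF small_in_slit_plane[OF u]] .
    then show "(tanh has_field_derivative (1 - (tanh u)\<^sup>2)) (at u)"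
      by (auto intro!: derivative_eq_intros)
  qed (auto simp: u deriv_lc_power2)
  ultimately have "2 * deriv lc (u\<^sup>2) + 2 * u * (deriv (deriv lc) (u\<^sup>2) * (2 * u)) = 1 - (tanh u)\<^sup>2"
    by (rule DERIV_unique)
  then show ?thesis
    unfolding deriv_lc_power2[OF u, symmetric] z[symmetric]
    by (simp add: power2_eq_square algebra_simps)
qed

text \<open>\<open>lc_ode\<close> determines these values: at z = 0 it gives the first derivative,
  and differentiated once at 0 it reads 6 lc'' + 4 (lc')^2 = 0.\<close>

lemma lc_0: "lc 0 = 0" and deriv_lc_0: "deriv lc 0 = 1 / 2" and deriv2_lc_0: "deriv (deriv lc) 0 = - 1 / 6"
proof -
  show "lc 0 = 0" by (simp add: lc_def log_cosh_0)
  show d1: "deriv lc 0 = 1 / 2" using lc_ode[of 0] by (simp add: field_simps)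
  have "(deriv (deriv lc) has_field_derivative deriv (deriv (deriv lc)) 0) (at 0)"
    by (rule holomorphic_derivI[OF holomorphic_deriv[OF holomorphic_deriv[OF lc_holomorphic open_ball] open_ball] open_ball]) simp
  then have "((\<lambda>z. 2 * deriv lc z + 4 * z * deriv (deriv lc) z + 4 * z * (deriv lc z)\<^sup>2) has_field_derivative
      (6 * deriv (deriv lc) 0 + 4 * (deriv lc 0)\<^sup>2)) (at 0)"
    using DERIV_lc1[of 0] by (auto intro!: derivative_eq_intros)
  moreover have "((\<lambda>z. 2 * deriv lc z + 4 * z * deriv (deriv lc) z + 4 * z * (deriv lc z)\<^sup>2) has_field_derivative 0) (at 0)"
    by (rule has_field_derivative_transform_within_open[where S = "ball 0 1", OF DERIV_const[of 1]])
       (auto simp: lc_ode)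
  ultimately have "6 * deriv (deriv lc) 0 + 4 * (deriv lc 0)\<^sup>2 = 0" by (rule DERIV_unique)
  then have "6 * deriv (deriv lc) 0 + 1 = 0" by (simp add: d1 power2_eq_square)
  then have "6 * deriv (deriv lc) 0 = - 1" by (rule eq_neg_iff_add_eq_0[THEN iffD2])
  then show "deriv (deriv lc) 0 = - 1 / 6" by (simp add: field_simps)
qed

text \<open>The bound on the second derivative is integrated twice. The base point w is arbitrary in
  the disc and the quadratic coefficient is - 1/12 for all of them: w = 0 describes the saddle 0,
  and w = z_\<beta> the other one.\<close>

lemma lc_quadratic:
  fixes z w :: complex
  assumes R: "R < 1" and B: "\<And>z::complex. cmod z \<le> R \<Longrightarrow> cmod (deriv (deriv lc) z + 1 / 6) \<le> \<eta>"
    and z: "cmod z \<le> R" and w: "cmod w \<le> R"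
  shows lc_quadratic_0: "cmod (lc z - lc w - deriv lc w * (z - w) + (z - w)\<^sup>2 / 12) \<le> \<eta> * (cmod (z - w))\<^sup>2"
    and lc_quadratic_1: "cmod (deriv lc z - deriv lc w + (z - w) / 6) \<le> \<eta> * cmod (z - w)"
proof -
  have bound1: "cmod (deriv lc x - deriv lc w + (x - w) / 6) \<le> \<eta> * cmod (x - w)" if x: "cmod x \<le> R" for x
  proof -
    have "cmod ((deriv lc x + x / 6) - (deriv lc w + w / 6)) \<le> \<eta> * cmod (x - w)"
    proof (rule field_differentiable_bound[where S = "cball 0 R"])
      fix y :: complex assume "y \<in> cball 0 R"
      then have y: "cmod y \<le> R" by simp
      show "((\<lambda>x. deriv lc x + x / 6) has_field_derivative deriv (deriv lc) y + 1 / 6) (at y within cball 0 R)"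
        by (rule has_field_derivative_at_within) (use y R in \<open>auto intro!: derivative_eq_intros DERIV_lc1\<close>)
      show "cmod (deriv (deriv lc) y + 1 / 6) \<le> \<eta>" by (rule B[OF y])
    qed (use x w in auto)
    moreover have "(deriv lc x + x / 6) - (deriv lc w + w / 6) = deriv lc x - deriv lc w + (x - w) / 6"
      by (simp add: diff_divide_distrib)
    ultimately show ?thesis by simp
  qed
  then show "cmod (deriv lc z - deriv lc w + (z - w) / 6) \<le> \<eta> * cmod (z - w)" using z .
  define h where "h x = lc x - deriv lc w * (x - w) + (x - w)\<^sup>2 / 12" for x
  have \<eta>: "0 \<le> \<eta>" using B[OF w] norm_ge_zero order_trans by blast
  have seg: "closed_segment w z \<subseteq> cball 0 R"
    by (rule closed_segment_subset) (use z w in auto)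
  have "cmod (h z - h w) \<le> (\<eta> * cmod (z - w)) * cmod (z - w)"
  proof (rule field_differentiable_bound[where S = "closed_segment w z"])
    fix x assume xs: "x \<in> closed_segment w z"
    then have x: "cmod x \<le> R" using seg by auto
    show "(h has_field_derivative (deriv lc x - deriv lc w + (x - w) / 6)) (at x within closed_segment w z)"
      unfolding h_def by (rule has_field_derivative_at_within)
        (use x R in \<open>auto intro!: derivative_eq_intros DERIV_lc\<close>)
    have "cmod (x - w) \<le> cmod (z - w)"
      using segment_bound(1)[OF xs] by (simp add: norm_minus_commute)
    then show "cmod (deriv lc x - deriv lc w + (x - w) / 6) \<le> \<eta> * cmod (z - w)"
      using bound1[OF x] \<eta> by (meson mult_left_mono order_trans)
  qed auto
  then show "cmod (lc z - lc w - deriv lc w * (z - w) + (z - w)\<^sup>2 / 12) \<le> \<eta> * (cmod (z - w))\<^sup>2"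
    by (simp add: h_def power2_eq_square algebra_simps)
qed

lemma deriv_lc_inj:
  assumes R: "R < 1" and B: "\<And>z::complex. cmod z \<le> R \<Longrightarrow> cmod (deriv (deriv lc) z + 1 / 6) \<le> 1 / 10000"
    and z: "cmod z \<le> R" and w: "cmod w \<le> R" and eq: "deriv lc z = deriv lc w"
  shows "z = w"
proof -
  have "cmod (z - w) / 6 \<le> 1 / 10000 * cmod (z - w)"
    using lc_quadratic_1[OF R B z w] eq by (simp add: norm_divide)
  then show ?thesis by simp
qed

section \<open>The saddle z_\<beta> as a holomorphic function of \<beta>\<close>

lemma norm_inverse_near_1:
  assumes "cmod (\<beta> - 1) \<le> 1 / 1000"
  shows "\<beta> \<noteq> 0" "cmod \<beta> \<le> 1001 / 1000" "999 / 1000 \<le> cmod \<beta>"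
    "cmod (1 / \<beta> - 1) \<le> 1002 / 1000 * cmod (\<beta> - 1)" "cmod (1 / \<beta>\<^sup>2 - 1) \<le> 21 / 10 * cmod (\<beta> - 1)" "cmod (1 / \<beta>) \<le> 1002 / 1000"
proof -
  show b: "cmod \<beta> \<le> 1001 / 1000" "999 / 1000 \<le> cmod \<beta>"
    using assms norm_triangle_ineq2[of \<beta> 1] norm_triangle_ineq2[of 1 \<beta>] by (auto simp: norm_minus_commute)
  then show b0: "\<beta> \<noteq> 0" by auto
  have "1 / cmod \<beta> \<le> 1 / (999 / 1000)" using b by (intro divide_left_mono) auto
  also have "\<dots> \<le> 1002 / 1000" by simp
  finally have i: "1 / cmod \<beta> \<le> 1002 / 1000" .
  then show "cmod (1 / \<beta>) \<le> 1002 / 1000" by (simp add: norm_divide)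
  have "1 / \<beta> - 1 = (1 / \<beta>) * (1 - \<beta>)" using b0 by (simp add: field_simps)
  then have "cmod (1 / \<beta> - 1) = 1 / cmod \<beta> * cmod (\<beta> - 1)"
    by (metis norm_minus_commute norm_mult norm_divide norm_one)
  also have "\<dots> \<le> 1002 / 1000 * cmod (\<beta> - 1)" by (rule mult_right_mono[OF i]) simp
  finally show e1: "cmod (1 / \<beta> - 1) \<le> 1002 / 1000 * cmod (\<beta> - 1)" .
  have "1 / \<beta>\<^sup>2 - 1 = (1 / \<beta> - 1) * (1 / \<beta> + 1)" using b0 by (simp add: field_simps power2_eq_square)
  then have "cmod (1 / \<beta>\<^sup>2 - 1) = cmod (1 / \<beta> - 1) * cmod (1 / \<beta> + 1)" by (simp add: norm_mult)
  also have "\<dots> \<le> (1002 / 1000 * cmod (\<beta> - 1)) * (2002 / 1000)"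
  proof (rule mult_mono[OF e1])
    have "cmod (1 / \<beta> + 1) \<le> cmod (1 / \<beta>) + cmod 1" by (rule norm_triangle_ineq)
    also have "cmod (1 / \<beta>) \<le> 1002 / 1000" using i by (simp add: norm_divide)
    finally show "cmod (1 / \<beta> + 1) \<le> 2002 / 1000" by simp
  qed auto
  also have "\<dots> \<le> 21 / 10 * cmod (\<beta> - 1)" by simp
  finally show "cmod (1 / \<beta>\<^sup>2 - 1) \<le> 21 / 10 * cmod (\<beta> - 1)" .
qed

text \<open>\<open>zs \<beta>\<close> is \<open>u\<^sub>\<beta>\<^sup>2\<close>, which unlike \<open>u\<^sub>\<beta>\<close> is holomorphic at \<open>\<beta> = 1\<close>; \<open>zs_eq\<close> is the saddle point
  equation \<open>tanh u / u = 1 / \<beta>\<close>.\<close>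
locale local_saddle =
  fixes r c1 :: real and zs :: "complex \<Rightarrow> complex"
  assumes r: "0 < r" "r \<le> 1 / 8"
    and lc2: "cmod z \<le> 4 * r \<Longrightarrow> cmod (deriv (deriv lc) z + 1 / 6) \<le> 1 / 10000"
    and c1: "0 < c1" "c1 \<le> r / 1000"
    and zs_holomorphic: "zs holomorphic_on ball 1 c1"
    and zs_eq: "\<beta> \<in> ball 1 c1 \<Longrightarrow> deriv lc (zs \<beta>) = 1 / (2 * \<beta>)"
    and zs_small: "\<beta> \<in> ball 1 c1 \<Longrightarrow> cmod (zs \<beta>) \<le> 4 * r"

text \<open>On a small disc of radius 4 r the second derivative of \<open>lc\<close> stays near its
  value - 1/6 at 0, so \<open>deriv lc\<close> is injective there; its inverse, applied to 1 / (2
  \<beta>), is the saddle. The open image contains \<open>deriv lc 0 = 1 / 2\<close>, which leaves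
  room for \<beta> near 1.\<close>

lemma local_saddle_exists:
  fixes c0 :: real
  assumes c0: "0 < c0"
  shows "\<exists>r c1 zs. local_saddle r c1 zs \<and> c1 \<le> c0"
proof -
  have hol1: "deriv lc holomorphic_on ball 0 1" and hol2: "deriv (deriv lc) holomorphic_on ball 0 1"
    by (intro holomorphic_deriv lc_holomorphic open_ball)+
  have "isCont (deriv (deriv lc)) 0"
    using holomorphic_on_imp_continuous_on[OF hol2] by (auto simp: continuous_on_eq_continuous_at)
  then obtain d where d: "0 < d" and dd: "\<And>z. dist z 0 < d \<Longrightarrow> dist (deriv (deriv lc) z) (deriv (deriv lc) 0) < 1 / 10000"
    unfolding continuous_at_eps_delta by (metis divide_pos_pos zero_less_one zero_less_numeral)
  define r where "r = min (1 / 8) (d / 8)"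
  have r: "0 < r" "r \<le> 1 / 8" "4 * r < d" using d by (auto simp: r_def min_def)
  have lc2: "cmod (deriv (deriv lc) z + 1 / 6) \<le> 1 / 10000" if "cmod z \<le> 4 * r" for z
    using dd[of z] that r by (simp add: dist_norm deriv2_lc_0)
  have r1: "4 * r < 1" using r by simp
  have inj: "inj_on (deriv lc) (ball 0 (4 * r))"
    by (rule inj_onI, rule deriv_lc_inj[OF r1 lc2]) auto
  have sub: "ball 0 (4 * r) \<subseteq> ball (0::complex) 1" using r by (intro subset_ball) auto
  obtain g where g: "g holomorphic_on (deriv lc ` ball 0 (4 * r))"
    and gi: "\<And>z. z \<in> ball 0 (4 * r) \<Longrightarrow> g (deriv lc z) = z"
    using holomorphic_has_inverse[OF holomorphic_on_subset[OF hol1 sub] open_ball inj] by metis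
  have "open (deriv lc ` ball 0 (4 * r))"
    by (rule open_mapping_thm3[OF holomorphic_on_subset[OF hol1 sub] open_ball inj])
  moreover have "1 / 2 \<in> deriv lc ` ball 0 (4 * r)"
    using r by (intro image_eqI[of _ _ 0]) (auto simp: deriv_lc_0)
  ultimately obtain e where e: "0 < e" and eb: "ball (1 / 2) e \<subseteq> deriv lc ` ball 0 (4 * r)"
    by (meson open_contains_ball)
  \<comment> \<open>\<open>r / 1000\<close> makes the saddle and the linear coefficient 1 / \<beta>
    - 1 negligible against r; \<open>e / 2\<close> keeps 1 / (2 \<beta>) in the image.\<close>
  define c1 where "c1 = min c0 (min (r / 1000) (e / 2))"
  have c1: "0 < c1" "c1 \<le> c0" "c1 \<le> r / 1000" "c1 \<le> e / 2"
    using c0 r e by (auto simp: c1_def min_def)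
  define zs where "zs \<beta> = g (1 / (2 * \<beta>))" for \<beta>
  have im: "1 / (2 * \<beta>) \<in> deriv lc ` ball 0 (4 * r)" and b0: "\<beta> \<noteq> 0" if "\<beta> \<in> ball 1 c1" for \<beta>
  proof -
    have b: "cmod (\<beta> - 1) < c1" using that by (simp add: dist_norm norm_minus_commute)
    then have b': "cmod (\<beta> - 1) \<le> 1 / 1000" using c1 r by simp
    show "\<beta> \<noteq> 0" by (rule norm_inverse_near_1(1)[OF b'])
    have "1 / 2 - 1 / (2 * \<beta>) = - (1 / \<beta> - 1) / 2" by simp
    then have "cmod (1 / 2 - 1 / (2 * \<beta>)) = cmod (1 / \<beta> - 1) / 2"
      by (metis norm_divide norm_minus_cancel norm_numeral)
    also have "\<dots> < e" using norm_inverse_near_1(4)[OF b'] b c1 e norm_ge_zero[of "\<beta> - 1"] by linarith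
    finally show "1 / (2 * \<beta>) \<in> deriv lc ` ball 0 (4 * r)" using eb by (auto simp: dist_norm)
  qed
  have "local_saddle r c1 zs"
  proof
    have "(g \<circ> (\<lambda>\<beta>. 1 / (2 * \<beta>))) holomorphic_on ball 1 c1"
      by (rule holomorphic_on_compose_gen[OF _ g]) (auto intro!: holomorphic_intros dest: b0 im)
    then show "zs holomorphic_on ball 1 c1" by (simp add: o_def zs_def[abs_def])
    fix \<beta> :: complex assume "\<beta> \<in> ball 1 c1"
    from im[OF this] obtain z where z: "z \<in> ball 0 (4 * r)" "1 / (2 * \<beta>) = deriv lc z" by auto
    then have "zs \<beta> = z" using gi[OF z(1)] by (simp add: zs_def)
    then show "deriv lc (zs \<beta>) = 1 / (2 * \<beta>)" "cmod (zs \<beta>) \<le> 4 * r" using z by auto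
  qed (use r c1 lc2 in auto)
  then show ?thesis using c1 by blast
qed

section \<open>Size of the saddle, of its critical value and of the two coefficients\<close>

context local_saddle
begin

text \<open>\<open>hs \<beta>\<close> is \<open>h\<^sub>\<beta>(u\<^sub>\<beta>)\<close>, and \<open>A\<close> and \<open>B\<close> are the two coefficients of \<open>\<Psi>\<^sub>N\<close>.\<close>
definition hs :: "complex \<Rightarrow> complex" where "hs \<beta> = zs \<beta> / (2 * \<beta>) - lc (zs \<beta>)"

definition A :: "complex \<Rightarrow> complex" where "A \<beta> = 1 / csqrt (1 - \<beta>)"

definition B :: "complex \<Rightarrow> complex" where "B \<beta> = 2 * csqrt (\<beta> / (\<beta> - \<beta>\<^sup>2 + zs \<beta>))"

lemma r1: "4 * r < 1" using r by simp

lemma ballD: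
  assumes "\<beta> \<in> ball 1 c1"
  shows "cmod (\<beta> - 1) < c1" "cmod (\<beta> - 1) \<le> 1 / 1000" "cmod (\<beta> - 1) \<le> 1 / 8000" "cmod (\<beta> - 1) \<le> r / 1000"
proof -
  show "cmod (\<beta> - 1) < c1" using assms by (simp add: dist_norm norm_minus_commute)
  then show "cmod (\<beta> - 1) \<le> 1 / 1000" "cmod (\<beta> - 1) \<le> 1 / 8000" "cmod (\<beta> - 1) \<le> r / 1000"
    using c1 r by auto
qed

text \<open>By \<open>lc_quadratic_1\<close> at 0 the saddle equation reads 1 / (2 \<beta>) = 1/2 -
  z/6 up to |z| / 10000, so z is about 3 (1 - 1 / \<beta>), hence about 3 (\<beta> - 1). The error
  still contains |z| and is absorbed at the end.\<close>

lemma zs_approx: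
  assumes \<beta>: "\<beta> \<in> ball 1 c1"
  shows "cmod (zs \<beta> - 3 * (\<beta> - 1)) \<le> cmod (\<beta> - 1) / 100"
proof -
  let ?z = "zs \<beta>" let ?e = "\<beta> - 1"
  note b = ballD[OF \<beta>] and n = norm_inverse_near_1[OF ballD(2)[OF \<beta>]]
  have "cmod (deriv lc ?z - deriv lc 0 + (?z - 0) / 6) \<le> 1 / 10000 * cmod (?z - 0)"
    by (rule lc_quadratic_1[OF r1 lc2 zs_small[OF \<beta>]]) (use r in auto)
  then have 1: "cmod (1 / (2 * \<beta>) - 1 / 2 + ?z / 6) \<le> 1 / 10000 * cmod ?z"
    by (simp add: zs_eq[OF \<beta>] deriv_lc_0)
  have eq: "?z - 3 * ?e = 6 * (1 / (2 * \<beta>) - 1 / 2 + ?z / 6) + 3 * (1 / \<beta> - 1) * ?e"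
    using n(1) by (simp add: field_simps)
  have 2: "cmod (3 * (1 / \<beta> - 1) * ?e) \<le> 1 / 1000 * cmod ?e"
    unfolding norm_mult
  proof (rule mult_right_mono)
    show "cmod 3 * cmod (1 / \<beta> - 1) \<le> 1 / 1000" using n(4) b(3) by simp
  qed simp
  have "cmod (?z - 3 * ?e) \<le> cmod (6 * (1 / (2 * \<beta>) - 1 / 2 + ?z / 6)) + cmod (3 * (1 / \<beta> - 1) * ?e)"
    unfolding eq by (rule norm_triangle_ineq)
  also have "\<dots> \<le> 6 * (1 / 10000 * cmod ?z) + 1 / 1000 * cmod ?e"
  proof (rule add_mono[OF _ 2])
    show "cmod (6 * (1 / (2 * \<beta>) - 1 / 2 + ?z / 6)) \<le> 6 * (1 / 10000 * cmod ?z)"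
      unfolding norm_mult norm_numeral by (rule mult_left_mono[OF 1]) simp
  qed
  finally have 3: "cmod (?z - 3 * ?e) \<le> 6 / 10000 * cmod ?z + 1 / 1000 * cmod ?e" by simp
  have "cmod ?z \<le> cmod (?z - 3 * ?e) + 3 * cmod ?e"
    using norm_triangle_ineq[of "?z - 3 * ?e" "3 * ?e"] by (simp only: norm_mult norm_numeral diff_add_cancel)
  with 3 show ?thesis using norm_ge_zero[of ?e] by linarith
qed

lemma zs_bounds:
  assumes \<beta>: "\<beta> \<in> ball 1 c1"
  shows "cmod (zs \<beta>) \<le> 301 / 100 * cmod (\<beta> - 1)" "299 / 100 * cmod (\<beta> - 1) \<le> cmod (zs \<beta>)"
    "cmod (zs \<beta>) \<le> r / 300"
proof -
  have 3: "cmod (3 * (\<beta> - 1)) = 3 * cmod (\<beta> - 1)" by (simp only: norm_mult norm_numeral)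
  show z: "cmod (zs \<beta>) \<le> 301 / 100 * cmod (\<beta> - 1)"
    using zs_approx[OF \<beta>] norm_triangle_ineq2[of "zs \<beta>" "3 * (\<beta> - 1)"] 3 by simp
  show "299 / 100 * cmod (\<beta> - 1) \<le> cmod (zs \<beta>)"
    using zs_approx[OF \<beta>] norm_triangle_ineq3[of "zs \<beta>" "3 * (\<beta> - 1)"] 3 by simp
  show "cmod (zs \<beta>) \<le> r / 300" using z ballD(4)[OF \<beta>] r by simp
qed

text \<open>Both sides solve the saddle equation for \<open>cnj \<beta>\<close> in the disc where
  \<open>deriv lc\<close> is injective.\<close>

lemma zs_cnj:
  assumes \<beta>: "\<beta> \<in> ball 1 c1"
  shows "zs (cnj \<beta>) = cnj (zs \<beta>)"
proof -
  have cb: "cnj \<beta> \<in> ball 1 c1"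
    using \<beta> by (metis complex_cnj_diff complex_cnj_one complex_mod_cnj dist_norm mem_ball)
  have "deriv lc (cnj z) = cnj (deriv lc z)" if "cmod z < 1" for z
  proof -
    have "((cnj \<circ> lc \<circ> cnj) has_field_derivative cnj (deriv lc z)) (at (cnj z))"
      using has_field_derivative_cnj_cnj[of lc "deriv lc z" "cnj z"] DERIV_lc[OF that] by simp
    then have "(lc has_field_derivative cnj (deriv lc z)) (at (cnj z))"
      by (rule has_field_derivative_transform_within_open[where S = "ball 0 1"])
         (use that in \<open>auto simp: lc_cnj\<close>)
    then show ?thesis by (rule DERIV_imp_deriv)
  qed
  moreover have "cmod (zs \<beta>) < 1" using zs_small[OF \<beta>] r1 by linarith
  ultimately have "deriv lc (cnj (zs \<beta>)) = deriv lc (zs (cnj \<beta>))"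
    by (simp add: zs_eq[OF \<beta>] zs_eq[OF cb])
  from deriv_lc_inj[OF r1 lc2 _ _ this] have "cnj (zs \<beta>) = zs (cnj \<beta>)"
    using zs_small[OF \<beta>] zs_small[OF cb] by simp
  then show ?thesis by simp
qed

lemma hs_cnj:
  assumes \<beta>: "\<beta> \<in> ball 1 c1"
  shows "hs (cnj \<beta>) = cnj (hs \<beta>)"
proof -
  have "cmod (zs \<beta>) < 1" using zs_small[OF \<beta>] r1 by linarith
  then show ?thesis by (simp add: hs_def zs_cnj[OF \<beta>] lc_cnj)
qed

text \<open>The z-derivative of h vanishes at the saddle, so \<open>deriv zs\<close> cancels and
  only the explicit dependence on \<beta> remains.\<close>

lemma DERIV_hs:
  assumes \<beta>: "\<beta> \<in> ball 1 c1"
  shows "(hs has_field_derivative - zs \<beta> / (2 * \<beta>\<^sup>2)) (at \<beta>)"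
proof -
  have z1: "cmod (zs \<beta>) < 1" using zs_small[OF \<beta>] r1 by linarith
  have b0: "\<beta> \<noteq> 0" using norm_inverse_near_1[OF ballD(2)[OF \<beta>]] by blast
  have D: "(zs has_field_derivative deriv zs \<beta>) (at \<beta>)"
    by (rule holomorphic_derivI[OF zs_holomorphic open_ball \<beta>])
  have "((\<lambda>\<beta>. lc (zs \<beta>)) has_field_derivative deriv lc (zs \<beta>) * deriv zs \<beta>) (at \<beta>)"
    by (rule DERIV_chain2[where f = lc and g = zs, OF DERIV_lc[OF z1] D])
  then have L: "((\<lambda>\<beta>. lc (zs \<beta>)) has_field_derivative 1 / (2 * \<beta>) * deriv zs \<beta>) (at \<beta>)"
    by (simp only: zs_eq[OF \<beta>])
  have "((\<lambda>\<beta>. zs \<beta> / (2 * \<beta>)) has_field_derivative (deriv zs \<beta> * (2 * \<beta>) - zs \<beta> * 2) / ((2 * \<beta>) * (2 * \<beta>))) (at \<beta>)"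
    by (rule DERIV_divide[OF D]) (use b0 in \<open>auto intro!: derivative_eq_intros\<close>)
  from DERIV_diff[OF this L] show ?thesis
    unfolding hs_def[abs_def] by (rule DERIV_cong) (use b0 in \<open>simp add: field_simps power2_eq_square\<close>)
qed

lemma hs_holomorphic: "hs holomorphic_on ball 1 c1"
  unfolding holomorphic_on_open[OF open_ball] using DERIV_hs by blast

lemma deriv_hs_approx:
  assumes \<beta>: "\<beta> \<in> ball 1 c1"
  shows "cmod (- zs \<beta> / (2 * \<beta>\<^sup>2) + 3 / 2 * (\<beta> - 1)) \<le> cmod (\<beta> - 1) / 100"
proof -
  let ?z = "zs \<beta>" let ?e = "\<beta> - 1"
  note b = ballD[OF \<beta>] and n = norm_inverse_near_1[OF ballD(2)[OF \<beta>]]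
  have eq: "- ?z / (2 * \<beta>\<^sup>2) + 3 / 2 * ?e = - (?z - 3 * ?e) / 2 - ?z / 2 * (1 / \<beta>\<^sup>2 - 1)"
    using n(1) by (simp add: field_simps)
  have "cmod (?z / 2 * (1 / \<beta>\<^sup>2 - 1)) \<le> (301 / 200 * cmod ?e) * (1 / 1000)"
    unfolding norm_mult
    by (rule mult_mono) (use zs_bounds[OF \<beta>] n(5) b(3) in \<open>auto simp: norm_divide\<close>)
  moreover have "cmod (- (?z - 3 * ?e) / 2) = cmod (?z - 3 * ?e) / 2" by (simp only: norm_divide norm_minus_cancel norm_numeral)
  ultimately have "cmod (- ?z / (2 * \<beta>\<^sup>2) + 3 / 2 * ?e) \<le> cmod ?e / 200 + (301 / 200 * cmod ?e) * (1 / 1000)"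
    unfolding eq using norm_triangle_ineq4[of "- (?z - 3 * ?e) / 2" "?z / 2 * (1 / \<beta>\<^sup>2 - 1)"] zs_approx[OF \<beta>]
    by linarith
  also have "\<dots> \<le> cmod ?e / 100" by simp
  finally show ?thesis .
qed

text \<open>Obtained by integrating \<open>deriv_hs_approx\<close> from 1. With \<beta> - 1 = a + i
  b the leading term has real part - 3/4 (a^2 - b^2), which places the critical curve along the
  directions b = a and b = - a.\<close>

lemma hs_approx:
  assumes \<beta>: "\<beta> \<in> ball 1 c1"
  shows "cmod (hs \<beta> + 3 / 4 * (\<beta> - 1)\<^sup>2) \<le> (cmod (\<beta> - 1))\<^sup>2 / 100"
proof -
  have one: "(1::complex) \<in> ball 1 c1" using c1 by simp
  have z0: "zs 1 = 0" using zs_approx[OF one] by simp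
  have h0: "hs 1 = 0" by (simp add: hs_def z0 lc_0)
  have seg: "closed_segment 1 \<beta> \<subseteq> ball 1 c1" by (rule closed_segment_subset) (use one \<beta> in auto)
  have "cmod ((hs \<beta> + 3 / 4 * (\<beta> - 1)\<^sup>2) - (hs 1 + 3 / 4 * (1 - 1)\<^sup>2)) \<le> (cmod (\<beta> - 1) / 100) * cmod (\<beta> - 1)"
  proof (rule field_differentiable_bound[where S = "closed_segment 1 \<beta>"])
    fix x assume xs: "x \<in> closed_segment 1 \<beta>"
    then have x: "x \<in> ball 1 c1" using seg by auto
    have "((\<lambda>x. hs x + 3 / 4 * (x - 1)\<^sup>2) has_field_derivative (- zs x / (2 * x\<^sup>2) + 3 / 2 * (x - 1))) (at x)"
      by (auto intro!: derivative_eq_intros DERIV_hs[OF x])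
    then show "((\<lambda>x. hs x + 3 / 4 * (x - 1)\<^sup>2) has_field_derivative (- zs x / (2 * x\<^sup>2) + 3 / 2 * (x - 1)))
        (at x within closed_segment 1 \<beta>)"
      by (rule has_field_derivative_at_within)
    have "cmod (x - 1) \<le> cmod (\<beta> - 1)"
      using segment_bound(1)[OF xs] by (simp add: norm_minus_commute)
    then show "cmod (- zs x / (2 * x\<^sup>2) + 3 / 2 * (x - 1)) \<le> cmod (\<beta> - 1) / 100"
      using deriv_hs_approx[OF x] by linarith
  qed auto
  then show ?thesis by (simp add: h0 power2_eq_square)
qed

lemma norm_A: "cmod (A \<beta>) = 1 / sqrt (cmod (\<beta> - 1))"
  by (simp add: A_def norm_divide norm_csqrt norm_minus_commute)

text \<open>Combines z_\<beta> = 3 (\<beta> - 1) + ... with \<beta> - \<beta>^2 = - (\<beta> - 1) -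
  (\<beta> - 1)^2.\<close>

lemma B_denominator:
  assumes \<beta>: "\<beta> \<in> ball 1 c1"
  shows "cmod (\<beta> - \<beta>\<^sup>2 + zs \<beta> - 2 * (\<beta> - 1)) \<le> cmod (\<beta> - 1) / 50"
proof -
  have "\<beta> - \<beta>\<^sup>2 + zs \<beta> - 2 * (\<beta> - 1) = (zs \<beta> - 3 * (\<beta> - 1)) - (\<beta> - 1)\<^sup>2"
    by (simp add: power2_eq_square algebra_simps)
  then have "cmod (\<beta> - \<beta>\<^sup>2 + zs \<beta> - 2 * (\<beta> - 1)) \<le> cmod (zs \<beta> - 3 * (\<beta> - 1)) + cmod ((\<beta> - 1)\<^sup>2)"
    by (simp only: norm_triangle_ineq4)
  also have "\<dots> \<le> cmod (\<beta> - 1) / 100 + cmod (\<beta> - 1) * cmod (\<beta> - 1)"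
    by (intro add_mono zs_approx \<beta>) (simp only: power2_eq_square norm_mult order_refl)
  also have "cmod (\<beta> - 1) * cmod (\<beta> - 1) \<le> 1 / 1000 * cmod (\<beta> - 1)"
    using ballD(2)[OF \<beta>] by (rule mult_right_mono) simp
  finally show ?thesis using norm_ge_zero[of "\<beta> - 1"] by linarith
qed

lemma B_denominator_bounds:
  assumes \<beta>: "\<beta> \<in> ball 1 c1"
  shows "99 / 50 * cmod (\<beta> - 1) \<le> cmod (\<beta> - \<beta>\<^sup>2 + zs \<beta>)" "cmod (\<beta> - \<beta>\<^sup>2 + zs \<beta>) \<le> 101 / 50 * cmod (\<beta> - 1)"
proof -
  have 2: "cmod (2 * (\<beta> - 1)) = 2 * cmod (\<beta> - 1)" by (simp only: norm_mult norm_numeral)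
  show "99 / 50 * cmod (\<beta> - 1) \<le> cmod (\<beta> - \<beta>\<^sup>2 + zs \<beta>)" "cmod (\<beta> - \<beta>\<^sup>2 + zs \<beta>) \<le> 101 / 50 * cmod (\<beta> - 1)"
    using B_denominator[OF \<beta>] norm_triangle_ineq3[of "\<beta> - \<beta>\<^sup>2 + zs \<beta>" "2 * (\<beta> - 1)"] 2 by auto
qed

text \<open>In view of \<open>norm_A\<close> this says |A| \<le> |B| \<le> 2 |A|, so at a zero of
  \<Psi> the exponential factor must be of order 1.\<close>

lemma norm_B:
  assumes \<beta>: "\<beta> \<in> ball 1 c1" and \<beta>1: "\<beta> \<noteq> 1"
  shows "1 / sqrt (cmod (\<beta> - 1)) \<le> cmod (B \<beta>)" "cmod (B \<beta>) \<le> 2 / sqrt (cmod (\<beta> - 1))"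
proof -
  let ?q = "cmod (\<beta> - 1)" let ?w = "cmod (\<beta> - \<beta>\<^sup>2 + zs \<beta>)"
  have q: "0 < ?q" using \<beta>1 by simp
  note w = B_denominator_bounds[OF \<beta>] and n = norm_inverse_near_1[OF ballD(2)[OF \<beta>]]
  have w0: "0 < ?w" using w q by linarith
  have B: "cmod (B \<beta>) = sqrt (4 * cmod \<beta> / ?w)"
    by (simp add: B_def norm_mult norm_csqrt norm_divide real_sqrt_mult real_sqrt_divide)
  have "1 / ?q \<le> 4 * cmod \<beta> / ?w"
  proof -
    have "(999 / 250) / (999 / 250 * ?q) \<le> 4 * cmod \<beta> / ?w"
      by (rule frac_le) (use w w0 q n in auto)
    then show ?thesis by simp
  qed
  then show "1 / sqrt ?q \<le> cmod (B \<beta>)" unfolding B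
    by (metis real_sqrt_divide real_sqrt_le_iff real_sqrt_one)
  have "4 * cmod \<beta> / ?w \<le> 4 / ?q"
  proof -
    have "4 * cmod \<beta> / ?w \<le> (1001 / 250) / (99 / 50 * ?q)"
      by (rule frac_le) (use w w0 q n in auto)
    also have "\<dots> = (1001 / 250 / (99 / 50)) / ?q" by simp
    also have "\<dots> \<le> 4 / ?q" by (rule divide_right_mono) auto
    finally show ?thesis .
  qed
  then have "sqrt (4 * cmod \<beta> / ?w) \<le> sqrt (4 / ?q)" by (rule real_sqrt_le_mono)
  then show "cmod (B \<beta>) \<le> 2 / sqrt ?q" unfolding B by (simp add: real_sqrt_divide)
qed

text \<open>The radicand is about 1 / (2 (\<beta> - 1)), so a real part of \<beta> - 1 that is
  positive with some margin carries over. This keeps the root in B off its cut, as needed for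
  holomorphy and for conjugation.\<close>

lemma Re_B_radicand:
  assumes \<beta>: "\<beta> \<in> ball 1 c1" and \<beta>1: "cmod (\<beta> - 1) / 10 \<le> Re (\<beta> - 1)" "\<beta> \<noteq> 1"
  shows "0 < Re (\<beta> / (\<beta> - \<beta>\<^sup>2 + zs \<beta>))"
proof -
  define w where "w = \<beta> - \<beta>\<^sup>2 + zs \<beta>"
  let ?q = "cmod (\<beta> - 1)"
  have q: "0 < ?q" using \<beta>1 by simp
  have wq: "99 / 50 * ?q \<le> cmod w" "cmod w \<le> 101 / 50 * ?q" and wd: "cmod (w - 2 * (\<beta> - 1)) \<le> ?q / 50"
    using B_denominator_bounds[OF \<beta>] B_denominator[OF \<beta>] by (auto simp: w_def)
  have w0: "w \<noteq> 0" using wq q by auto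
  have "Re (2 * (\<beta> - 1) - w) \<le> ?q / 50"
    using wd complex_Re_le_cmod[of "2 * (\<beta> - 1) - w"] by (simp add: norm_minus_commute)
  then have "9 / 50 * ?q \<le> Re w" using \<beta>1 by simp
  moreover have "- Re ((\<beta> - 1) * cnj w) \<le> 1 / 1000 * (101 / 50 * ?q)"
  proof -
    have "- Re ((\<beta> - 1) * cnj w) \<le> cmod ((\<beta> - 1) * cnj w)"
      using abs_Re_le_cmod[of "(\<beta> - 1) * cnj w"] by linarith
    also have "\<dots> \<le> 1 / 1000 * (101 / 50 * ?q)"
      unfolding norm_mult complex_mod_cnj using ballD(2)[OF \<beta>] wq by (intro mult_mono) auto
    finally show ?thesis .
  qed
  moreover have "Re (\<beta> * cnj w) = Re w + Re ((\<beta> - 1) * cnj w)" by (simp add: algebra_simps)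
  ultimately have "0 < Re (\<beta> * cnj w)" using q by linarith
  then show ?thesis unfolding w_def[symmetric] complex_div_cnj[of \<beta> w] using w0
    by (simp add: Re_divide_of_real flip: of_real_power)
qed

text \<open>\<open>csqrt (zs \<beta>)\<close> is a nonzero critical point of h with modulus at most
  10 sqrt c0, so \<open>saddle_points\<close> forces it to be u_\<beta> or - u_\<beta>. Everything
  used later is even in u_\<beta>, and the arbitrary sign disappears.\<close>

lemma ub_power2:
  assumes sp: "saddle_points c0 ub" and c0: "c1 \<le> c0" and \<beta>: "\<beta> \<in> ball 1 c1" "\<beta> \<noteq> 1"
  shows "(ub \<beta>)\<^sup>2 = zs \<beta>" "cw_h \<beta> (ub \<beta>) = hs \<beta>" "cw_h \<beta> (- ub \<beta>) = hs \<beta>"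
proof -
  define u where "u = csqrt (zs \<beta>)"
  have q: "0 < cmod (\<beta> - 1)" using \<beta> by simp
  have cu: "cmod u < 1"
    unfolding u_def using zs_small[OF \<beta>(1)] r1 by (intro norm_csqrt_less_1) linarith
  have u0: "u \<noteq> 0" using zs_bounds(2)[OF \<beta>(1)] q by (auto simp: u_def)
  have "cw_h_deriv \<beta> u = 0"
    using deriv_lc_power2[OF cu] zs_eq[OF \<beta>(1)] norm_inverse_near_1(1)[OF ballD(2)[OF \<beta>(1)]]
    by (simp add: cw_h_deriv_def u_def field_simps)
  moreover have "cmod u \<le> 10 * sqrt c0"
  proof -
    have "cmod (zs \<beta>) \<le> 100 * c0" using zs_bounds(1)[OF \<beta>(1)] ballD(1)[OF \<beta>(1)] c0 c1 by linarith
    then have "sqrt (cmod (zs \<beta>)) \<le> sqrt (100 * c0)" by (rule real_sqrt_le_mono)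
    also have "\<dots> = 10 * sqrt c0" by (simp add: real_sqrt_mult)
    finally show ?thesis by (simp add: u_def norm_csqrt)
  qed
  moreover have "{u. cmod u \<le> 10 * sqrt c0 \<and> cw_h_deriv \<beta> u = 0} = {0, ub \<beta>, - ub \<beta>}"
    using sp q ballD(1)[OF \<beta>(1)] c0 unfolding saddle_points_def by auto
  ultimately have "u \<in> {0, ub \<beta>, - ub \<beta>}" by blast
  then have "(ub \<beta>)\<^sup>2 = u\<^sup>2" using u0 by auto
  then show z: "(ub \<beta>)\<^sup>2 = zs \<beta>" by (simp add: u_def)
  have "cmod (ub \<beta>) ^ 2 < 1"
    using zs_small[OF \<beta>(1)] r1 unfolding z[symmetric] norm_power by linarith
  then have "cmod (ub \<beta>) < 1" by (metis norm_ge_zero one_power2 power2_less_imp_less zero_le_one)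
  then have s: "ub \<beta> \<in> slit_plane" by (rule small_in_slit_plane)
  show "cw_h \<beta> (ub \<beta>) = hs \<beta>" "cw_h \<beta> (- ub \<beta>) = hs \<beta>"
    using lc_power2[OF s] log_cosh_minus[OF s] z by (auto simp: cw_h_def hs_def)
qed

lemma cw_Psi_eq:
  assumes sp: "saddle_points c0 ub" and c0: "c1 \<le> c0" and \<beta>: "\<beta> \<in> ball 1 c1" "\<beta> \<noteq> 1"
  shows "cw_Psi ub N \<beta> = A \<beta> + B \<beta> * exp (- of_nat N * hs \<beta>)"
  by (simp add: cw_Psi_def A_def B_def ub_power2[OF assms])

end

section \<open>Gaussian linearisation of the partition function and truncation of the
  integral\<close>

text \<open>No complex shift of the line is made: the real part of a is removed by a real
  translation, and the imaginary part then enters as the characteristic function of the standard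
  normal law.\<close>

lemma has_bochner_integral_gauss_mgf_1:
  fixes a :: complex
  shows "has_bochner_integral lborel (\<lambda>x::real. exp (- (complex_of_real x)\<^sup>2 / 2 + a * x)) (sqrt (2 * pi) * exp (a\<^sup>2 / 2))"
proof -
  define p where "p = Re a" define q where "q = Im a"
  have a: "a = of_real p + \<i> * of_real q" by (simp add: p_def q_def complex_eq_iff)
  let ?f = "\<lambda>x. std_normal_density x *\<^sub>R iexp (q * x)"
  have "integrable lborel ?f"
    by (rule Bochner_Integration.integrable_bound[of lborel std_normal_density])
       (auto simp: integrable_normal_density norm_mult)
  moreover have "(LINT x|lborel. ?f x) = exp (- (q\<^sup>2) / 2)"
  proof -
    have "(LINT x|lborel. ?f x) = (LINT x|std_normal_distribution. iexp (q * x))"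
      by (rule integral_density[symmetric]) auto
    also have "\<dots> = complex_of_real (exp (- (q\<^sup>2) / 2))"
      using char_std_normal_distribution by (simp add: char_def fun_eq_iff)
    finally show ?thesis .
  qed
  ultimately have "has_bochner_integral lborel ?f (complex_of_real (exp (- (q\<^sup>2) / 2)))"
    by (simp add: has_bochner_integral_iff)
  then have sh: "has_bochner_integral lborel (\<lambda>x. ?f (- p + 1 * x)) (complex_of_real (exp (- (q\<^sup>2) / 2)))"
    using lborel_has_bochner_integral_real_affine_iff[of 1 ?f _ "- p"] by simp
  have I: "has_bochner_integral lborel (\<lambda>x. sqrt (2 * pi) * exp (of_real p ^ 2 / 2 + \<i> * of_real q * of_real p) * ?f (- p + 1 * x))
    (sqrt (2 * pi) * exp (of_real p ^ 2 / 2 + \<i> * of_real q * of_real p) * complex_of_real (exp (- (q\<^sup>2) / 2)))"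
    by (intro has_bochner_integral_mult_right) (rule sh)
  have 1: "sqrt (2 * pi) * exp (of_real p ^ 2 / 2 + \<i> * of_real q * of_real p) * ?f (- p + 1 * x)
      = exp (- (complex_of_real x)\<^sup>2 / 2 + a * x)" for x
  proof -
    have "sqrt (2 * pi) * exp (of_real p ^ 2 / 2 + \<i> * of_real q * of_real p) * ?f (- p + 1 * x)
      = exp (of_real p ^ 2 / 2 + \<i> * of_real q * of_real p) * (exp (of_real (- ((x - p)\<^sup>2) / 2)) * exp (\<i> * of_real (q * (x - p))))"
      unfolding exp_of_real by (simp add: std_normal_density_def scaleR_conv_of_real real_sqrt_mult)
    also have "\<dots> = exp (of_real p ^ 2 / 2 + \<i> * of_real q * of_real p + (of_real (- ((x - p)\<^sup>2) / 2) + \<i> * of_real (q * (x - p))))"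
      by (simp only: exp_add)
    also have "of_real p ^ 2 / 2 + \<i> * of_real q * of_real p + (of_real (- ((x - p)\<^sup>2) / 2) + \<i> * of_real (q * (x - p)))
       = - (complex_of_real x)\<^sup>2 / 2 + a * x"
      by (simp add: a power2_eq_square field_simps)
    finally show ?thesis .
  qed
  have 2: "sqrt (2 * pi) * exp (of_real p ^ 2 / 2 + \<i> * of_real q * of_real p) * complex_of_real (exp (- (q\<^sup>2) / 2)) = sqrt (2 * pi) * exp (a\<^sup>2 / 2)"
  proof -
    have "exp (of_real p ^ 2 / 2 + \<i> * of_real q * of_real p) * complex_of_real (exp (- (q\<^sup>2) / 2))
        = exp (of_real p ^ 2 / 2 + \<i> * of_real q * of_real p + of_real (- (q\<^sup>2) / 2))"
      by (simp only: exp_add exp_of_real)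
    also have "of_real p ^ 2 / 2 + \<i> * of_real q * of_real p + of_real (- (q\<^sup>2) / 2) = a\<^sup>2 / 2"
      by (simp add: a power2_eq_square field_simps)
    finally show ?thesis by (simp add: mult.assoc)
  qed
  show ?thesis using I unfolding 1 2 .
qed

lemma has_bochner_integral_gauss_mgf:
  fixes a :: complex and n :: real
  assumes n: "0 < n"
  shows "has_bochner_integral lborel (\<lambda>x::real. exp (- of_real n * (complex_of_real x)\<^sup>2 / 2 + a * x))
    (sqrt (2 * pi / n) * exp (a\<^sup>2 / (2 * n)))"
proof -
  let ?s = "sqrt n"
  have s: "?s \<noteq> 0" using n by simp
  have s2: "(complex_of_real ?s)\<^sup>2 = of_real n" using n by (simp flip: of_real_power)
  have "has_bochner_integral lborel (\<lambda>x. exp (- (complex_of_real (0 + ?s * x))\<^sup>2 / 2 + (a / ?s) * of_real (0 + ?s * x)))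
     ((sqrt (2 * pi) * exp ((a / ?s)\<^sup>2 / 2)) /\<^sub>R \<bar>?s\<bar>)"
    using lborel_has_bochner_integral_real_affine_iff[OF s, of "\<lambda>x. exp (- (complex_of_real x)\<^sup>2 / 2 + (a / ?s) * x)"
      "sqrt (2 * pi) * exp ((a / ?s)\<^sup>2 / 2)" 0] has_bochner_integral_gauss_mgf_1[of "a / ?s"] by blast
  moreover have "exp (- (complex_of_real (0 + ?s * x))\<^sup>2 / 2 + (a / ?s) * of_real (0 + ?s * x))
      = exp (- of_real n * (complex_of_real x)\<^sup>2 / 2 + a * x)" for x
    using n by (simp add: power_mult_distrib s2)
  moreover have "(sqrt (2 * pi) * exp ((a / ?s)\<^sup>2 / 2)) /\<^sub>R \<bar>?s\<bar> = sqrt (2 * pi / n) * exp (a\<^sup>2 / (2 * n))"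
    using n by (simp add: power_divide s2 real_sqrt_divide scaleR_conv_of_real field_simps)
  ultimately show ?thesis by simp
qed

lemma cosh_power_eq_sum:
  fixes w :: complex
  shows "cosh w ^ N = 1 / 2 ^ N * (\<Sum>\<sigma>\<in>{1..N} \<rightarrow>\<^sub>E {-1, 1 :: real}. exp (w * of_real (\<Sum>i\<in>{1..N}. \<sigma> i)))"
proof -
  have "(\<Sum>\<sigma>\<in>{1..N} \<rightarrow>\<^sub>E {-1, 1 :: real}. exp (w * of_real (\<Sum>i\<in>{1..N}. \<sigma> i)))
      = (\<Sum>\<sigma>\<in>{1..N} \<rightarrow>\<^sub>E {-1, 1 :: real}. \<Prod>i\<in>{1..N}. exp (w * of_real (\<sigma> i)))"
    by (simp add: exp_sum sum_distrib_left)
  also have "\<dots> = (\<Prod>i\<in>{1..N}. \<Sum>s\<in>{-1, 1 :: real}. exp (w * of_real s))"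
    by (rule prod_sum_PiE[symmetric]) auto
  also have "(\<Sum>s\<in>{-1, 1 :: real}. exp (w * of_real s)) = 2 * cosh w" by (simp add: cosh_field_def)
  finally show ?thesis by (simp add: power_mult_distrib)
qed

lemma cw_hamiltonian_eq: "cw_hamiltonian N \<sigma> = - (\<Sum>i\<in>{1..N}. \<sigma> i)\<^sup>2 / (2 * real N)"
  by (simp add: cw_hamiltonian_def power2_eq_square sum_product)

text \<open>With a = \<open>csqrt \<beta>\<close> times the total spin, a^2 / (2 N) is - \<beta>
  times the energy. The Gaussian thus makes the exponent linear in the spins, and their sum
  factorises into a power of cosh.\<close>

lemma cw_partition_integral:
  assumes N: "1 \<le> N"
  shows "has_bochner_integral lborel (\<lambda>x::real. (exp (- (complex_of_real x)\<^sup>2 / 2) * cosh (csqrt \<beta> * x)) ^ N)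
    (sqrt (2 * pi / N) * cw_partition N \<beta>)"
proof -
  let ?P = "{1..N} \<rightarrow>\<^sub>E {-1, 1 :: real}"
  let ?S = "\<lambda>\<sigma>. complex_of_real (\<Sum>i\<in>{1..N}. \<sigma> i)"
  have n: "0 < real N" using N by simp
  have "has_bochner_integral lborel
     (\<lambda>x::real. 1 / 2 ^ N * (\<Sum>\<sigma>\<in>?P. exp (- of_real (real N) * (complex_of_real x)\<^sup>2 / 2 + (csqrt \<beta> * ?S \<sigma>) * x)))
     (1 / 2 ^ N * (\<Sum>\<sigma>\<in>?P. sqrt (2 * pi / N) * exp ((csqrt \<beta> * ?S \<sigma>)\<^sup>2 / (2 * real N))))"
    by (intro has_bochner_integral_mult_right has_bochner_integral_sum has_bochner_integral_gauss_mgf n)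
  moreover have "1 / 2 ^ N * (\<Sum>\<sigma>\<in>?P. exp (- of_real (real N) * (complex_of_real x)\<^sup>2 / 2 + (csqrt \<beta> * ?S \<sigma>) * x))
     = (exp (- (complex_of_real x)\<^sup>2 / 2) * cosh (csqrt \<beta> * x)) ^ N" for x :: real
  proof -
    have e: "exp (- (complex_of_real x)\<^sup>2 / 2) ^ N = exp (- of_real (real N) * (complex_of_real x)\<^sup>2 / 2)"
      by (simp flip: exp_of_nat_mult)
    show ?thesis
      unfolding power_mult_distrib cosh_power_eq_sum e exp_add
      by (simp add: sum_distrib_left mult_ac)
  qed
  moreover have "1 / 2 ^ N * (\<Sum>\<sigma>\<in>?P. sqrt (2 * pi / N) * exp ((csqrt \<beta> * ?S \<sigma>)\<^sup>2 / (2 * real N)))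
     = sqrt (2 * pi / N) * cw_partition N \<beta>"
    unfolding cw_partition_def cw_hamiltonian_eq
    by (simp add: sum_distrib_left power_mult_distrib mult_ac flip: of_real_power of_real_sum)
  ultimately show ?thesis by simp
qed

text \<open>Since tanh y < y, the function y^2 / 2 - ln (cosh y) is positive for y > 0 and has a
  positive minimum on a compact interval; dividing it by 16, a bound for y^2 when y < 4, gives
  \<kappa> there. For y \<ge> 4 already cosh y \<le> exp y \<le> exp (y^2 / 4), whence \<kappa>
  \<le> 1/4.\<close>

lemma cosh_less_exp_gauss:
  assumes y1: "0 < y1"
  shows "\<exists>\<kappa>>0. \<kappa> \<le> 1 / 4 \<and> (\<forall>y\<ge>y1. cosh y \<le> exp ((1 / 2 - \<kappa>) * y\<^sup>2 :: real))"
proof -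
  define \<phi> :: "real \<Rightarrow> real" where "\<phi> y = y\<^sup>2 / 2 - ln (cosh y)" for y
  have tanh_less: "tanh y < y" if "0 < y" for y :: real
  proof -
    have "tanh 0 - 0 > tanh y - y"
    proof (rule DERIV_neg_imp_decreasing_open[OF that])
      fix x :: real assume x: "0 < x" "x < y"
      have "((\<lambda>x. tanh x - x) has_real_derivative (1 - (tanh x)\<^sup>2) - 1) (at x)"
        by (auto intro!: derivative_eq_intros)
      then show "\<exists>D. ((\<lambda>x. tanh x - x) has_real_derivative D) (at x) \<and> D < 0"
        using x by (intro exI[of _ "(1 - (tanh x)\<^sup>2) - 1"]) auto
    qed (auto intro!: continuous_intros)
    then show ?thesis by simp
  qed
  have pos: "0 < \<phi> y" if "0 < y" for y
  proof -
    have "\<phi> 0 < \<phi> y"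
    proof (rule DERIV_pos_imp_increasing_open[OF that])
      fix x :: real assume x: "0 < x" "x < y"
      have "(\<phi> has_real_derivative x - tanh x) (at x)"
        unfolding \<phi>_def by (auto intro!: derivative_eq_intros simp: tanh_def)
      then show "\<exists>D. (\<phi> has_real_derivative D) (at x) \<and> D > 0"
        using tanh_less[OF x(1)] by (intro exI[of _ "x - tanh x"]) auto
    qed (auto intro!: continuous_intros simp: \<phi>_def)
    then show ?thesis by (simp add: \<phi>_def)
  qed
  have "\<exists>x\<in>{y1..max 4 y1}. \<forall>y\<in>{y1..max 4 y1}. \<phi> x \<le> \<phi> y"
    by (rule continuous_attains_inf) (auto intro!: continuous_intros simp: \<phi>_def)
  then obtain x where x: "x \<in> {y1..max 4 y1}" and inf: "\<And>y. y \<in> {y1..max 4 y1} \<Longrightarrow> \<phi> x \<le> \<phi> y" by blast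
  have px: "0 < \<phi> x" using x y1 by (intro pos) auto
  define \<kappa> where "\<kappa> = min (1 / 4) (\<phi> x / 16)"
  have \<kappa>: "0 < \<kappa>" "\<kappa> \<le> 1 / 4" "\<kappa> * 16 \<le> \<phi> x" using px by (auto simp: \<kappa>_def min_def)
  have "cosh y \<le> exp ((1 / 2 - \<kappa>) * y\<^sup>2)" if y: "y1 \<le> y" for y
  proof (cases "4 \<le> y")
    case True
    have "cosh y \<le> exp y" using True by (simp add: cosh_def)
    also have "y \<le> (1 / 4) * y\<^sup>2" using True by (simp add: power2_eq_square)
    then have "exp y \<le> exp ((1 / 4) * y\<^sup>2)" by simp
    also have "\<dots> \<le> exp ((1 / 2 - \<kappa>) * y\<^sup>2)" using \<kappa> mult_right_mono[of "1 / 4" "1 / 2 - \<kappa>" "y\<^sup>2"] by simp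
    finally show ?thesis .
  next
    case False
    have "y\<^sup>2 \<le> 4\<^sup>2" using False y y1 by (intro power_mono) auto
    then have "\<kappa> * y\<^sup>2 \<le> \<kappa> * 16" using \<kappa> by (intro mult_left_mono) auto
    also have "\<dots> \<le> \<phi> x" by (rule \<kappa>)
    also have "\<dots> \<le> \<phi> y" using False y by (intro inf) auto
    finally have "ln (cosh y) \<le> (1 / 2 - \<kappa>) * y\<^sup>2" by (simp add: \<phi>_def algebra_simps)
    then have "exp (ln (cosh y)) \<le> exp ((1 / 2 - \<kappa>) * y\<^sup>2)" by (simp only: exp_le_cancel_iff)
    then show ?thesis by (simp only: exp_ln[OF cosh_real_pos])
  qed
  then show ?thesis using \<kappa> by blast
qed

lemma norm_cosh_le: "cmod (cosh w) \<le> cosh (Re w)"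
proof -
  have "cmod (cosh w) \<le> (cmod (exp w) + cmod (exp (- w))) / 2"
    using norm_triangle_ineq[of "exp w" "exp (- w)"] by (simp add: cosh_def scaleR_conv_of_real norm_mult)
  then show ?thesis by (simp add: cosh_def)
qed

text \<open>Under u = \<open>csqrt \<beta> * x\<close> the integrand is exp (- N h_\<beta>) along a
  ray, and |x| > x1 contributes exponentially little for \<beta> near 1. The rest is stated through
  a primitive F, odd because the integrand is even, so that a later change of path only compares
  endpoint values.\<close>

lemma cw_partition_primitive:
  fixes x1 :: real
  assumes x1: "0 < x1"
  obtains \<kappa> c C where "0 < \<kappa>" "0 < c" "0 < C"
    and "\<And>\<beta> N F. \<beta> \<in> ball 1 c \<Longrightarrow> 1 \<le> N \<Longrightarrow>
      (\<And>u. (F has_field_derivative (exp (- u\<^sup>2 / (2 * \<beta>)) * cosh u) ^ N) (at u)) \<Longrightarrow> F 0 = 0 \<Longrightarrow>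
      cmod (cw_partition N \<beta> - of_real (sqrt (real N / (2 * pi))) * (2 * F (csqrt \<beta> * of_real x1) / csqrt \<beta>))
        \<le> C * sqrt (real N) * exp (- \<kappa> * real N)"
proof -
  obtain k where k: "0 < k" "k \<le> 1 / 4" and cosh: "\<And>y. y \<ge> x1 / 2 \<Longrightarrow> cosh y \<le> exp ((1 / 2 - k) * y\<^sup>2 :: real)"
    using cosh_less_exp_gauss[of "x1 / 2"] x1 by auto
  \<comment> \<open>Half of k is spent on |\<beta>| \<le> 1 + k: indeed (1/2 - k) (1 + k) \<le> 1/2
    - k/2.\<close>
  define \<kappa> where "\<kappa> = k / 2"
  have \<kappa>: "0 < \<kappa>" using k by (simp add: \<kappa>_def)
  have int\<kappa>: "integrable lborel (\<lambda>x. exp (- \<kappa> * x\<^sup>2))"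
  proof -
    have "integrable lborel (\<lambda>x. norm (exp (- of_real (2 * \<kappa>) * (complex_of_real x)\<^sup>2 / 2 + 0 * x)))"
      using has_bochner_integral_gauss_mgf[of "2 * \<kappa>" 0] \<kappa>
      by (intro integrable_norm) (simp add: has_bochner_integral_iff)
    then show ?thesis by (simp flip: of_real_power)
  qed
  define J where "J = (LINT x|lborel. exp (- \<kappa> * x\<^sup>2))"
  have J0: "0 \<le> J" unfolding J_def by (intro integral_nonneg_AE) auto
  define C where "C = exp (\<kappa> * x1\<^sup>2) * J + 1"
  have C0: "0 < C" using J0 by (simp add: C_def add_nonneg_pos)
  \<comment> \<open>These become the rate and the radius of the statement. |\<beta> - 1| < 3/4 gives
    |csqrt \<beta>| \<ge> 1/2, which is why cosh was estimated from x1 / 2 on.\<close>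
  have kp: "0 < \<kappa> * x1\<^sup>2" "0 < min k (3 / 4)" using \<kappa> x1 k by auto
  show thesis
  proof (rule that[OF kp C0])
    fix \<beta> :: complex and N :: nat and F
    assume \<beta>: "\<beta> \<in> ball 1 (min k (3 / 4))" and N: "1 \<le> N" and
      F: "\<And>u. (F has_field_derivative (exp (- u\<^sup>2 / (2 * \<beta>)) * cosh u) ^ N) (at u)" and F0: "F 0 = 0"
    have \<beta>1: "cmod (\<beta> - 1) < k" "cmod (\<beta> - 1) < 3 / 4" using \<beta> by (auto simp: dist_norm norm_minus_commute)
    have nb: "cmod \<beta> \<le> 1 + k" "1 / 4 \<le> cmod \<beta>"
      using \<beta>1 norm_triangle_ineq2[of \<beta> 1] norm_triangle_ineq2[of 1 \<beta>] by (auto simp: norm_minus_commute)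
    define s where "s = csqrt \<beta>"
    have s2: "s\<^sup>2 = \<beta>" by (simp add: s_def)
    have \<beta>0: "\<beta> \<noteq> 0" using nb by auto
    then have s0: "s \<noteq> 0" by (auto simp: s_def)
    have cs: "(cmod s)\<^sup>2 = cmod \<beta>" using s2 by (metis norm_power)
    have cs2: "1 / 2 \<le> cmod s"
      using nb cs by (intro power2_le_imp_le[of "1 / 2"]) (auto simp: power2_eq_square)
    define E where "E u = (exp (- u\<^sup>2 / (2 * \<beta>)) * cosh u) ^ N" for u
    have DF: "(F has_field_derivative E u) (at u)" for u using F by (simp add: E_def)
    define \<phi> where "\<phi> x = (exp (- (complex_of_real x)\<^sup>2 / 2) * cosh (csqrt \<beta> * x)) ^ N" for x :: real
    have \<phi>E: "\<phi> x = E (s * x)" for x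
      using \<beta>0 by (simp add: \<phi>_def E_def s_def[symmetric] power_mult_distrib s2)
    have \<phi>: "has_bochner_integral lborel \<phi> (sqrt (2 * pi / N) * cw_partition N \<beta>)"
      using cw_partition_integral[OF N, of \<beta>] by (simp add: \<phi>_def[abs_def])
    have odd: "F (- w) = - F w" for w
    proof -
      have "((\<lambda>w. F w + F (- w)) has_field_derivative 0) (at w within UNIV)" for w
      proof -
        have "((\<lambda>w. F (- w)) has_field_derivative E (- w) * (- 1)) (at w)"
          by (rule DERIV_chain2[OF DF]) (auto intro!: derivative_eq_intros)
        from DERIV_add[OF DF this] show ?thesis by (simp add: E_def)
      qed
      then obtain c where c: "\<And>w. F w + F (- w) = c"
        using has_field_derivative_zero_constant[OF convex_UNIV, of "\<lambda>w. F w + F (- w)"] by auto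
      have "c = 0" using c[of 0] F0 by simp
      then show ?thesis using c[of w] by (simp add: eq_neg_iff_add_eq_0 add.commute)
    qed
    have "(\<phi> has_integral (F (s * of_real x1) / s - F (s * of_real (- x1)) / s)) {- x1..x1}"
    proof (rule fundamental_theorem_of_calculus)
      fix x
      have "((\<lambda>x. F (s * x) / s) has_field_derivative \<phi> x) (at (of_real x))"
      proof -
        have "((\<lambda>x. F (s * x)) has_field_derivative E (s * of_real x) * s) (at (of_real x))"
          by (rule DERIV_chain2[OF DF]) (auto intro!: derivative_eq_intros)
        from DERIV_cdivide[OF this, of s] show ?thesis using s0 by (simp add: \<phi>E)
      qed
      from has_vector_derivative_real_field[OF this]
      show "((\<lambda>x. F (s * complex_of_real x) / s) has_vector_derivative \<phi> x) (at x within {- x1..x1})"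
        by (rule has_vector_derivative_at_within)
    qed (use x1 in auto)
    then have mid: "integral {- x1..x1} \<phi> = 2 * F (s * x1) / s"
      by (simp add: integral_unique odd)
    have cont: "continuous_on S \<phi>" for S unfolding \<phi>_def by (intro continuous_intros) auto
    have 1: "set_integrable lborel {- x1..x1} \<phi>"
      by (intro borel_integrable_atLeastAtMost' cont)
    have i\<phi>: "integrable lborel \<phi>" using \<phi> by (simp add: has_bochner_integral_iff)
    have 2: "set_integrable lborel (- {- x1..x1}) \<phi>"
      unfolding set_integrable_def by (rule integrable_mult_indicator[OF _ i\<phi>]) auto
    have "sqrt (2 * pi / N) * cw_partition N \<beta> = (LINT x|lborel. \<phi> x)"
      using \<phi> by (simp add: has_bochner_integral_iff)
    also have "\<dots> = (LINT x:({- x1..x1} \<union> (- {- x1..x1}))|lborel. \<phi> x)"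
      by (simp add: set_lebesgue_integral_def)
    also have "\<dots> = (LINT x:{- x1..x1}|lborel. \<phi> x) + (LINT x:(- {- x1..x1})|lborel. \<phi> x)"
      by (rule set_integral_Un[OF _ 1 2]) auto
    also have "(LINT x:{- x1..x1}|lborel. \<phi> x) = 2 * F (s * x1) / s"
      unfolding mid[symmetric] by (rule set_borel_integral_eq_integral(2)[OF 1])
    finally have split: "sqrt (2 * pi / N) * cw_partition N \<beta> - 2 * F (s * x1) / s = (LINT x:(- {- x1..x1})|lborel. \<phi> x)"
      by simp
    have "cmod (LINT x:(- {- x1..x1})|lborel. \<phi> x) \<le> (LINT x|lborel. norm (indicator (- {- x1..x1}) x *\<^sub>R \<phi> x))"
      unfolding set_lebesgue_integral_def by (rule integral_norm_bound)
    \<comment> \<open>One of the N factors is kept for integrability; the other N - 1 are evaluated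
      at |x| = x1 and produce the exponential rate.\<close>
    also have "\<dots> \<le> (LINT x|lborel. exp (- (real N - 1) * \<kappa> * x1\<^sup>2) * exp (- \<kappa> * x\<^sup>2))"
    proof (rule integral_mono)
      show "integrable lborel (\<lambda>x. norm (indicator (- {- x1..x1}) x *\<^sub>R \<phi> x))"
        using 2 unfolding set_integrable_def by (rule integrable_norm)
      show "integrable lborel (\<lambda>x. exp (- (real N - 1) * \<kappa> * x1\<^sup>2) * exp (- \<kappa> * x\<^sup>2))"
        using int\<kappa> by (rule integrable_mult_right)
      fix x :: real
      show "norm (indicator (- {- x1..x1}) x *\<^sub>R \<phi> x) \<le> exp (- (real N - 1) * \<kappa> * x1\<^sup>2) * exp (- \<kappa> * x\<^sup>2)"
      proof (cases "x \<in> {- x1..x1}")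
        case False
        then have ax: "x1 < \<bar>x\<bar>" by auto
        define y where "y = cmod s * \<bar>x\<bar>"
        have y: "x1 / 2 \<le> y" using mult_mono[of "1 / 2" "cmod s" x1 "\<bar>x\<bar>"] ax cs2 x1 by (simp add: y_def)
        have "cmod (cosh (s * x)) \<le> cosh (Re (s * x))" by (rule norm_cosh_le)
        also have "\<dots> = cosh \<bar>Re (s * x)\<bar>" by (simp add: cosh_real_abs)
        also have "\<dots> \<le> cosh y"
        proof -
          have "\<bar>Re (s * x)\<bar> \<le> y" using abs_Re_le_cmod[of "s * x"] by (simp add: y_def norm_mult)
          then show ?thesis by (subst cosh_real_nonneg_le_iff) auto
        qed
        also have "\<dots> \<le> exp ((1 / 2 - k) * y\<^sup>2)" by (rule cosh[OF y])
        also have "\<dots> \<le> exp ((1 / 2 - \<kappa>) * x\<^sup>2)"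
        proof -
          have "(1 / 2 - k) * y\<^sup>2 = ((1 / 2 - k) * cmod \<beta>) * x\<^sup>2" by (simp add: y_def power_mult_distrib cs)
          also have "\<dots> \<le> ((1 / 2 - k) * (1 + k)) * x\<^sup>2"
            using nb k by (intro mult_right_mono mult_left_mono) auto
          also have "\<dots> \<le> (1 / 2 - \<kappa>) * x\<^sup>2"
          proof (rule mult_right_mono)
            have "0 \<le> k * k" by simp
            then show "(1 / 2 - k) * (1 + k) \<le> 1 / 2 - \<kappa>" by (simp add: \<kappa>_def algebra_simps)
          qed simp
          finally show ?thesis by simp
        qed
        finally have c: "cmod (cosh (s * x)) \<le> exp ((1 / 2 - \<kappa>) * x\<^sup>2)" .
        have e: "cmod (exp (- (complex_of_real x)\<^sup>2 / 2)) = exp (- x\<^sup>2 / 2)" by (simp flip: of_real_power)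
        have "cmod (exp (- (complex_of_real x)\<^sup>2 / 2) * cosh (s * x)) \<le> exp (- x\<^sup>2 / 2) * exp ((1 / 2 - \<kappa>) * x\<^sup>2)"
          unfolding norm_mult e by (intro mult_left_mono c) auto
        also have "\<dots> = exp (- \<kappa> * x\<^sup>2)" by (simp add: exp_add[symmetric] algebra_simps)
        finally have "cmod (\<phi> x) \<le> exp (- \<kappa> * x\<^sup>2) ^ N"
          unfolding \<phi>_def s_def[symmetric] norm_power by (intro power_mono) auto
        also have "\<dots> = exp (- (real N - 1) * (\<kappa> * x\<^sup>2)) * exp (- \<kappa> * x\<^sup>2)"
          by (simp add: exp_of_nat_mult[symmetric] exp_add[symmetric] algebra_simps)
        also have "\<dots> \<le> exp (- (real N - 1) * (\<kappa> * x1\<^sup>2)) * exp (- \<kappa> * x\<^sup>2)"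
        proof (rule mult_right_mono)
          have "x1\<^sup>2 \<le> \<bar>x\<bar>\<^sup>2" using ax x1 by (intro power_mono) auto
          then have "(real N - 1) * (\<kappa> * x1\<^sup>2) \<le> (real N - 1) * (\<kappa> * x\<^sup>2)"
            using N \<kappa> by (intro mult_left_mono) auto
          then show "exp (- (real N - 1) * (\<kappa> * x\<^sup>2)) \<le> exp (- (real N - 1) * (\<kappa> * x1\<^sup>2))"
            by (simp only: exp_le_cancel_iff mult_minus_left neg_le_iff_le)
        qed simp
        finally show ?thesis using False by (simp add: indicator_def mult.assoc)
      qed (simp add: indicator_def)
    qed
    also have "\<dots> = exp (- (real N - 1) * \<kappa> * x1\<^sup>2) * J" by (simp add: J_def)
    also have "\<dots> \<le> C * exp (- (\<kappa> * x1\<^sup>2) * N)"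
    proof -
      have "exp (- (real N - 1) * \<kappa> * x1\<^sup>2) = exp (\<kappa> * x1\<^sup>2) * exp (- (\<kappa> * x1\<^sup>2) * N)"
        by (simp add: exp_add[symmetric] algebra_simps)
      then show ?thesis by (simp add: C_def algebra_simps)
    qed
    finally have T: "cmod (sqrt (2 * pi / N) * cw_partition N \<beta> - 2 * F (s * x1) / s) \<le> C * exp (- (\<kappa> * x1\<^sup>2) * N)"
      unfolding split .
    have sq: "sqrt (N / (2 * pi)) * sqrt (2 * pi / N) = 1"
      using N by (simp add: real_sqrt_mult[symmetric])
    have "cw_partition N \<beta> - sqrt (N / (2 * pi)) * (2 * F (csqrt \<beta> * x1) / csqrt \<beta>)
       = of_real (sqrt (N / (2 * pi)) * sqrt (2 * pi / N)) * cw_partition N \<beta> - sqrt (N / (2 * pi)) * (2 * F (s * x1) / s)"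
      unfolding sq by (simp add: s_def)
    also have "\<dots> = sqrt (N / (2 * pi)) * (sqrt (2 * pi / N) * cw_partition N \<beta> - 2 * F (s * x1) / s)"
      by (simp add: right_diff_distrib mult.assoc)
    finally have "cmod (cw_partition N \<beta> - sqrt (N / (2 * pi)) * (2 * F (csqrt \<beta> * x1) / csqrt \<beta>))
      = sqrt (N / (2 * pi)) * cmod (sqrt (2 * pi / N) * cw_partition N \<beta> - 2 * F (s * x1) / s)"
      by (simp only: norm_mult norm_of_real) simp
    also have "\<dots> \<le> sqrt N * (C * exp (- (\<kappa> * x1\<^sup>2) * N))"
    proof (rule mult_mono[OF _ T])
      have "real N / (2 * pi) \<le> real N" using pi_gt3 divide_left_mono[of 1 "2 * pi" "real N"] by simp
      then show "sqrt (N / (2 * pi)) \<le> sqrt N" by (rule real_sqrt_le_mono)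
    qed auto
    finally show "cmod (cw_partition N \<beta> - of_real (sqrt (real N / (2 * pi))) * (2 * F (csqrt \<beta> * of_real x1) / csqrt \<beta>))
        \<le> C * sqrt (real N) * exp (- (\<kappa> * x1\<^sup>2) * real N)" by (simp add: mult_ac)
  qed
qed

section \<open>Exponentially small ends of paths, and the entire primitive\<close>

lemma exp_neg_le_inverse_power2:
  fixes k n :: real
  assumes k: "0 < k" and n: "0 < n"
  shows "exp (- (k * n)) \<le> 2 / k\<^sup>2 / n\<^sup>2"
proof -
  have "n\<^sup>2 \<le> 2 / k\<^sup>2 * exp (n * k)"
    using power_le_fact_exp[OF k, of n 2] n by (simp add: power_divide mult.commute)
  then have "n\<^sup>2 * exp (- (k * n)) \<le> 2 / k\<^sup>2" by (simp add: exp_minus field_simps)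
  moreover have "0 < n\<^sup>2" using n by simp
  ultimately show ?thesis by (simp only: pos_le_divide_eq mult.commute)
qed

lemma sqrt_exp_neg_le:
  fixes k n :: real
  assumes k: "0 < k" and n: "1 \<le> n"
  shows "sqrt n * exp (- (k * n)) \<le> 2 / k\<^sup>2 / n"
proof -
  have "sqrt n \<le> n" using n by (intro real_le_lsqrt self_le_power) auto
  then have "sqrt n * exp (- (k * n)) \<le> n * (2 / k\<^sup>2 / n\<^sup>2)"
    using exp_neg_le_inverse_power2[OF k, of n] n by (intro mult_mono) auto
  also have "\<dots> = 2 / k\<^sup>2 / n" using n by (simp add: power2_eq_square)
  finally show ?thesis .
qed

text \<open>From w^2 - a^2 = (w - a) (w + a) with |w + a| \<ge> a. It decides between the two roots:
  the one with non-negative real part is near a, not near - a.\<close>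

lemma csqrt_diff_bound:
  assumes w: "0 \<le> Re w" and a: "0 < a"
  shows "cmod (w - of_real a) \<le> cmod (w\<^sup>2 - of_real (a\<^sup>2)) / a"
proof -
  have "a \<le> Re (w + of_real a)" using w by simp
  then have *: "a \<le> cmod (w + of_real a)" using complex_Re_le_cmod order_trans by blast
  have "w\<^sup>2 - of_real (a\<^sup>2) = (w - of_real a) * (w + of_real a)" by (simp add: power2_eq_square algebra_simps)
  then have "cmod (w\<^sup>2 - of_real (a\<^sup>2)) = cmod (w - of_real a) * cmod (w + of_real a)" by (simp only: norm_mult)
  moreover have "cmod (w - of_real a) * a \<le> cmod (w - of_real a) * cmod (w + of_real a)"
    by (rule mult_left_mono[OF *]) simp
  ultimately show ?thesis using a by (simp add: pos_le_divide_eq)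
qed

text \<open>The endpoints of all the paths lie in \<open>wedge \<rho>\<close> or in \<open>\<i>\<close> times it, with \<open>\<rho>\<^sup>2 = r\<close>. There
  \<open>Re (u\<^sup>4) > 0\<close>, which makes the integrand exponentially small, so endpoints may be moved freely.\<close>
definition wedge :: "real \<Rightarrow> complex set" where
  "wedge \<rho> = {v. 9 / 10 * \<rho> \<le> Re v \<and> Re v \<le> 11 / 10 * \<rho> \<and> \<bar>Im v\<bar> \<le> Re v / 3}"

lemma convex_wedge: "convex (wedge \<rho>)"
proof -
  have l1: "linear (\<lambda>v. Im v - Re v / 3)" and l2: "linear (\<lambda>v. - Im v - Re v / 3)"
    by (auto intro!: linearI simp: algebra_simps add_divide_distrib)
  have "wedge \<rho> = {v. Re v \<ge> 9 / 10 * \<rho>} \<inter> {v. Re v \<le> 11 / 10 * \<rho>} \<inter>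
      ((\<lambda>v. Im v - Re v / 3) -` {..0}) \<inter> ((\<lambda>v. - Im v - Re v / 3) -` {..0})"
    by (auto simp: wedge_def)
  then show ?thesis
    by (simp only: convex_Int convex_halfspace_Re_ge convex_halfspace_Re_le convex_linear_vimage[OF l1]
        convex_linear_vimage[OF l2] convex_real_interval)
qed

lemma near_in_wedge:
  assumes "cmod (v - of_real \<rho>) \<le> \<rho> / 100" "0 < \<rho>"
  shows "v \<in> wedge \<rho>"
proof -
  have "\<bar>Re v - \<rho>\<bar> \<le> \<rho> / 100" "\<bar>Im v\<bar> \<le> \<rho> / 100"
    using abs_Re_le_cmod[of "v - of_real \<rho>"] abs_Im_le_cmod[of "v - of_real \<rho>"] assms by auto
  then have "9 / 10 * \<rho> \<le> Re v" "Re v \<le> 11 / 10 * \<rho>" "\<bar>Im v\<bar> \<le> Re v / 3" using assms(2) by linarith+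
  then show ?thesis unfolding wedge_def by blast
qed

text \<open>With |y| \<le> x/3 the real part x^4 - 6 x^2 y^2 + y^4 is at least x^4 / 3, and (9/10)^4
  / 3 exceeds 21/100; likewise (11/10)^2 times 10/9 is below 27/20.\<close>

lemma wedge_power:
  assumes "v \<in> wedge \<rho>" "0 < \<rho>"
  shows "cmod (v\<^sup>2) \<le> 27 / 20 * \<rho>\<^sup>2" "21 / 100 * (\<rho>\<^sup>2)\<^sup>2 \<le> Re ((v\<^sup>2)\<^sup>2)"
proof -
  define x y where "x = Re v" and "y = Im v"
  have v: "9 / 10 * \<rho> \<le> x" "x \<le> 11 / 10 * \<rho>" "\<bar>y\<bar> \<le> x / 3"
    using assms by (auto simp: wedge_def x_def y_def)
  have x2: "x\<^sup>2 \<le> (11 / 10 * \<rho>)\<^sup>2" "(9 / 10 * \<rho>)\<^sup>2 \<le> x\<^sup>2" using v assms(2) by (auto intro!: power_mono)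
  have y2: "y\<^sup>2 \<le> (x / 3)\<^sup>2" using v by (metis abs_ge_zero power2_abs power_mono)
  have "cmod (v\<^sup>2) = x\<^sup>2 + y\<^sup>2" by (simp add: norm_power cmod_power2 x_def y_def)
  then show "cmod (v\<^sup>2) \<le> 27 / 20 * \<rho>\<^sup>2" using x2 y2 by (simp add: power_mult_distrib power_divide)
  have re: "Re ((v\<^sup>2)\<^sup>2) = (x\<^sup>2)\<^sup>2 - 6 * x\<^sup>2 * y\<^sup>2 + (y\<^sup>2)\<^sup>2"
    by (simp add: Re_power2 Im_power2 x_def y_def power2_eq_square algebra_simps)
  have "x\<^sup>2 * y\<^sup>2 \<le> x\<^sup>2 * (x / 3)\<^sup>2" using y2 by (rule mult_left_mono) simp
  then have "6 * x\<^sup>2 * y\<^sup>2 \<le> 6 / 9 * (x\<^sup>2)\<^sup>2" by (simp add: power2_eq_square)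
  then have "(x\<^sup>2)\<^sup>2 / 3 \<le> Re ((v\<^sup>2)\<^sup>2)" unfolding re using zero_le_power2[of "y\<^sup>2"] by linarith
  moreover have "((9 / 10 * \<rho>)\<^sup>2)\<^sup>2 \<le> (x\<^sup>2)\<^sup>2" by (rule power_mono[OF x2(2)]) simp
  then have "81 / 100 * (81 / 100) * (\<rho>\<^sup>2)\<^sup>2 \<le> (x\<^sup>2)\<^sup>2" by (simp add: power_mult_distrib power2_eq_square)
  ultimately show "21 / 100 * (\<rho>\<^sup>2)\<^sup>2 \<le> Re ((v\<^sup>2)\<^sup>2)" using zero_le_power2[of "\<rho>\<^sup>2"] by linarith
qed

text \<open>This is exp (- N h_\<beta>) written without the logarithm, hence entire: it has one
  primitive on the whole plane, across the slits of \<open>log_cosh\<close> as well.\<close>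

definition gaussian_cosh :: "complex \<Rightarrow> nat \<Rightarrow> complex \<Rightarrow> complex" where
  "gaussian_cosh \<beta> N u = (exp (- u\<^sup>2 / (2 * \<beta>)) * cosh u) ^ N"

lemma gaussian_cosh_primitive_exists:
  "\<exists>F. (\<forall>u. (F has_field_derivative gaussian_cosh \<beta> N u) (at u)) \<and> F 0 = 0"
proof -
  have "gaussian_cosh \<beta> N holomorphic_on UNIV"
    unfolding gaussian_cosh_def[abs_def] holomorphic_on_def field_differentiable_def
    by (cases "\<beta> = 0") (auto intro!: derivative_eq_intros exI)
  then obtain g where "\<And>x. x \<in> UNIV \<Longrightarrow> (g has_field_derivative gaussian_cosh \<beta> N x) (at x within UNIV)"
    using holomorphic_convex_primitive'[OF convex_UNIV open_UNIV] by blast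
  then have "\<And>x. ((\<lambda>x. g x - g 0) has_field_derivative gaussian_cosh \<beta> N x) (at x)"
    by (auto intro!: derivative_eq_intros)
  then show ?thesis by (intro exI[of _ "\<lambda>x. g x - g 0"]) auto
qed

section \<open>The saddle 0 and the exchange of endpoints\<close>

context local_saddle
begin

text \<open>This is h_\<beta> in the variable z. Near 0 its critical point is z_\<beta>; the saddle
  u = 0 is not critical for H but comes from the branching of u^2.\<close>

definition H :: "complex \<Rightarrow> complex \<Rightarrow> complex" where "H \<beta> z = z / (2 * \<beta>) - lc z"

lemma hs_eq_H: "hs \<beta> = H \<beta> (zs \<beta>)" by (simp add: hs_def H_def)

lemma gaussian_cosh_eq_exp:
  assumes "cmod u < 1"
  shows "gaussian_cosh \<beta> N u = exp (- of_nat N * H \<beta> (u\<^sup>2))"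
proof -
  have s: "u \<in> slit_plane" using assms by (rule small_in_slit_plane)
  have "exp (- u\<^sup>2 / (2 * \<beta>)) * cosh u = exp (- H \<beta> (u\<^sup>2))"
    unfolding exp_log_cosh[OF s, symmetric] by (simp add: H_def lc_power2[OF s] exp_add[symmetric])
  then have "gaussian_cosh \<beta> N u = exp (- H \<beta> (u\<^sup>2)) ^ N" by (simp only: gaussian_cosh_def)
  also have "\<dots> = exp (of_nat N * - H \<beta> (u\<^sup>2))" by (rule exp_of_nat_mult[symmetric])
  finally show ?thesis by simp
qed

text \<open>Expansion at z = 0 with linear coefficient (1 / \<beta> - 1) / 2 and quadratic
  coefficient 1/12, used for the saddle 0 and for the ends of the paths.
  \<open>H_saddle_lower\<close> is the analogue at z_\<beta>, where the linear term
  vanishes.\<close>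

lemma H_lower:
  assumes z: "cmod z \<le> 4 * r"
  shows "Re ((1 / \<beta> - 1) * z) / 2 + Re (z\<^sup>2) / 12 - (cmod z)\<^sup>2 / 10000 \<le> Re (H \<beta> z)"
    and "cmod (H \<beta> z - (1 / \<beta> - 1) * z / 2) \<le> (cmod z)\<^sup>2"
proof -
  let ?d = "lc z - z / 2 + z\<^sup>2 / 12"
  have "cmod (lc z - lc 0 - deriv lc 0 * (z - 0) + (z - 0)\<^sup>2 / 12) \<le> 1 / 10000 * (cmod (z - 0))\<^sup>2"
    by (rule lc_quadratic_0[OF r1 lc2 z]) (use r in auto)
  then have d: "cmod ?d \<le> (cmod z)\<^sup>2 / 10000" by (simp add: lc_0 deriv_lc_0)
  have eq: "H \<beta> z = (1 / \<beta> - 1) * z / 2 + z\<^sup>2 / 12 - ?d" by (simp add: H_def field_simps)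
  have "Re ?d \<le> (cmod z)\<^sup>2 / 10000" using d complex_Re_le_cmod order_trans by blast
  then show "Re ((1 / \<beta> - 1) * z) / 2 + Re (z\<^sup>2) / 12 - (cmod z)\<^sup>2 / 10000 \<le> Re (H \<beta> z)"
    unfolding eq by simp
  have "H \<beta> z - (1 / \<beta> - 1) * z / 2 = z\<^sup>2 / 12 - ?d" unfolding eq by simp
  moreover have "cmod (z\<^sup>2 / 12) = (cmod z)\<^sup>2 / 12" by (simp add: norm_divide norm_power)
  ultimately have "cmod (H \<beta> z - (1 / \<beta> - 1) * z / 2) \<le> (cmod z)\<^sup>2 / 12 + (cmod z)\<^sup>2 / 10000"
    using norm_triangle_ineq4[of "z\<^sup>2 / 12" ?d] d by simp
  also have "\<dots> \<le> (cmod z)\<^sup>2" using zero_le_power2[of "cmod z"] by linarith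
  finally show "cmod (H \<beta> z - (1 / \<beta> - 1) * z / 2) \<le> (cmod z)\<^sup>2" .
qed

lemma H_saddle_lower:
  assumes \<beta>: "\<beta> \<in> ball 1 c1" and z: "cmod z \<le> 4 * r"
  shows "Re ((z - zs \<beta>)\<^sup>2) / 12 - (cmod (z - zs \<beta>))\<^sup>2 / 10000 \<le> Re (H \<beta> z - hs \<beta>)"
proof -
  let ?w = "zs \<beta>"
  let ?d = "lc z - lc ?w - deriv lc ?w * (z - ?w) + (z - ?w)\<^sup>2 / 12"
  have "cmod ?d \<le> 1 / 10000 * (cmod (z - ?w))\<^sup>2"
    by (rule lc_quadratic_0[OF r1 lc2 z zs_small[OF \<beta>]])
  then have "Re ?d \<le> (cmod (z - ?w))\<^sup>2 / 10000" using complex_Re_le_cmod[of ?d] by linarith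
  moreover have "H \<beta> z - hs \<beta> = (z - ?w)\<^sup>2 / 12 - ?d"
    using norm_inverse_near_1(1)[OF ballD(2)[OF \<beta>]] by (simp add: H_def hs_def zs_eq[OF \<beta>] field_simps)
  ultimately show ?thesis by simp
qed

lemma sqrt_r: "0 < sqrt r" "(sqrt r)\<^sup>2 = r" "sqrt r < 1 / 2"
proof -
  show "0 < sqrt r" "(sqrt r)\<^sup>2 = r" using r by auto
  show "sqrt r < 1 / 2" using r by (intro real_less_lsqrt) (auto simp: power2_eq_square)
qed

text \<open>The quadratic term contributes at least 21/1200 r^2, while |1 / \<beta> - 1|, of order r
  / 1000, keeps the linear term below r^2 / 1000. The main term depends on z^2 only, so the wedge
  and its rotation by i are treated at once.\<close>

lemma H_edge:
  assumes \<beta>: "\<beta> \<in> ball 1 c1" and v: "v \<in> wedge (sqrt r)" and z: "z = v\<^sup>2 \<or> z = - v\<^sup>2"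
  shows "r\<^sup>2 / 100 \<le> Re (H \<beta> z)" "cmod z < 1"
proof -
  note w = wedge_power[OF v sqrt_r(1), unfolded sqrt_r(2)]
  have cz: "cmod z \<le> 27 / 20 * r" and rz: "21 / 100 * r\<^sup>2 \<le> Re (z\<^sup>2)" using z w by auto
  show "cmod z < 1" using cz r by simp
  have b: "cmod (1 / \<beta> - 1) \<le> 1002 / 1000 * (r / 1000)"
    using norm_inverse_near_1(4)[OF ballD(2)[OF \<beta>]] ballD(4)[OF \<beta>] by simp
  have "- Re ((1 / \<beta> - 1) * z) \<le> cmod ((1 / \<beta> - 1) * z)"
    using abs_Re_le_cmod[of "(1 / \<beta> - 1) * z"] by linarith
  also have "\<dots> \<le> (1002 / 1000 * (r / 1000)) * (27 / 20 * r)"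
    unfolding norm_mult using b cz r by (intro mult_mono) auto
  also have "\<dots> = 1002 * 27 / 20000000 * r\<^sup>2" by (simp add: power2_eq_square)
  finally have 1: "- Re ((1 / \<beta> - 1) * z) \<le> 1002 * 27 / 20000000 * r\<^sup>2" .
  have "(cmod z)\<^sup>2 \<le> (27 / 20 * r)\<^sup>2" by (rule power_mono[OF cz]) simp
  then have 2: "(cmod z)\<^sup>2 \<le> 729 / 400 * r\<^sup>2" by (simp add: power2_eq_square)
  have "cmod z \<le> 4 * r" using cz r by linarith
  from H_lower(1)[OF this, of \<beta>] 1 2 rz show "r\<^sup>2 / 100 \<le> Re (H \<beta> z)"
    using zero_le_power2[of r] by linarith
qed

lemma primitive_edge:
  assumes \<beta>: "\<beta> \<in> ball 1 c1" and F: "\<And>u. (F has_field_derivative gaussian_cosh \<beta> N u) (at u)"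
    and a: "a \<in> wedge (sqrt r)" and b: "b \<in> wedge (sqrt r)"
  shows "cmod (F a - F b) \<le> exp (- (r\<^sup>2 / 100) * N) * cmod (a - b)"
    and "cmod (F (\<i> * a) - F (\<i> * b)) \<le> exp (- (r\<^sup>2 / 100) * N) * cmod (a - b)"
proof -
  have E: "cmod (gaussian_cosh \<beta> N u) \<le> exp (- (r\<^sup>2 / 100) * N)"
    if v: "v \<in> wedge (sqrt r)" and u: "u\<^sup>2 = v\<^sup>2 \<or> u\<^sup>2 = - v\<^sup>2" for u v
  proof -
    note h = H_edge[OF \<beta> v u]
    have "(cmod u)\<^sup>2 < 1\<^sup>2" using h(2) by (simp add: norm_power)
    then have "cmod u < 1" by (rule power2_less_imp_less) simp
    then have "cmod (gaussian_cosh \<beta> N u) = exp (- (real N * Re (H \<beta> (u\<^sup>2))))"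
      by (simp add: gaussian_cosh_eq_exp)
    also have "\<dots> \<le> exp (- (r\<^sup>2 / 100) * N)"
      using mult_left_mono[OF h(1), of "real N"] by (simp add: mult.commute)
    finally show ?thesis .
  qed
  show "cmod (F a - F b) \<le> exp (- (r\<^sup>2 / 100) * N) * cmod (a - b)"
    by (rule field_differentiable_bound[OF convex_wedge has_field_derivative_at_within[OF F] _ a b]) (rule E, auto)
  show "cmod (F (\<i> * a) - F (\<i> * b)) \<le> exp (- (r\<^sup>2 / 100) * N) * cmod (a - b)"
  proof (rule field_differentiable_bound[OF convex_wedge _ _ a b])
    fix z assume z: "z \<in> wedge (sqrt r)"
    have "((\<lambda>z. F (\<i> * z)) has_field_derivative gaussian_cosh \<beta> N (\<i> * z) * \<i>) (at z)"
      by (rule DERIV_chain2[OF F]) (auto intro!: derivative_eq_intros)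
    then show "((\<lambda>z. F (\<i> * z)) has_field_derivative gaussian_cosh \<beta> N (\<i> * z) * \<i>) (at z within wedge (sqrt r))"
      by (rule has_field_derivative_at_within)
    show "cmod (gaussian_cosh \<beta> N (\<i> * z) * \<i>) \<le> exp (- (r\<^sup>2 / 100) * N)"
      using E[OF z, of "\<i> * z"] by (simp add: norm_mult power_mult_distrib)
  qed
qed

lemma primitive_odd:
  assumes F: "\<And>u. (F has_field_derivative gaussian_cosh \<beta> N u) (at u)" and F0: "F 0 = 0"
  shows "F (- w) = - F w"
proof -
  have "((\<lambda>w. F w + F (- w)) has_field_derivative 0) (at w within UNIV)" for w
  proof -
    have "((\<lambda>w. F (- w)) has_field_derivative gaussian_cosh \<beta> N (- w) * (- 1)) (at w)"
      by (rule DERIV_chain2[OF F]) (auto intro!: derivative_eq_intros)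
    from DERIV_add[OF F this] show ?thesis by (simp add: gaussian_cosh_def)
  qed
  then obtain c where c: "\<And>w. F w + F (- w) = c"
    using has_field_derivative_zero_constant[OF convex_UNIV, of "\<lambda>w. F w + F (- w)"] by auto
  have "c = 0" using c[of 0] F0 by simp
  then show ?thesis using c[of w] by (simp add: eq_neg_iff_add_eq_0 add.commute)
qed

text \<open>The direction \<open>d\<close> is \<open>\<i>\<close> when \<open>Re \<beta>\<close> is well above \<open>1\<close>, and it is close to the positive real axis otherwise.\<close>
lemma saddle_zero_asymptotics:
  assumes \<kappa>: "0 < \<kappa>"
  obtains C where "0 < C" and "\<And>\<beta> N F d. \<beta> \<in> ball 1 c1 \<Longrightarrow> 1 \<le> N \<Longrightarrow>
     (\<And>u. (F has_field_derivative gaussian_cosh \<beta> N u) (at u)) \<Longrightarrow> F 0 = 0 \<Longrightarrow>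
     cmod d = 1 \<Longrightarrow> 1 / 4 \<le> Re (d ^ 4) \<Longrightarrow> 2 * \<kappa> \<le> Re ((1 / \<beta> - 1) * d\<^sup>2) \<Longrightarrow>
     cmod (2 * F (d * of_real (sqrt r)) - d * of_real (sqrt pi) / csqrt (of_nat N * ((1 / \<beta> - 1) * d\<^sup>2 / 2))) \<le> C / (real N * sqrt (real N))"
proof (rule laplace_method[OF \<kappa> sqrt_r(1) zero_le_one])
  fix C :: real assume C: "0 < C" and lap:
    "\<And>n f g a b g0 g1. 1 \<le> n \<Longrightarrow> continuous_on {-sqrt r..sqrt r} f \<Longrightarrow> continuous_on {-sqrt r..sqrt r} g \<Longrightarrow>
     (\<forall>t\<in>{-sqrt r..sqrt r}. \<kappa> * t\<^sup>2 \<le> Re (f t) \<and> cmod (f t - a * of_real (t\<^sup>2) - b * of_real (t ^ 3)) \<le> 1 * t ^ 4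
        \<and> cmod (g t - g0 - g1 * of_real t) \<le> 1 * t\<^sup>2) \<Longrightarrow>
     cmod b \<le> 1 \<Longrightarrow> cmod g0 \<le> 1 \<Longrightarrow> cmod g1 \<le> 1 \<Longrightarrow> \<kappa> \<le> Re a \<Longrightarrow>
     cmod (integral {-sqrt r..sqrt r} (\<lambda>t. exp (- of_real n * f t) * g t) - g0 * of_real (sqrt pi) / csqrt (of_real n * a))
       \<le> C / (n * sqrt n)"
  show thesis
  proof (rule that[OF C])
    fix \<beta> :: complex and N :: nat and F and d :: complex
    assume \<beta>: "\<beta> \<in> ball 1 c1" and N: "1 \<le> N" and F: "\<And>u. (F has_field_derivative gaussian_cosh \<beta> N u) (at u)" and F0: "F 0 = 0"
      and d: "cmod d = 1" "1 / 4 \<le> Re (d ^ 4)" "2 * \<kappa> \<le> Re ((1 / \<beta> - 1) * d\<^sup>2)"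
    have d0: "d \<noteq> 0" using d by auto
    define f where "f t = H \<beta> ((d * of_real t)\<^sup>2)" for t :: real
    define a where "a = (1 / \<beta> - 1) * d\<^sup>2 / 2"
    have cd: "cmod ((d * of_real t)\<^sup>2) = t\<^sup>2" for t by (simp add: norm_power norm_mult d)
    have tr: "t\<^sup>2 \<le> r" and ct: "cmod (d * of_real t) < 1" if "t \<in> {-sqrt r..sqrt r}" for t
    proof -
      have at: "\<bar>t\<bar> \<le> sqrt r" using that by (simp add: abs_le_iff)
      then have "\<bar>t\<bar>\<^sup>2 \<le> (sqrt r)\<^sup>2" by (intro power_mono) auto
      then show "t\<^sup>2 \<le> r" using sqrt_r by simp
      show "cmod (d * of_real t) < 1" using at sqrt_r(3) by (simp add: norm_mult d)
    qed
    have "((\<lambda>t. exp (- of_real (real N) * f t) * 1) has_integral (F (d * of_real (sqrt r)) / d - F (d * of_real (- sqrt r)) / d)) {-sqrt r..sqrt r}"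
    proof (rule fundamental_theorem_of_calculus)
      show "- sqrt r \<le> sqrt r" using sqrt_r by simp
      fix t assume t: "t \<in> {-sqrt r..sqrt r}"
      have "((\<lambda>x. F (d * x) / d) has_field_derivative exp (- of_real (real N) * f t) * 1) (at (of_real t))"
      proof -
        have "((\<lambda>x. F (d * x)) has_field_derivative gaussian_cosh \<beta> N (d * of_real t) * d) (at (of_real t))"
          by (rule DERIV_chain2[OF F]) (auto intro!: derivative_eq_intros)
        from DERIV_cdivide[OF this, of d] show ?thesis
          using d0 gaussian_cosh_eq_exp[OF ct[OF t]] by (simp add: f_def)
      qed
      from has_vector_derivative_real_field[OF this]
      show "((\<lambda>x. F (d * complex_of_real x) / d) has_vector_derivative exp (- of_real (real N) * f t) * 1)
           (at t within {-sqrt r..sqrt r})"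
        by (rule has_vector_derivative_at_within)
    qed
    then have I: "integral {-sqrt r..sqrt r} (\<lambda>t. exp (- of_real (real N) * f t) * 1) = 2 * F (d * of_real (sqrt r)) / d"
      by (simp add: integral_unique primitive_odd[OF F F0])
    have "cmod (integral {-sqrt r..sqrt r} (\<lambda>t. exp (- of_real (real N) * f t) * 1) - 1 * of_real (sqrt pi) / csqrt (of_real (real N) * a))
       \<le> C / (real N * sqrt (real N))"
    proof (rule lap[where b = 0 and ?g1.0 = 0])
      have lcc: "continuous_on (ball 0 1) lc" using lc_holomorphic by (rule holomorphic_on_imp_continuous_on)
      have "t\<^sup>2 < 1" if "t \<in> {-sqrt r..sqrt r}" for t using tr[OF that] r by linarith
      then have im: "(\<lambda>x. (d * complex_of_real x)\<^sup>2) ` {- sqrt r..sqrt r} \<subseteq> ball 0 1"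
        by (auto simp: cd)
      show "continuous_on {-sqrt r..sqrt r} f"
        unfolding f_def H_def
        using norm_inverse_near_1(1)[OF ballD(2)[OF \<beta>]]
        by (intro continuous_intros continuous_on_compose2[OF lcc _ im]) auto
      show "\<forall>t\<in>{-sqrt r..sqrt r}. \<kappa> * t\<^sup>2 \<le> Re (f t) \<and> cmod (f t - a * of_real (t\<^sup>2) - 0 * of_real (t ^ 3)) \<le> 1 * t ^ 4
        \<and> cmod (1 - 1 - 0 * of_real t) \<le> 1 * t\<^sup>2"
      proof (intro ballI conjI)
        fix t assume t: "t \<in> {-sqrt r..sqrt r}"
        have z: "cmod ((d * of_real t)\<^sup>2) \<le> 4 * r" using tr[OF t] r by (simp only: cd)
        have z2: "((d * complex_of_real t)\<^sup>2)\<^sup>2 = d ^ 4 * of_real (t ^ 4)"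
          by (simp add: power_mult_distrib power_mult[symmetric])
        have bz: "(1 / \<beta> - 1) * (d * complex_of_real t)\<^sup>2 = (1 / \<beta> - 1) * d\<^sup>2 * of_real (t\<^sup>2)"
          by (simp add: power_mult_distrib)
        have re: "Re (w * of_real x) = Re w * x" for w :: complex and x :: real by simp
        have t4: "(t\<^sup>2)\<^sup>2 = t ^ 4" by (simp add: power_mult[symmetric])
        have "Re ((1 / \<beta> - 1) * (d * complex_of_real t)\<^sup>2) = Re ((1 / \<beta> - 1) * d\<^sup>2) * t\<^sup>2"
          unfolding bz by (rule re)
        moreover have "Re (((d * complex_of_real t)\<^sup>2)\<^sup>2) = Re (d ^ 4) * t ^ 4"
          unfolding z2 by (rule re)
        \<comment> \<open>The quartic term only helps, because Re (d^4) / 12 \<ge> 1/48 exceeds the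
          error 1/10000. The Gaussian bound thus holds on the whole segment, however small \<kappa>
          is.\<close>
        ultimately have "Re ((1 / \<beta> - 1) * d\<^sup>2) * t\<^sup>2 / 2 + Re (d ^ 4) * t ^ 4 / 12 - t ^ 4 / 10000 \<le> Re (f t)"
          using H_lower(1)[OF z, of \<beta>] unfolding cd t4 f_def by simp
        moreover have "2 * \<kappa> * t\<^sup>2 \<le> Re ((1 / \<beta> - 1) * d\<^sup>2) * t\<^sup>2" by (rule mult_right_mono[OF d(3)]) simp
        moreover have "1 / 4 * t ^ 4 \<le> Re (d ^ 4) * t ^ 4" by (rule mult_right_mono[OF d(2)]) simp
        moreover have "0 \<le> t ^ 4" by simp
        ultimately show "\<kappa> * t\<^sup>2 \<le> Re (f t)" by linarith
        have "cmod (f t - a * of_real (t\<^sup>2)) \<le> (t\<^sup>2)\<^sup>2"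
          using H_lower(2)[OF z, of \<beta>] unfolding cd bz by (simp add: f_def a_def)
        then show "cmod (f t - a * of_real (t\<^sup>2) - 0 * of_real (t ^ 3)) \<le> 1 * t ^ 4" unfolding t4 by simp
      qed simp
    qed (use N d in \<open>auto simp: a_def\<close>)
    then have J: "cmod (2 * F (d * of_real (sqrt r)) / d - of_real (sqrt pi) / csqrt (of_nat N * a)) \<le> C / (real N * sqrt (real N))"
      unfolding I by simp
    have "2 * F (d * of_real (sqrt r)) - d * of_real (sqrt pi) / csqrt (of_nat N * a) = d * (2 * F (d * of_real (sqrt r)) / d - of_real (sqrt pi) / csqrt (of_nat N * a))"
      using d0 by (simp add: right_diff_distrib)
    then have "cmod (2 * F (d * of_real (sqrt r)) - d * of_real (sqrt pi) / csqrt (of_nat N * a)) \<le> C / (real N * sqrt (real N))"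
      using J by (simp add: norm_mult d)
    then show "cmod (2 * F (d * of_real (sqrt r)) - d * of_real (sqrt pi) / csqrt (of_nat N * ((1 / \<beta> - 1) * d\<^sup>2 / 2))) \<le> C / (real N * sqrt (real N))"
      by (simp only: a_def of_real_of_nat_eq)
  qed
qed

end

lemma csqrt_quadrant:
  assumes "0 < Im z"
  shows "0 < Re (csqrt z)" "0 < Im (csqrt z)"
proof -
  have "2 * Re (csqrt z) * Im (csqrt z) = Im ((csqrt z)\<^sup>2)" by (simp only: Im_power2)
  then have p: "0 < Re (csqrt z) * Im (csqrt z)" using assms by simp
  show "0 < Re (csqrt z)" using csqrt_principal[of z] p by auto
  then show "0 < Im (csqrt z)" using p by (simp add: zero_less_mult_iff)
qed

section \<open>The path through u_\<beta>\<close>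

context local_saddle
begin

text \<open>Keeps the horizontal line through z_\<beta> off the cut of \<open>csqrt\<close>.
  Subtracting the saddle equations at \<beta> and \<open>cnj \<beta>\<close> isolates imaginary
  parts: Im z_\<beta> / 3 equals Im \<beta> / |\<beta>|^2 up to a small multiple of Im
  z_\<beta>.\<close>

lemma Im_zs_pos:
  assumes \<beta>: "\<beta> \<in> ball 1 c1" and im: "0 < Im \<beta>"
  shows "0 < Im (zs \<beta>)"
proof -
  have cb: "cnj \<beta> \<in> ball 1 c1"
    using \<beta> by (metis complex_cnj_diff complex_cnj_one complex_mod_cnj dist_norm mem_ball)
  have b0: "\<beta> \<noteq> 0" using im by auto
  have "cmod (deriv lc (zs \<beta>) - deriv lc (zs (cnj \<beta>)) + (zs \<beta> - zs (cnj \<beta>)) / 6) \<le> 1 / 10000 * cmod (zs \<beta> - zs (cnj \<beta>))"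
    by (rule lc_quadratic_1[OF r1 lc2 zs_small[OF \<beta>] zs_small[OF cb]])
  then have "cmod (1 / (2 * \<beta>) - 1 / (2 * cnj \<beta>) + (zs \<beta> - cnj (zs \<beta>)) / 6) \<le> 1 / 10000 * cmod (zs \<beta> - cnj (zs \<beta>))"
    unfolding zs_eq[OF \<beta>] zs_eq[OF cb] unfolding zs_cnj[OF \<beta>] .
  moreover have "1 / (2 * \<beta>) - 1 / (2 * cnj \<beta>) = - \<i> * of_real (Im \<beta> / (cmod \<beta>)\<^sup>2)"
  proof -
    have "1 / (2 * \<beta>) - 1 / (2 * cnj \<beta>) = (cnj \<beta> - \<beta>) / (2 * (\<beta> * cnj \<beta>))"
      using b0 by (simp add: field_simps)
    also have "\<dots> = (- 2 * \<i> * of_real (Im \<beta>)) / (2 * of_real ((cmod \<beta>)\<^sup>2))"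
      unfolding complex_norm_square[symmetric] by (simp add: complex_eq_iff)
    finally show ?thesis by simp
  qed
  moreover have "zs \<beta> - cnj (zs \<beta>) = 2 * \<i> * of_real (Im (zs \<beta>))" by (simp add: complex_eq_iff)
  ultimately have "cmod (- \<i> * of_real (Im \<beta> / (cmod \<beta>)\<^sup>2) + 2 * \<i> * of_real (Im (zs \<beta>)) / 6) \<le> 1 / 10000 * cmod (2 * \<i> * of_real (Im (zs \<beta>)))"
    by simp
  moreover have "- \<i> * of_real (Im \<beta> / (cmod \<beta>)\<^sup>2) + 2 * \<i> * of_real (Im (zs \<beta>)) / 6 = \<i> * of_real (Im (zs \<beta>) / 3 - Im \<beta> / (cmod \<beta>)\<^sup>2)"
    by (simp add: algebra_simps)
  ultimately have "\<bar>Im (zs \<beta>) / 3 - Im \<beta> / (cmod \<beta>)\<^sup>2\<bar> \<le> 2 / 10000 * \<bar>Im (zs \<beta>)\<bar>"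
    by (simp only: norm_mult norm_of_real norm_ii norm_numeral) simp
  moreover have "0 < Im \<beta> / (cmod \<beta>)\<^sup>2" using im b0 by simp
  ultimately show ?thesis by linarith
qed

lemma path_arg_bounds:
  assumes \<beta>: "\<beta> \<in> ball 1 c1" and \<tau>: "\<bar>\<tau>\<bar> \<le> r"
  shows "cmod (zs \<beta> + of_real \<tau>) \<le> 4 * r" "cmod (csqrt (zs \<beta> + of_real \<tau>)) < 1"
proof -
  have "cmod (zs \<beta> + of_real \<tau>) \<le> cmod (zs \<beta>) + cmod (of_real \<tau>)" by (rule norm_triangle_ineq)
  then have b: "cmod (zs \<beta> + of_real \<tau>) \<le> r / 300 + r" using zs_bounds(3)[OF \<beta>] \<tau> by simp
  then show "cmod (zs \<beta> + of_real \<tau>) \<le> 4 * r" using r by linarith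
  then show "cmod (csqrt (zs \<beta> + of_real \<tau>)) < 1" using r1 by (intro norm_csqrt_less_1) linarith
qed

lemma path_derivative:
  assumes \<beta>: "\<beta> \<in> ball 1 c1" and im: "0 < Im \<beta>" and F: "\<And>u. (F has_field_derivative gaussian_cosh \<beta> N u) (at u)"
    and \<tau>: "\<bar>\<tau>\<bar> \<le> r"
  shows "((\<lambda>t. csqrt (zs \<beta> + of_real t)) has_vector_derivative inverse (2 * csqrt (zs \<beta> + of_real \<tau>))) (at \<tau> within S)"
    and "((\<lambda>t. F (csqrt (zs \<beta> + of_real t))) has_vector_derivative
        exp (- of_nat N * H \<beta> (zs \<beta> + of_real \<tau>)) * inverse (2 * csqrt (zs \<beta> + of_real \<tau>))) (at \<tau> within S)"
proof -
  have z: "zs \<beta> + of_real \<tau> \<notin> \<real>\<^sub>\<le>\<^sub>0"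
    using Im_zs_pos[OF \<beta> im] by (simp add: complex_nonpos_Reals_iff)
  have "((\<lambda>t. csqrt (zs \<beta> + t)) has_field_derivative inverse (2 * csqrt (zs \<beta> + of_real \<tau>)) * 1) (at (of_real \<tau>))"
    by (rule DERIV_chain2[where f = csqrt and g = "\<lambda>t. zs \<beta> + t" and x = "of_real \<tau>", OF has_field_derivative_csqrt[OF z]]) (auto intro!: derivative_eq_intros)
  then have D: "((\<lambda>t. csqrt (zs \<beta> + t)) has_field_derivative inverse (2 * csqrt (zs \<beta> + of_real \<tau>))) (at (of_real \<tau>))" by simp
  show "((\<lambda>t. csqrt (zs \<beta> + of_real t)) has_vector_derivative inverse (2 * csqrt (zs \<beta> + of_real \<tau>))) (at \<tau> within S)"
    using has_vector_derivative_real_field[OF D] by (rule has_vector_derivative_at_within)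
  have "((\<lambda>t. F (csqrt (zs \<beta> + t))) has_field_derivative
      gaussian_cosh \<beta> N (csqrt (zs \<beta> + of_real \<tau>)) * inverse (2 * csqrt (zs \<beta> + of_real \<tau>))) (at (of_real \<tau>))"
    by (rule DERIV_chain2[where f = F and g = "\<lambda>t. csqrt (zs \<beta> + t)", OF F D])
  moreover have "gaussian_cosh \<beta> N (csqrt (zs \<beta> + of_real \<tau>)) = exp (- of_nat N * H \<beta> (zs \<beta> + of_real \<tau>))"
    using gaussian_cosh_eq_exp[OF path_arg_bounds(2)[OF \<beta> \<tau>]] by simp
  ultimately have "((\<lambda>t. F (csqrt (zs \<beta> + t))) has_field_derivative
      exp (- of_nat N * H \<beta> (zs \<beta> + of_real \<tau>)) * inverse (2 * csqrt (zs \<beta> + of_real \<tau>))) (at (of_real \<tau>))" by simp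
  then show "((\<lambda>t. F (csqrt (zs \<beta> + of_real t))) has_vector_derivative
      exp (- of_nat N * H \<beta> (zs \<beta> + of_real \<tau>)) * inverse (2 * csqrt (zs \<beta> + of_real \<tau>))) (at \<tau> within S)"
    using has_vector_derivative_real_field has_vector_derivative_at_within by blast
qed

text \<open>On the line (z - z_\<beta>)^2 is the real number \<tau>^2, and 1/13 lies below 1/12 -
  1/10000. The rate does not deteriorate as \<beta> approaches 1.\<close>

lemma Re_H_path:
  assumes \<beta>: "\<beta> \<in> ball 1 c1" and \<tau>: "\<bar>\<tau>\<bar> \<le> r"
  shows "Re (hs \<beta>) + \<tau>\<^sup>2 / 13 \<le> Re (H \<beta> (zs \<beta> + of_real \<tau>))"
proof -
  have "(zs \<beta> + of_real \<tau> - zs \<beta>)\<^sup>2 = of_real (\<tau>\<^sup>2)" "cmod (zs \<beta> + of_real \<tau> - zs \<beta>) = \<bar>\<tau>\<bar>" by simp_all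
  then have "\<tau>\<^sup>2 / 12 - \<tau>\<^sup>2 / 10000 \<le> Re (H \<beta> (zs \<beta> + of_real \<tau>) - hs \<beta>)"
    using H_saddle_lower[OF \<beta> path_arg_bounds(1)[OF \<beta> \<tau>]] by simp
  then have "\<tau>\<^sup>2 / 12 - \<tau>\<^sup>2 / 10000 \<le> Re (H \<beta> (zs \<beta> + of_real \<tau>)) - Re (hs \<beta>)" by (simp only: minus_complex.sel)
  then show ?thesis using zero_le_power2[of \<tau>] by linarith
qed

text \<open>The speed of u = csqrt (z_\<beta> + \<tau>) has no uniform bound, since the line may
  pass close to z = 0. Its length has one: u' = 1 / (2 u) with u in the first quadrant, so Re u
  increases, Im u decreases, and |u'| \<le> Re u' - Im u' integrates to at most 4 because |u| <
  1.\<close>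

lemma path_outer:
  assumes \<beta>: "\<beta> \<in> ball 1 c1" and im: "0 < Im \<beta>" and F: "\<And>u. (F has_field_derivative gaussian_cosh \<beta> N u) (at u)"
    and \<tau>: "- r \<le> \<tau>1" "\<tau>1 \<le> \<tau>2" "\<tau>2 \<le> r" and d: "\<And>\<tau>. \<tau>1 \<le> \<tau> \<Longrightarrow> \<tau> \<le> \<tau>2 \<Longrightarrow> d\<^sup>2 \<le> \<tau>\<^sup>2"
  shows "cmod (F (csqrt (zs \<beta> + of_real \<tau>2)) - F (csqrt (zs \<beta> + of_real \<tau>1))) \<le> exp (- real N * (Re (hs \<beta>) + d\<^sup>2 / 13)) * 4"
proof -
  define \<gamma> where "\<gamma> t = csqrt (zs \<beta> + of_real t)" for t :: real
  define \<gamma>' where "\<gamma>' t = inverse (2 * \<gamma> t)" for t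
  define e where "e = exp (- real N * (Re (hs \<beta>) + d\<^sup>2 / 13))"
  have tr: "\<bar>t\<bar> \<le> r" if "t \<in> {\<tau>1..\<tau>2}" for t using that \<tau> by auto
  have I1: "((\<lambda>t. exp (- of_nat N * H \<beta> (zs \<beta> + of_real t)) * \<gamma>' t) has_integral F (\<gamma> \<tau>2) - F (\<gamma> \<tau>1)) {\<tau>1..\<tau>2}"
    unfolding \<gamma>_def \<gamma>'_def
    by (rule fundamental_theorem_of_calculus[OF \<tau>(2)]) (rule path_derivative(2)[OF \<beta> im F tr])
  have I2: "(\<gamma>' has_integral \<gamma> \<tau>2 - \<gamma> \<tau>1) {\<tau>1..\<tau>2}"
    unfolding \<gamma>_def[abs_def] \<gamma>'_def[abs_def]
    by (rule fundamental_theorem_of_calculus[OF \<tau>(2)]) (rule path_derivative(1)[OF \<beta> im F tr])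
  have I3: "((\<lambda>t. e * (Re (\<gamma>' t) - Im (\<gamma>' t))) has_integral e * (Re (\<gamma> \<tau>2 - \<gamma> \<tau>1) - Im (\<gamma> \<tau>2 - \<gamma> \<tau>1))) {\<tau>1..\<tau>2}"
    using has_integral_linear[OF I2 bounded_linear_Re] has_integral_linear[OF I2 bounded_linear_Im]
    by (intro has_integral_mult_right has_integral_diff) (simp_all only: o_def)
  have "cmod (integral {\<tau>1..\<tau>2} (\<lambda>t. exp (- of_nat N * H \<beta> (zs \<beta> + of_real t)) * \<gamma>' t))
      \<le> integral {\<tau>1..\<tau>2} (\<lambda>t. e * (Re (\<gamma>' t) - Im (\<gamma>' t)))"
  proof (rule integral_norm_bound_integral)
    fix t assume t: "t \<in> {\<tau>1..\<tau>2}"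
    have "Re (hs \<beta>) + d\<^sup>2 / 13 \<le> Re (H \<beta> (zs \<beta> + of_real t))"
      using Re_H_path[OF \<beta> tr[OF t]] d[of t] t by auto
    then have "real N * (Re (hs \<beta>) + d\<^sup>2 / 13) \<le> real N * Re (H \<beta> (zs \<beta> + of_real t))" by (rule mult_left_mono) simp
    then have 1: "cmod (exp (- of_nat N * H \<beta> (zs \<beta> + of_real t))) \<le> e" by (simp add: e_def)
    have q: "0 < Re (\<gamma> t)" "0 < Im (\<gamma> t)"
      using csqrt_quadrant[of "zs \<beta> + of_real t"] Im_zs_pos[OF \<beta> im] by (auto simp: \<gamma>_def)
    have "0 \<le> Re (\<gamma>' t)" "Im (\<gamma>' t) \<le> 0"
      using q by (auto simp: \<gamma>'_def complex_inverse divide_nonpos_nonneg)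
    then have 2: "cmod (\<gamma>' t) \<le> Re (\<gamma>' t) - Im (\<gamma>' t)" using cmod_le[of "\<gamma>' t"] by simp
    show "norm (exp (- of_nat N * H \<beta> (zs \<beta> + of_real t)) * \<gamma>' t) \<le> e * (Re (\<gamma>' t) - Im (\<gamma>' t))"
      unfolding norm_mult using 1 2 by (rule mult_mono) (auto simp: e_def)
  qed (use I1 I3 in \<open>auto simp: integrable_on_def\<close>)
  then have "cmod (F (\<gamma> \<tau>2) - F (\<gamma> \<tau>1)) \<le> e * (Re (\<gamma> \<tau>2 - \<gamma> \<tau>1) - Im (\<gamma> \<tau>2 - \<gamma> \<tau>1))"
    by (simp only: integral_unique[OF I1] integral_unique[OF I3])
  also have "\<dots> \<le> e * 4"
  proof (rule mult_left_mono)
    have "cmod (\<gamma> \<tau>1) < 1" "cmod (\<gamma> \<tau>2) < 1"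
      using path_arg_bounds(2)[OF \<beta>] \<tau> by (auto simp: \<gamma>_def)
    then show "Re (\<gamma> \<tau>2 - \<gamma> \<tau>1) - Im (\<gamma> \<tau>2 - \<gamma> \<tau>1) \<le> 4"
      using abs_Re_le_cmod[of "\<gamma> \<tau>1"] abs_Re_le_cmod[of "\<gamma> \<tau>2"] abs_Im_le_cmod[of "\<gamma> \<tau>1"] abs_Im_le_cmod[of "\<gamma> \<tau>2"]
      by simp
  qed (simp add: e_def)
  finally show ?thesis by (simp add: \<gamma>_def e_def)
qed

lemma H_holomorphic:
  assumes \<beta>: "\<beta> \<in> ball 1 c1"
  shows "H \<beta> holomorphic_on ball 0 1"
  unfolding H_def[abs_def]
  by (intro holomorphic_intros lc_holomorphic) (use norm_inverse_near_1(1)[OF ballD(2)[OF \<beta>]] in auto)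

lemma ball_zs_subset:
  assumes \<beta>: "\<beta> \<in> ball 1 c1" and z: "z \<in> ball (zs \<beta>) r"
  shows "cmod z \<le> 4 * r" "z \<in> ball 0 1"
proof -
  have "cmod z \<le> cmod (zs \<beta>) + cmod (z - zs \<beta>)" using norm_triangle_ineq[of "zs \<beta>" "z - zs \<beta>"] by simp
  then show "cmod z \<le> 4 * r" using zs_bounds(3)[OF \<beta>] z r by (simp add: dist_norm norm_minus_commute)
  then show "z \<in> ball 0 1" using r1 by simp
qed

text \<open>The linear coefficient vanishes by \<open>zs_eq\<close>, and |H| \<le> 1 on a disc of
  radius r, independent of \<beta>, bounds the others uniformly. The cubic term is kept because
  \<open>laplace_method\<close> asks for a quartic remainder.\<close>

lemma H_taylor:
  assumes \<beta>: "\<beta> \<in> ball 1 c1"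
  obtains b where "cmod b \<le> (4 / r) ^ 3"
    and "\<And>z. z \<in> ball (zs \<beta>) (r / 2) \<Longrightarrow>
      cmod (H \<beta> z - hs \<beta> - (- deriv (deriv lc) (zs \<beta>) / 2) * (z - zs \<beta>)\<^sup>2 - b * (z - zs \<beta>) ^ 3) \<le> 4 * (4 / r) ^ 4 * cmod (z - zs \<beta>) ^ 4"
proof -
  let ?w = "zs \<beta>"
  have b0: "\<beta> \<noteq> 0" using norm_inverse_near_1(1)[OF ballD(2)[OF \<beta>]] .
  have hol: "H \<beta> holomorphic_on ball ?w r"
    by (rule holomorphic_on_subset[OF H_holomorphic[OF \<beta>]]) (use ball_zs_subset(2)[OF \<beta>] in blast)
  have bd: "cmod (H \<beta> z) \<le> 1" if "z \<in> ball ?w r" for z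
  proof -
    have z: "cmod z \<le> 4 * r" by (rule ball_zs_subset(1)[OF \<beta> that])
    have "cmod (H \<beta> z) \<le> cmod ((1 / \<beta> - 1) * z / 2) + (cmod z)\<^sup>2"
      using H_lower(2)[OF z, of \<beta>] norm_triangle_ineq2[of "H \<beta> z" "(1 / \<beta> - 1) * z / 2"] by linarith
    also have "cmod ((1 / \<beta> - 1) * z / 2) = cmod (1 / \<beta> - 1) * cmod z / 2"
      by (simp only: norm_divide norm_mult norm_numeral)
    also have "\<dots> \<le> 1 / 2 * (1 / 2) / 2"
      using norm_inverse_near_1(4)[OF ballD(2)[OF \<beta>]] ballD(2)[OF \<beta>] z r by (intro divide_right_mono mult_mono) auto
    also have "(cmod z)\<^sup>2 \<le> (1 / 2)\<^sup>2" using z r by (intro power_mono) auto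
    finally show ?thesis by (simp add: power2_eq_square)
  qed
  define b where "b = (deriv ^^ 3) (H \<beta>) ?w / 6"
  have D1: "deriv (H \<beta>) z = 1 / (2 * \<beta>) - deriv lc z" if "cmod z < 1" for z
    by (rule DERIV_imp_deriv) (use b0 that in \<open>auto simp: H_def[abs_def] intro!: derivative_eq_intros DERIV_lc\<close>)
  have w1: "cmod ?w < 1" using ball_zs_subset(2)[OF \<beta>, of ?w] r by simp
  have D2: "deriv (deriv (H \<beta>)) ?w = - deriv (deriv lc) ?w"
  proof (rule DERIV_imp_deriv)
    have "((\<lambda>z. 1 / (2 * \<beta>) - deriv lc z) has_field_derivative - deriv (deriv lc) ?w) (at ?w)"
      using w1 by (auto intro!: derivative_eq_intros DERIV_lc1)
    then show "(deriv (H \<beta>) has_field_derivative - deriv (deriv lc) ?w) (at ?w)"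
      by (rule has_field_derivative_transform_within_open[where S = "ball 0 1"]) (use w1 D1 in auto)
  qed
  show thesis
  proof (rule that)
    have "cmod ((deriv ^^ 3) (H \<beta>) ?w) \<le> fact 3 * 1 * (4 / r) ^ 3"
      by (rule higher_deriv_bound_ball[OF hol bd]) (use r in auto)
    then show "cmod b \<le> (4 / r) ^ 3" by (simp add: b_def norm_divide fact_numeral)
    fix z assume z: "z \<in> ball ?w (r / 2)"
    have "cmod (H \<beta> z - (\<Sum>k\<le>3. (deriv ^^ k) (H \<beta>) ?w * (z - ?w) ^ k / fact k))
        \<le> real (Suc 3) * 1 * (4 / r) ^ Suc 3 * cmod (z - ?w) ^ Suc 3"
      by (rule taylor_remainder_ball[OF hol bd _ z]) (use r in auto)
    moreover have "(\<Sum>k\<le>3. (deriv ^^ k) (H \<beta>) ?w * (z - ?w) ^ k / fact k)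
        = hs \<beta> + (- deriv (deriv lc) ?w / 2) * (z - ?w)\<^sup>2 + b * (z - ?w) ^ 3"
      using D1[OF w1] by (simp add: eval_nat_numeral b_def D2 zs_eq[OF \<beta>] hs_eq_H)
    ultimately have "cmod (H \<beta> z - (hs \<beta> + (- deriv (deriv lc) ?w / 2) * (z - ?w)\<^sup>2 + b * (z - ?w) ^ 3))
        \<le> real (Suc 3) * 1 * (4 / r) ^ Suc 3 * cmod (z - ?w) ^ Suc 3" by (simp only:)
    then show "cmod (H \<beta> z - hs \<beta> - (- deriv (deriv lc) ?w / 2) * (z - ?w)\<^sup>2 - b * (z - ?w) ^ 3) \<le> 4 * (4 / r) ^ 4 * cmod (z - ?w) ^ 4"
      by (simp only: diff_diff_eq) simp
  qed
qed

lemma Re_zs: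
  assumes \<beta>: "\<beta> \<in> ball 1 c1" and re: "cmod (\<beta> - 1) / 10 \<le> Re (\<beta> - 1)"
  shows "29 / 100 * cmod (\<beta> - 1) \<le> Re (zs \<beta>)"
proof -
  have "Re (3 * (\<beta> - 1) - zs \<beta>) \<le> cmod (\<beta> - 1) / 100"
    using zs_approx[OF \<beta>] complex_Re_le_cmod[of "3 * (\<beta> - 1) - zs \<beta>"] by (simp add: norm_minus_commute)
  then show ?thesis using re by simp
qed

text \<open>The function is du/dz for z = u^2. It blows up at 0, so its expansion at z_\<beta> needs
  distance from 0 and its constants depend on \<delta>; 29/100 is the constant of
  \<open>Re_zs\<close>, and on the disc of radius \<delta>/5 the real part stays above 9/100
  \<delta>.\<close>

lemma inverse_csqrt_taylor:
  assumes \<delta>: "0 < \<delta>"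
  obtains M where "0 < M" and
    "\<And>w. 29 / 100 * \<delta> \<le> Re w \<Longrightarrow> cmod (inverse (2 * csqrt w)) \<le> M \<and>
       (\<exists>g1. cmod g1 \<le> M \<and> (\<forall>z\<in>ball w (\<delta> / 10). cmod (inverse (2 * csqrt z) - inverse (2 * csqrt w) - g1 * (z - w)) \<le> M * (cmod (z - w))\<^sup>2))"
proof -
  define M0 where "M0 = 1 / sqrt (9 / 100 * \<delta>)"
  define M where "M = M0 + M0 * (20 / \<delta>) + 2 * M0 * (20 / \<delta>)\<^sup>2"
  have M0: "0 < M0" using \<delta> by (simp add: M0_def)
  have "0 \<le> M0 * (20 / \<delta>)" "0 \<le> 2 * M0 * (20 / \<delta>)\<^sup>2" using M0 \<delta> by auto
  then have M: "0 < M" "M0 \<le> M" "M0 * (20 / \<delta>) \<le> M" "2 * M0 * (20 / \<delta>)\<^sup>2 \<le> M" using M0 unfolding M_def by linarith+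
  show thesis
  proof (rule that[OF M(1)], intro conjI)
    fix w assume w: "29 / 100 * \<delta> \<le> Re w"
    let ?g = "\<lambda>z. inverse (2 * csqrt z)"
    have re: "9 / 100 * \<delta> \<le> Re z" if "z \<in> ball w (\<delta> / 5)" for z
      using that w complex_Re_le_cmod[of "w - z"] by (simp add: dist_norm)
    have np: "z \<notin> \<real>\<^sub>\<le>\<^sub>0" "csqrt z \<noteq> 0" if "z \<in> ball w (\<delta> / 5)" for z
      using re[OF that] \<delta> by (auto simp: complex_nonpos_Reals_iff)
    have hol: "?g holomorphic_on ball w (\<delta> / 5)"
      by (intro holomorphic_intros) (use np in auto)
    have bd: "cmod (?g z) \<le> M0" if "z \<in> ball w (\<delta> / 5)" for z
    proof -
      have "9 / 100 * \<delta> \<le> cmod z" using re[OF that] complex_Re_le_cmod order_trans by blast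
      then have "sqrt (9 / 100 * \<delta>) \<le> sqrt (cmod z)" by (rule real_sqrt_le_mono)
      moreover have "0 < sqrt (9 / 100 * \<delta>)" using \<delta> by simp
      ultimately have "inverse (sqrt (cmod z)) \<le> M0" unfolding M0_def inverse_eq_divide
        by (intro divide_left_mono mult_pos_pos) linarith+
      moreover have "cmod (?g z) = inverse (sqrt (cmod z)) / 2" by (simp add: norm_inverse norm_mult norm_csqrt)
      moreover have "0 \<le> inverse (sqrt (cmod z))" by simp
      ultimately show ?thesis by linarith
    qed
    have \<delta>5: "0 < \<delta> / 5" using \<delta> by simp
    have g0: "cmod (?g w) \<le> M0" by (rule bd) (use \<delta> in auto)
    then show "cmod (?g w) \<le> M" using M by linarith
    have "cmod ((deriv ^^ 1) ?g w) \<le> fact 1 * M0 * (4 / (\<delta> / 5)) ^ 1"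
      by (rule higher_deriv_bound_ball[OF hol bd \<delta>5]) (use \<delta> in auto)
    then have g1: "cmod (deriv ?g w) \<le> M" using M by simp
    moreover have "cmod (?g z - ?g w - deriv ?g w * (z - w)) \<le> M * (cmod (z - w))\<^sup>2" if z: "z \<in> ball w (\<delta> / 10)" for z
    proof -
      have z': "z \<in> ball w (\<delta> / 5 / 2)" using z by simp
      have "cmod (?g z - (\<Sum>k\<le>1. (deriv ^^ k) ?g w * (z - w) ^ k / fact k)) \<le> real (Suc 1) * M0 * (4 / (\<delta> / 5)) ^ Suc 1 * cmod (z - w) ^ Suc 1"
        by (rule taylor_remainder_ball[OF hol bd \<delta>5 z'])
      then have "cmod (?g z - ?g w - deriv ?g w * (z - w)) \<le> 2 * M0 * (20 / \<delta>)\<^sup>2 * (cmod (z - w))\<^sup>2"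
        by (simp add: diff_diff_eq numeral_2_eq_2)
      also have "\<dots> \<le> M * (cmod (z - w))\<^sup>2" using M by (intro mult_right_mono) auto
      finally show ?thesis .
    qed
    ultimately show "\<exists>g1. cmod g1 \<le> M \<and> (\<forall>z\<in>ball w (\<delta> / 10). cmod (?g z - ?g w - g1 * (z - w)) \<le> M * (cmod (z - w))\<^sup>2)"
      by blast
  qed
qed

text \<open>Only the part |\<tau>| \<le> d of the line is treated by Laplace's method, with the
  exponential at the saddle factored out. On the rest du/dz has no useful expansion, and
  \<open>path_outer\<close> applies.\<close>

lemma saddle_u_asymptotics:
  assumes \<delta>: "0 < \<delta>"
  obtains C where "0 < C" and "\<And>\<beta> N F. \<beta> \<in> ball 1 c1 \<Longrightarrow> 1 \<le> N \<Longrightarrow>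
     (\<And>u. (F has_field_derivative gaussian_cosh \<beta> N u) (at u)) \<Longrightarrow>
     \<delta> \<le> cmod (\<beta> - 1) \<Longrightarrow> 0 < Im \<beta> \<Longrightarrow> cmod (\<beta> - 1) / 10 \<le> Re (\<beta> - 1) \<Longrightarrow>
     cmod (2 * (F (csqrt (zs \<beta> + of_real r)) - F (csqrt (zs \<beta> - of_real r)))
        - exp (- of_nat N * hs \<beta>) * (of_real (sqrt pi) / (csqrt (zs \<beta>) * csqrt (of_nat N * (- deriv (deriv lc) (zs \<beta>) / 2)))))
       \<le> C / (real N * sqrt (real N)) * exp (- real N * Re (hs \<beta>))"
proof -
  obtain Mg where Mg: "0 < Mg" and g: "\<And>w. 29 / 100 * \<delta> \<le> Re w \<Longrightarrow> cmod (inverse (2 * csqrt w)) \<le> Mg \<and>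
       (\<exists>g1. cmod g1 \<le> Mg \<and> (\<forall>z\<in>ball w (\<delta> / 10). cmod (inverse (2 * csqrt z) - inverse (2 * csqrt w) - g1 * (z - w)) \<le> Mg * (cmod (z - w))\<^sup>2))"
    using inverse_csqrt_taylor[OF \<delta>] by blast
  \<comment> \<open>Below \<delta>/10 for the expansion of du/dz, below r/2 for that of H.\<close>
  define d where "d = min (\<delta> / 20) (r / 4)"
  have d: "0 < d" "d < \<delta> / 10" "d < r / 2" "d < r" using \<delta> r by (auto simp: d_def min_def)
  define M where "M = Mg + (4 / r) ^ 3 + 4 * (4 / r) ^ 4"
  have "0 < (4 / r) ^ 3" "0 < 4 * (4 / r) ^ 4" using r by auto
  then have M: "0 \<le> M" "Mg \<le> M" "(4 / r) ^ 3 \<le> M" "4 * (4 / r) ^ 4 \<le> M" using Mg unfolding M_def by linarith+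
  have k13: "(0::real) < 1 / 13" by simp
  show thesis
  proof (rule laplace_method[OF k13 d(1) M(1)])
    fix C0 :: real assume C0: "0 < C0" and lap: "\<And>n f g a b g0 g1. 1 \<le> n \<Longrightarrow> continuous_on {-d..d} f \<Longrightarrow> continuous_on {-d..d} g \<Longrightarrow>
     (\<forall>t\<in>{-d..d}. 1 / 13 * t\<^sup>2 \<le> Re (f t) \<and> cmod (f t - a * of_real (t\<^sup>2) - b * of_real (t ^ 3)) \<le> M * t ^ 4
        \<and> cmod (g t - g0 - g1 * of_real t) \<le> M * t\<^sup>2) \<Longrightarrow>
     cmod b \<le> M \<Longrightarrow> cmod g0 \<le> M \<Longrightarrow> cmod g1 \<le> M \<Longrightarrow> 1 / 13 \<le> Re a \<Longrightarrow>
     cmod (integral {-d..d} (\<lambda>t. exp (- of_real n * f t) * g t) - g0 * of_real (sqrt pi) / csqrt (of_real n * a))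
       \<le> C0 / (n * sqrt n)"
    define k where "k = d\<^sup>2 / 13"
    have k: "0 < k" using d by (simp add: k_def)
    \<comment> \<open>16 is the product of the overall factor 2, the two outer pieces, and the
      length bound 4.\<close>
    define C where "C = 2 * C0 + 16 * (2 / k\<^sup>2)"
    have C: "0 < C" unfolding C_def using C0 k by (simp add: add_pos_pos)
    show thesis
    proof (rule that[OF C])
      fix \<beta> :: complex and N :: nat and F
      assume \<beta>: "\<beta> \<in> ball 1 c1" and N: "1 \<le> N" and F: "\<And>u. (F has_field_derivative gaussian_cosh \<beta> N u) (at u)"
        and \<beta>\<delta>: "\<delta> \<le> cmod (\<beta> - 1)" and im: "0 < Im \<beta>" and re: "cmod (\<beta> - 1) / 10 \<le> Re (\<beta> - 1)"
      let ?w = "zs \<beta>"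
      define \<gamma> where "\<gamma> t = csqrt (?w + of_real t)" for t :: real
      define X where "X = exp (- of_nat N * hs \<beta>)"
      have cX: "cmod X = exp (- real N * Re (hs \<beta>))" by (simp add: X_def)
      define a where "a = - deriv (deriv lc) ?w / 2"
      obtain b where b: "cmod b \<le> (4 / r) ^ 3" and ht: "\<And>z. z \<in> ball ?w (r / 2) \<Longrightarrow>
         cmod (H \<beta> z - hs \<beta> - a * (z - ?w)\<^sup>2 - b * (z - ?w) ^ 3) \<le> 4 * (4 / r) ^ 4 * cmod (z - ?w) ^ 4"
        using H_taylor[OF \<beta>] unfolding a_def by blast
      have wre: "29 / 100 * \<delta> \<le> Re ?w" using Re_zs[OF \<beta> re] \<beta>\<delta> by linarith
      obtain g1 where g0: "cmod (inverse (2 * csqrt ?w)) \<le> Mg" and g1: "cmod g1 \<le> Mg"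
        and gt: "\<And>z. z \<in> ball ?w (\<delta> / 10) \<Longrightarrow> cmod (inverse (2 * csqrt z) - inverse (2 * csqrt ?w) - g1 * (z - ?w)) \<le> Mg * (cmod (z - ?w))\<^sup>2"
        using g[OF wre] by blast
      define f where "f t = H \<beta> (?w + of_real t) - hs \<beta>" for t :: real
      define gg where "gg t = inverse (2 * csqrt (?w + of_real t))" for t :: real
      have z: "?w + of_real t \<in> ball ?w (r / 2)" "?w + of_real t \<in> ball ?w (\<delta> / 10)" "\<bar>t\<bar> \<le> r" if "t \<in> {-d..d}" for t
        using that d by (auto simp: dist_norm)
      have mid: "cmod (integral {-d..d} (\<lambda>t. exp (- of_real (real N) * f t) * gg t) - inverse (2 * csqrt ?w) * of_real (sqrt pi) / csqrt (of_real (real N) * a))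
         \<le> C0 / (real N * sqrt (real N))"
      proof (rule lap[where b = b and ?g1.0 = g1])
        have c: "continuous_on (ball 0 1) (H \<beta>)"
          using H_holomorphic[OF \<beta>] by (rule holomorphic_on_imp_continuous_on)
        have im: "(\<lambda>t. ?w + of_real t) ` {-d..d} \<subseteq> ball 0 1"
          using path_arg_bounds(1)[OF \<beta> z(3)] r1 by force
        show "continuous_on {-d..d} f" unfolding f_def
          by (intro continuous_intros continuous_on_compose2[OF c _ im])
        have "continuous (at t within {-d..d}) (\<lambda>t. csqrt (?w + of_real t))" if "t \<in> {-d..d}" for t
          by (rule has_vector_derivative_continuous[OF path_derivative(1)[OF \<beta> \<open>0 < Im \<beta>\<close> F z(3)[OF that]]])
        then have "continuous_on {-d..d} (\<lambda>t. csqrt (?w + of_real t))"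
          by (simp add: continuous_on_eq_continuous_within)
        moreover have "csqrt (?w + of_real t) \<noteq> 0" for t :: real
        proof -
          have "0 < Im (?w + of_real t)" using Im_zs_pos[OF \<beta> \<open>0 < Im \<beta>\<close>] by simp
          from csqrt_quadrant(1)[OF this] show ?thesis by (metis less_irrefl zero_complex.sel(1))
        qed
        ultimately show "continuous_on {-d..d} gg" unfolding gg_def
          by (intro continuous_intros) auto
        show "\<forall>t\<in>{-d..d}. 1 / 13 * t\<^sup>2 \<le> Re (f t) \<and> cmod (f t - a * of_real (t\<^sup>2) - b * of_real (t ^ 3)) \<le> M * t ^ 4
          \<and> cmod (gg t - inverse (2 * csqrt ?w) - g1 * of_real t) \<le> M * t\<^sup>2"
        proof (intro ballI conjI)
          fix t assume t: "t \<in> {-d..d}"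
          show "1 / 13 * t\<^sup>2 \<le> Re (f t)" using Re_H_path[OF \<beta> z(3)[OF t]] by (simp add: f_def)
          have "cmod (f t - a * of_real (t\<^sup>2) - b * of_real (t ^ 3)) \<le> 4 * (4 / r) ^ 4 * t ^ 4"
            using ht[OF z(1)[OF t]] by (simp add: f_def power_even_abs)
          also have "\<dots> \<le> M * t ^ 4" using M(4) by (rule mult_right_mono) simp
          finally show "cmod (f t - a * of_real (t\<^sup>2) - b * of_real (t ^ 3)) \<le> M * t ^ 4" .
          have "cmod (gg t - inverse (2 * csqrt ?w) - g1 * of_real t) \<le> Mg * t\<^sup>2"
            using gt[OF z(2)[OF t]] by (simp add: gg_def)
          also have "\<dots> \<le> M * t\<^sup>2" using M(2) by (rule mult_right_mono) simp
          finally show "cmod (gg t - inverse (2 * csqrt ?w) - g1 * of_real t) \<le> M * t\<^sup>2" .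
        qed
        have "cmod (deriv (deriv lc) ?w + 1 / 6) \<le> 1 / 10000" by (rule lc2[OF zs_small[OF \<beta>]])
        then have "Re (deriv (deriv lc) ?w + 1 / 6) \<le> 1 / 10000" using complex_Re_le_cmod order_trans by blast
        then show "1 / 13 \<le> Re a" by (simp add: a_def)
      qed (use N b g0 g1 M in auto)
      have "((\<lambda>t. exp (- of_nat N * H \<beta> (?w + of_real t)) * gg t) has_integral (F (\<gamma> d) - F (\<gamma> (-d)))) {-d..d}"
        unfolding \<gamma>_def gg_def
        by (rule fundamental_theorem_of_calculus) (use d path_derivative(2)[OF \<beta> im F z(3)] in auto)
      moreover have "exp (- of_nat N * H \<beta> (?w + of_real t)) * gg t = X * (exp (- of_real (real N) * f t) * gg t)" for t
        by (simp add: X_def f_def exp_add[symmetric] algebra_simps)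
      ultimately have "((\<lambda>t. X * (exp (- of_real (real N) * f t) * gg t)) has_integral (F (\<gamma> d) - F (\<gamma> (-d)))) {-d..d}"
        by (simp only:)
      then have "integral {-d..d} (\<lambda>t. X * (exp (- of_real (real N) * f t) * gg t)) = F (\<gamma> d) - F (\<gamma> (-d))"
        by (rule integral_unique)
      then have I: "F (\<gamma> d) - F (\<gamma> (-d)) = X * integral {-d..d} (\<lambda>t. exp (- of_real (real N) * f t) * gg t)"
        unfolding integral_mult_right by (rule sym)
      have "F (\<gamma> d) - F (\<gamma> (-d)) - X * (inverse (2 * csqrt ?w) * of_real (sqrt pi) / csqrt (of_real (real N) * a))
         = X * (integral {-d..d} (\<lambda>t. exp (- of_real (real N) * f t) * gg t) - inverse (2 * csqrt ?w) * of_real (sqrt pi) / csqrt (of_real (real N) * a))"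
        unfolding I by (simp add: right_diff_distrib)
      then have B1: "cmod (F (\<gamma> d) - F (\<gamma> (-d)) - X * (inverse (2 * csqrt ?w) * of_real (sqrt pi) / csqrt (of_real (real N) * a)))
         \<le> cmod X * (C0 / (real N * sqrt (real N)))"
        using mult_left_mono[OF mid, of "cmod X"] by (simp only: norm_mult norm_ge_zero)
      have ek: "exp (- real N * (Re (hs \<beta>) + d\<^sup>2 / 13)) \<le> cmod X * (2 / k\<^sup>2 / (real N * sqrt (real N)))"
      proof -
        have "exp (- real N * (Re (hs \<beta>) + d\<^sup>2 / 13)) = cmod X * exp (- (k * real N))"
          by (simp add: cX k_def exp_add[symmetric] algebra_simps)
        also have "\<dots> \<le> cmod X * (2 / k\<^sup>2 / (real N * sqrt (real N)))"
        proof (rule mult_left_mono)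
          have "exp (- (k * real N)) \<le> 2 / k\<^sup>2 / (real N)\<^sup>2" by (rule exp_neg_le_inverse_power2[OF k]) (use N in simp)
          also have "\<dots> \<le> 2 / k\<^sup>2 / (real N * sqrt (real N))"
          proof (rule divide_left_mono)
            have "sqrt (real N) \<le> real N" using N by (intro real_le_lsqrt self_le_power) auto
            then show "real N * sqrt (real N) \<le> (real N)\<^sup>2" unfolding power2_eq_square by (rule mult_left_mono) simp
          qed (use N in auto)
          finally show "exp (- (k * real N)) \<le> 2 / k\<^sup>2 / (real N * sqrt (real N))" .
        qed simp
        finally show ?thesis .
      qed
      have dd: "d\<^sup>2 \<le> \<tau>\<^sup>2" if "d \<le> \<bar>\<tau>\<bar>" for \<tau>
        using that d by (metis abs_le_square_iff abs_of_pos)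
      have "cmod (F (\<gamma> r) - F (\<gamma> d)) \<le> exp (- real N * (Re (hs \<beta>) + d\<^sup>2 / 13)) * 4"
        unfolding \<gamma>_def by (rule path_outer[OF \<beta> im F]) (use d dd in auto)
      then have B2: "cmod (F (\<gamma> r) - F (\<gamma> d)) \<le> cmod X * (2 / k\<^sup>2 / (real N * sqrt (real N))) * 4" using mult_right_mono[OF ek, of 4] by simp
      have "cmod (F (\<gamma> (-d)) - F (\<gamma> (-r))) \<le> exp (- real N * (Re (hs \<beta>) + d\<^sup>2 / 13)) * 4"
        unfolding \<gamma>_def by (rule path_outer[OF \<beta> im F]) (use d dd in auto)
      then have B3: "cmod (F (\<gamma> (-d)) - F (\<gamma> (-r))) \<le> cmod X * (2 / k\<^sup>2 / (real N * sqrt (real N))) * 4" using mult_right_mono[OF ek, of 4] by simp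
      have eq: "2 * (F (\<gamma> r) - F (\<gamma> (-r))) - X * (of_real (sqrt pi) / (csqrt ?w * csqrt (of_nat N * a)))
         = 2 * ((F (\<gamma> d) - F (\<gamma> (-d)) - X * (inverse (2 * csqrt ?w) * of_real (sqrt pi) / csqrt (of_real (real N) * a)))
            + ((F (\<gamma> r) - F (\<gamma> d)) + (F (\<gamma> (-d)) - F (\<gamma> (-r)))))"
        by (simp add: field_simps)
      have "cmod (2 * (F (\<gamma> r) - F (\<gamma> (-r))) - X * (of_real (sqrt pi) / (csqrt ?w * csqrt (of_nat N * a))))
         \<le> 2 * (cmod X * (C0 / (real N * sqrt (real N))) + (cmod X * (2 / k\<^sup>2 / (real N * sqrt (real N))) * 4 + cmod X * (2 / k\<^sup>2 / (real N * sqrt (real N))) * 4))"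
        unfolding eq norm_mult norm_numeral by (intro mult_left_mono norm_triangle_le add_mono B1 B2 B3) simp
      also have "\<dots> = C / (real N * sqrt (real N)) * cmod X"
        by (simp add: C_def add_divide_distrib algebra_simps)
      finally show "cmod (2 * (F (csqrt (zs \<beta> + of_real r)) - F (csqrt (zs \<beta> - of_real r)))
        - exp (- of_nat N * hs \<beta>) * (of_real (sqrt pi) / (csqrt (zs \<beta>) * csqrt (of_nat N * (- deriv (deriv lc) (zs \<beta>) / 2)))))
       \<le> C / (real N * sqrt (real N)) * exp (- real N * Re (hs \<beta>))"
        unfolding cX unfolding \<gamma>_def a_def X_def by simp
    qed
  qed
qed

end

section \<open>Identification of the coefficients and assembly of the contour\<close>

lemma Re_csqrt_nonneg: "0 \<le> Re (csqrt z)"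
  using csqrt_principal[of z] by linarith

context local_saddle
begin

lemma csqrt_near_1:
  assumes \<beta>: "\<beta> \<in> ball 1 c1"
  shows "cmod (csqrt \<beta> - 1) \<le> 1 / 1000" "1 / 2 \<le> cmod (csqrt \<beta>)"
proof -
  have "cmod (csqrt \<beta> - of_real 1) \<le> cmod ((csqrt \<beta>)\<^sup>2 - of_real (1\<^sup>2)) / 1"
    by (rule csqrt_diff_bound) (simp_all only: Re_csqrt_nonneg zero_less_one)
  then show "cmod (csqrt \<beta> - 1) \<le> 1 / 1000" using ballD(2)[OF \<beta>] by simp
  then show "1 / 2 \<le> cmod (csqrt \<beta>)" using norm_triangle_ineq2[of 1 "1 - csqrt \<beta>"] by (simp add: norm_minus_commute)
qed

lemma sqrt_half: "sqrt (real N / (2 * pi)) * sqrt pi = sqrt (real N / 2)"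
  by (simp add: real_sqrt_mult[symmetric])

text \<open>The squares agree at once; the point is the branch. As s and c lie in the open first
  quadrant, V = - i s c / n has positive real part, and V^2 = 1 - \<beta>, so V is the principal
  root.\<close>

lemma saddle_zero_coefficient:
  assumes \<beta>: "\<beta> \<in> ball 1 c1" and im: "0 < Im \<beta>" and N: "1 \<le> N"
  shows "of_real (sqrt (real N / (2 * pi))) * (\<i> * of_real (sqrt pi) / csqrt (of_nat N * ((1 / \<beta> - 1) * \<i>\<^sup>2 / 2))) / csqrt \<beta> = A \<beta>"
proof -
  define s where "s = csqrt \<beta>"
  define c where "c = csqrt (of_nat N * ((1 / \<beta> - 1) * \<i>\<^sup>2 / 2))"
  define n where "n = sqrt (real N / 2)"
  have n: "0 < n" "(complex_of_real n)\<^sup>2 = of_nat N / 2" using N by (auto simp: n_def simp flip: of_real_power)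
  have b0: "\<beta> \<noteq> 0" using im by auto
  have s2: "s\<^sup>2 = \<beta>" and c2: "c\<^sup>2 = of_nat N * (1 - 1 / \<beta>) / 2" by (auto simp: s_def c_def)
  have sq: "0 < Re s" "0 < Im s" using csqrt_quadrant[OF im] by (auto simp: s_def)
  have "of_nat N * ((1 / \<beta> - 1) * \<i>\<^sup>2 / 2) = of_real (real N / 2) * (1 - 1 / \<beta>)" by simp
  moreover have "0 < Im (1 - 1 / \<beta>)" using im b0 by (simp add: Im_divide cmod_power2[symmetric])
  ultimately have "0 < Im (of_nat N * ((1 / \<beta> - 1) * \<i>\<^sup>2 / 2))" using N by (simp only: Im_complex_of_real complex.sel times_complex.sel Re_complex_of_real) (simp add: mult_pos_neg)
  then have cq: "0 < Re c" "0 < Im c" unfolding c_def by (rule csqrt_quadrant)+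
  define V where "V = - \<i> * (s * c) / of_real n"
  have "V\<^sup>2 = - (\<beta> * (of_nat N * (1 - 1 / \<beta>) / 2)) / (of_nat N / 2)"
    unfolding V_def power_divide power_mult_distrib s2 c2 n(2) by simp
  also have "\<dots> = 1 - \<beta>" using N b0 by (simp add: field_simps)
  finally have V2: "V\<^sup>2 = 1 - \<beta>" .
  have "Re V = (Re s * Im c + Im s * Re c) / n" unfolding V_def using n by (simp add: Re_divide_of_real field_simps)
  then have "0 < Re V" using sq cq n by (simp add: add_pos_pos)
  then have "csqrt (1 - \<beta>) = V" using V2 by (intro csqrt_unique) auto
  then have "A \<beta> = 1 / V" by (simp add: A_def)
  also have "\<dots> = of_real n * \<i> / (c * s)"
  proof -
    have "s \<noteq> 0" "c \<noteq> 0" using sq cq by auto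
    then have "(of_real n * \<i> / (c * s)) * V = 1" using n(1) unfolding V_def by simp
    moreover have "V \<noteq> 0" using \<open>0 < Re V\<close> by auto
    ultimately show ?thesis by (simp only: divide_eq_eq) simp
  qed
  also have "\<dots> = of_real (sqrt (real N / (2 * pi)) * sqrt pi) * \<i> / (c * s)" by (simp only: sqrt_half n_def)
  finally show ?thesis unfolding c_def[symmetric] s_def[symmetric] by (simp add: mult_ac)
qed

text \<open>\<open>lc_ode\<close> at z_\<beta> turns 8 \<beta>^2 z_\<beta> a into the denominator
  under the root in B, which settles the squares. For the sign, s c is close to the positive number
  m and |u| < 2 Re u, so s c u and its reciprocal have positive real part.\<close>

lemma saddle_u_coefficient:
  assumes \<beta>: "\<beta> \<in> ball 1 c1" and im: "0 < Im \<beta>" and re: "cmod (\<beta> - 1) / 10 \<le> Re (\<beta> - 1)" and N: "1 \<le> N"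
  shows "of_real (sqrt (real N / (2 * pi))) * (of_real (sqrt pi) / (csqrt (zs \<beta>) * csqrt (of_nat N * (- deriv (deriv lc) (zs \<beta>) / 2)))) / csqrt \<beta> = B \<beta>"
proof -
  define s where "s = csqrt \<beta>"
  define a where "a = - deriv (deriv lc) (zs \<beta>) / 2"
  define c where "c = csqrt (of_nat N * a)"
  define u where "u = csqrt (zs \<beta>)"
  define w where "w = \<beta> - \<beta>\<^sup>2 + zs \<beta>"
  define n where "n = sqrt (real N / 2)"
  have n: "0 < n" "(complex_of_real n)\<^sup>2 = of_nat N / 2" using N by (auto simp: n_def simp flip: of_real_power)
  have b0: "\<beta> \<noteq> 0" and \<beta>1: "\<beta> \<noteq> 1" using im by auto
  have q: "0 < cmod (\<beta> - 1)" using \<beta>1 by simp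
  have s2: "s\<^sup>2 = \<beta>" and c2: "c\<^sup>2 = of_nat N * a" and u2: "u\<^sup>2 = zs \<beta>" by (auto simp: s_def c_def u_def)
  have w0: "w \<noteq> 0" using B_denominator_bounds(1)[OF \<beta>] q by (auto simp: w_def)
  have za: "8 * \<beta>\<^sup>2 * (zs \<beta> * a) = w"
  proof -
    have "cmod (zs \<beta>) < 1" using zs_small[OF \<beta>] r1 by linarith
    from lc_ode[OF this] have o: "1 / \<beta> + 4 * zs \<beta> * deriv (deriv lc) (zs \<beta>) + zs \<beta> / \<beta>\<^sup>2 = 1"
      by (simp add: zs_eq[OF \<beta>] power_divide power_mult_distrib)
    then have "\<beta>\<^sup>2 * (1 / \<beta> + 4 * zs \<beta> * deriv (deriv lc) (zs \<beta>) + zs \<beta> / \<beta>\<^sup>2) = \<beta>\<^sup>2" by simp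
    then have "\<beta> + 4 * \<beta>\<^sup>2 * zs \<beta> * deriv (deriv lc) (zs \<beta>) + zs \<beta> = \<beta>\<^sup>2"
      using b0 by (simp add: distrib_left power2_eq_square mult_ac)
    then show ?thesis by (simp add: w_def a_def algebra_simps)
  qed
  \<comment> \<open>The value of c if lc'' were exactly - 1/6, that is, a = 1/12.\<close>
  define m where "m = sqrt (real N / 12)"
  have m: "0 < m" "m\<^sup>2 = real N / 12" using N by (auto simp: m_def)
  have "cmod (c - of_real m) \<le> cmod (c\<^sup>2 - of_real (m\<^sup>2)) / m"
    by (rule csqrt_diff_bound[OF _ m(1)]) (simp only: c_def Re_csqrt_nonneg)
  also have "c\<^sup>2 - of_real (m\<^sup>2) = - (of_real (real N / 2) * (deriv (deriv lc) (zs \<beta>) + 1 / 6))"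
    unfolding c2 m a_def by (simp add: field_simps)
  also have "cmod \<dots> / m \<le> (real N / 2 * (1 / 10000)) / m"
    unfolding norm_minus_cancel norm_mult using lc2[OF zs_small[OF \<beta>]] m
    by (intro divide_right_mono mult_mono) auto
  also have "\<dots> = 6 / 10000 * m" using m by (simp add: field_simps power2_eq_square)
  finally have cm: "cmod (c - of_real m) \<le> 6 / 10000 * m" .
  have "cmod (s * c - of_real m) \<le> m / 100"
  proof -
    have "s * c - of_real m = (s - 1) * c + (c - of_real m)" by (simp add: algebra_simps)
    then have f1: "cmod (s * c - of_real m) \<le> cmod (s - 1) * cmod c + cmod (c - of_real m)"
      by (metis norm_mult norm_triangle_ineq)
    have "cmod c \<le> m + 6 / 10000 * m" using cm norm_triangle_ineq2[of c "of_real m"] m by simp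
    then have f2: "cmod (s - 1) * cmod c \<le> 1 / 1000 * (m + 6 / 10000 * m)"
      using csqrt_near_1(1)[OF \<beta>] by (intro mult_mono) (auto simp: s_def)
    show ?thesis using order_trans[OF f1 add_mono[OF f2 cm]] m(1) by simp
  qed
  then have e: "cmod ((s * c - of_real m) * u) \<le> m / 100 * cmod u"
    unfolding norm_mult by (rule mult_right_mono) simp
  have "0 < Re (zs \<beta>)" using Re_zs[OF \<beta> re] q by linarith
  then have "0 < (Re u)\<^sup>2 - (Im u)\<^sup>2" unfolding u2[symmetric] by (simp add: Re_power2)
  moreover have "(2 * Re u)\<^sup>2 = 4 * (Re u)\<^sup>2" by (simp add: power_mult_distrib)
  ultimately have "(cmod u)\<^sup>2 < (2 * Re u)\<^sup>2" using cmod_power2[of u] zero_le_power2[of "Re u"] by linarith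
  moreover have ru: "0 \<le> Re u" unfolding u_def by (rule Re_csqrt_nonneg)
  ultimately have uu: "cmod u < 2 * Re u" using power2_less_imp_less[of "cmod u" "2 * Re u"] by linarith
  have "Re (s * c * u) = m * Re u + Re ((s * c - of_real m) * u)" by (simp add: algebra_simps)
  also have "\<dots> \<ge> m * Re u - m / 100 * cmod u" using e abs_Re_le_cmod[of "(s * c - of_real m) * u"] by linarith
  finally have "m * Re u - m / 100 * cmod u \<le> Re (s * c * u)" .
  moreover have "m / 100 * cmod u \<le> m / 100 * (2 * Re u)" using uu m by (intro mult_left_mono) auto
  moreover have "0 < m * Re u" using uu m norm_ge_zero[of u] by (intro mult_pos_pos) linarith+
  ultimately have V: "0 < Re (s * c * u)" by linarith
  then have V0: "s \<noteq> 0" "c \<noteq> 0" "u \<noteq> 0" by auto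
  define Y where "Y = of_real n / (s * c * u)"
  have ReY: "0 < Re Y"
  proof -
    have "Re (of_real n * inverse W) = n * (Re W / (cmod W)\<^sup>2)" for W by (simp add: cmod_power2)
    from this[of "s * c * u"] have "Re Y = n * (Re (s * c * u) / (cmod (s * c * u))\<^sup>2)"
      by (simp only: Y_def divide_inverse)
    moreover have "0 < Re (s * c * u) / (cmod (s * c * u))\<^sup>2" using V V0 by (intro divide_pos_pos) simp_all
    ultimately show ?thesis using n(1) by (simp only: mult_pos_pos)
  qed
  have "(Y / 2)\<^sup>2 = (of_nat N / 2) / (\<beta> * (of_nat N * a) * zs \<beta>) / 4"
    unfolding Y_def power_divide power_mult_distrib s2 c2 u2 n(2) by (simp add: power2_eq_square)
  also have "\<dots> = \<beta> / (8 * \<beta>\<^sup>2 * (zs \<beta> * a))" using N b0 by (simp add: field_simps power2_eq_square)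
  also have "\<dots> = \<beta> / w" unfolding za ..
  finally have "csqrt (\<beta> / w) = Y / 2" using ReY by (intro csqrt_unique) auto
  then have "B \<beta> = Y" by (simp add: B_def w_def mult.commute)
  also have "\<dots> = of_real (sqrt (real N / (2 * pi)) * sqrt pi) / (s * c * u)" by (simp only: Y_def n_def sqrt_half)
  finally show ?thesis unfolding a_def[symmetric] c_def[symmetric] s_def[symmetric] u_def[symmetric] by (simp add: mult_ac)
qed

lemma inverse_eps_approx:
  assumes \<beta>: "\<beta> \<in> ball 1 c1"
  shows "cmod ((1 / \<beta> - 1) + (\<beta> - 1)) \<le> cmod (\<beta> - 1) / 500"
proof -
  note n = norm_inverse_near_1[OF ballD(2)[OF \<beta>]]
  have "(1 / \<beta> - 1) + (\<beta> - 1) = - ((1 / \<beta> - 1) * (\<beta> - 1))" using n(1) by (simp add: field_simps)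
  then have "cmod ((1 / \<beta> - 1) + (\<beta> - 1)) = cmod (1 / \<beta> - 1) * cmod (\<beta> - 1)" by (simp add: norm_mult)
  also have "\<dots> \<le> 1 / 500 * cmod (\<beta> - 1)" using n(4) ballD(2)[OF \<beta>] by (intro mult_right_mono) auto
  finally show ?thesis by simp
qed

text \<open>In order: the end of the truncated integral, the right and left ends of the horizontal
  line, the end of the segment through 0 before rotation by i, and that of the tilted segment, whose
  slope 1/3 is the largest the wedge admits. At the left end the principal root jumps across the
  negative axis; z_\<beta> in the upper half plane selects the root near i sqrt r.\<close>

lemma endpoint_in_wedge:
  assumes \<beta>: "\<beta> \<in> ball 1 c1"
  shows "csqrt \<beta> * of_real (sqrt r) \<in> wedge (sqrt r)" "csqrt (zs \<beta> + of_real r) \<in> wedge (sqrt r)"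
    "- \<i> * csqrt (zs \<beta> - of_real r) \<in> wedge (sqrt r) \<or> Im (zs \<beta>) \<le> 0" "of_real (sqrt r) \<in> wedge (sqrt r)"
    "(3 + \<i>) / of_real (sqrt 10) * of_real (sqrt r) \<in> wedge (sqrt r)"
proof -
  have "csqrt \<beta> * of_real (sqrt r) - of_real (sqrt r) = (csqrt \<beta> - 1) * of_real (sqrt r)" by (simp add: algebra_simps)
  then have "cmod (csqrt \<beta> * of_real (sqrt r) - of_real (sqrt r)) = cmod (csqrt \<beta> - 1) * sqrt r"
    using sqrt_r by (simp add: norm_mult)
  also have "\<dots> \<le> 1 / 1000 * sqrt r" using csqrt_near_1(1)[OF \<beta>] sqrt_r by (intro mult_right_mono) auto
 also have "\<dots> \<le> sqrt r / 100" using sqrt_r by simp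
  finally show "csqrt \<beta> * of_real (sqrt r) \<in> wedge (sqrt r)" using sqrt_r by (intro near_in_wedge) auto
  have zr: "cmod (zs \<beta>) / sqrt r \<le> sqrt r / 100"
    using zs_bounds(3)[OF \<beta>] sqrt_r r by (simp add: field_simps power2_eq_square)
  have "cmod (csqrt (zs \<beta> + of_real r) - of_real (sqrt r)) \<le> cmod ((csqrt (zs \<beta> + of_real r))\<^sup>2 - of_real ((sqrt r)\<^sup>2)) / sqrt r"
    by (rule csqrt_diff_bound[OF _ sqrt_r(1)]) (rule Re_csqrt_nonneg)
  then have "cmod (csqrt (zs \<beta> + of_real r) - of_real (sqrt r)) \<le> cmod (zs \<beta>) / sqrt r" by (simp only: sqrt_r(2) power2_csqrt) simp
  then have "cmod (csqrt (zs \<beta> + of_real r) - of_real (sqrt r)) \<le> sqrt r / 100" using zr by linarith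
  then show "csqrt (zs \<beta> + of_real r) \<in> wedge (sqrt r)" by (rule near_in_wedge[OF _ sqrt_r(1)])
  show "- \<i> * csqrt (zs \<beta> - of_real r) \<in> wedge (sqrt r) \<or> Im (zs \<beta>) \<le> 0"
  proof (cases "Im (zs \<beta>) \<le> 0")
    case False
    then have "0 < Im (csqrt (zs \<beta> - of_real r))" by (intro csqrt_quadrant) simp
    then have "0 \<le> Re (- \<i> * csqrt (zs \<beta> - of_real r))" by simp
    then have "cmod (- \<i> * csqrt (zs \<beta> - of_real r) - of_real (sqrt r)) \<le> cmod ((- \<i> * csqrt (zs \<beta> - of_real r))\<^sup>2 - of_real ((sqrt r)\<^sup>2)) / sqrt r"
      by (rule csqrt_diff_bound[OF _ sqrt_r(1)])
    then have "cmod (- \<i> * csqrt (zs \<beta> - of_real r) - of_real (sqrt r)) \<le> cmod (zs \<beta>) / sqrt r"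
      by (simp only: sqrt_r(2) power2_csqrt power_mult_distrib) simp
    then have "cmod (- \<i> * csqrt (zs \<beta> - of_real r) - of_real (sqrt r)) \<le> sqrt r / 100" using zr by linarith
    then show ?thesis using near_in_wedge[OF _ sqrt_r(1)] by blast
  qed simp
  show "of_real (sqrt r) \<in> wedge (sqrt r)" using sqrt_r by (intro near_in_wedge) auto
  have s10: "0 < sqrt 10" "sqrt 10 \<le> (10 / 3 :: real)" by simp (rule real_le_lsqrt, auto simp: power2_eq_square)
  have "3 < sqrt (10::real)" by (rule real_less_rsqrt) simp
  then have x: "9 / 10 \<le> 3 / sqrt 10" "3 / sqrt 10 \<le> 1" using s10 by (auto simp: field_simps)
  have eq: "(3 + \<i>) / of_real (sqrt 10) * of_real (sqrt r) = Complex (3 / sqrt 10 * sqrt r) (1 / sqrt 10 * sqrt r)"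
    by (simp add: complex_eq_iff Re_divide_of_real Im_divide_of_real)
  have "9 / 10 * sqrt r \<le> 3 / sqrt 10 * sqrt r" "3 / sqrt 10 * sqrt r \<le> 1 * sqrt r"
    by (rule mult_right_mono[OF x(1)], use sqrt_r in simp) (rule mult_right_mono[OF x(2)], use sqrt_r in simp)
  then show "(3 + \<i>) / of_real (sqrt 10) * of_real (sqrt r) \<in> wedge (sqrt r)"
    unfolding eq wedge_def using sqrt_r(1) s10 by (simp add: abs_mult mult.commute)
qed

lemma wedge_dist:
  assumes "a \<in> wedge (sqrt r)" "b \<in> wedge (sqrt r)"
  shows "cmod (a - b) \<le> 2"
proof -
  have "cmod v \<le> 1" if "v \<in> wedge (sqrt r)" for v
  proof -
    have "(cmod v)\<^sup>2 \<le> 27 / 20 * r" using wedge_power(1)[OF that sqrt_r(1)] sqrt_r by (simp add: norm_power)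
    then have "(cmod v)\<^sup>2 \<le> 1\<^sup>2" using r by simp
    then show ?thesis by (rule power2_le_imp_le) simp
  qed
  from this[OF assms(1)] this[OF assms(2)] show ?thesis using norm_triangle_ineq4[of a b] by linarith
qed

text \<open>The radius c is fixed before \<delta>; only C depends on \<delta>. The two sectors
  together cover the upper half plane, since Re (\<beta> - 1) > Im \<beta> / 2 implies |\<beta> - 1|
  < 3 Re (\<beta> - 1). In the second one a straight segment through 0 suffices.\<close>

lemma partition_asymptotics_sector:
  obtains c where "0 < c" "c \<le> c1"
    and "\<And>\<delta>. 0 < \<delta> \<Longrightarrow> \<exists>C>0. \<forall>\<beta>\<in>ball 1 c. \<forall>N\<ge>1. \<delta> \<le> cmod (\<beta> - 1) \<longrightarrow> 0 < Im \<beta> \<longrightarrow> cmod (\<beta> - 1) / 10 \<le> Re (\<beta> - 1) \<longrightarrow>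
       cmod (cw_partition N \<beta> - (A \<beta> + B \<beta> * exp (- of_nat N * hs \<beta>))) \<le> C / real N * (1 + exp (- real N * Re (hs \<beta>)))"
    and "\<And>\<delta>. 0 < \<delta> \<Longrightarrow> \<exists>C>0. \<forall>\<beta>\<in>ball 1 c. \<forall>N\<ge>1. \<delta> \<le> cmod (\<beta> - 1) \<longrightarrow> 0 < Im \<beta> \<longrightarrow> Re (\<beta> - 1) \<le> Im \<beta> / 2 \<longrightarrow>
       1 - C / real N \<le> cmod (cw_partition N \<beta>)"
proof (rule cw_partition_primitive[OF sqrt_r(1)])
  fix k' c' C' :: real
  assume k': "0 < k'" and c': "0 < c'" and C': "0 < C'" and Zp: "\<And>\<beta> N F. \<beta> \<in> ball 1 c' \<Longrightarrow> 1 \<le> N \<Longrightarrow>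
    (\<And>u. (F has_field_derivative (exp (- u\<^sup>2 / (2 * \<beta>)) * cosh u) ^ N) (at u)) \<Longrightarrow> F 0 = 0 \<Longrightarrow>
    cmod (cw_partition N \<beta> - of_real (sqrt (real N / (2 * pi))) * (2 * F (csqrt \<beta> * of_real (sqrt r)) / csqrt \<beta>))
      \<le> C' * sqrt (real N) * exp (- k' * real N)"
  define c where "c = min c1 c'"
  have c: "0 < c" "c \<le> c1" "ball 1 c \<subseteq> ball 1 c1" "ball 1 c \<subseteq> ball 1 c'"
    using c1 c' by (auto simp: c_def)
  define k where "k = min k' (r\<^sup>2 / 100)"
  have k: "0 < k" "k \<le> k'" "k \<le> r\<^sup>2 / 100" using k' r by (auto simp: k_def)
  have expk: "sqrt (real N) * exp (- (j * real N)) \<le> 2 / k\<^sup>2 / real N" if "1 \<le> N" "k \<le> j" for N :: nat and j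
  proof -
    have "exp (- (j * real N)) \<le> exp (- (k * real N))" using that by (simp add: mult_right_mono)
    then have "sqrt (real N) * exp (- (j * real N)) \<le> sqrt (real N) * exp (- (k * real N))" by (rule mult_left_mono) simp
    also have "\<dots> \<le> 2 / k\<^sup>2 / real N" by (rule sqrt_exp_neg_le[OF k(1)]) (use that in simp)
    finally show ?thesis .
  qed
  \<comment> \<open>The prefactor sqrt N turns the Laplace error of order N^(-3/2) into O(1/N). The
    number m counts the exchanges of endpoints inside the wedge, each costing 4 exp (- r^2 N /
    100).\<close>
  have transfer: "cmod (cw_partition N \<beta> - of_real (sqrt (real N / (2 * pi))) * L / csqrt \<beta>)
        \<le> 2 * sqrt (real N) * (D / (real N * sqrt (real N))) + 2 * 4 * (2 / k\<^sup>2 / real N) * m + C' * (2 / k\<^sup>2 / real N)"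
    if \<beta>: "\<beta> \<in> ball 1 c" and N: "1 \<le> N" and F: "\<And>u. (F has_field_derivative gaussian_cosh \<beta> N u) (at u)" and F0: "F 0 = 0"
      and L: "cmod (2 * F (csqrt \<beta> * of_real (sqrt r)) - L) \<le> D / (real N * sqrt (real N)) + 4 * m * exp (- (r\<^sup>2 / 100) * real N)"
      and m: "0 \<le> m"
    for \<beta> N F L D m
  proof -
    have b: "\<beta> \<in> ball 1 c1" "\<beta> \<in> ball 1 c'" using \<beta> c by auto
    define n where "n = sqrt (real N / (2 * pi))"
    have n: "0 \<le> n" "n \<le> sqrt (real N)"
      using pi_gt3 divide_left_mono[of 1 "2 * pi" "real N"] by (auto simp: n_def intro!: real_sqrt_le_mono)
    have "cmod (cw_partition N \<beta> - of_real n * (2 * F (csqrt \<beta> * of_real (sqrt r)) / csqrt \<beta>)) \<le> C' * sqrt (real N) * exp (- k' * real N)"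
      unfolding n_def by (rule Zp[OF b(2) N]) (use F F0 in \<open>simp_all add: gaussian_cosh_def\<close>)
    also have "\<dots> = C' * (sqrt (real N) * exp (- (k' * real N)))" by simp
    also have "\<dots> \<le> C' * (2 / k\<^sup>2 / real N)" by (intro mult_left_mono expk) (use N k C' in auto)
    finally have 1: "cmod (cw_partition N \<beta> - of_real n * (2 * F (csqrt \<beta> * of_real (sqrt r)) / csqrt \<beta>)) \<le> C' * (2 / k\<^sup>2 / real N)" .
    have ns: "n / cmod (csqrt \<beta>) \<le> sqrt (real N) / (1 / 2)"
      using csqrt_near_1(2)[OF b(1)] n by (intro frac_le) auto
    have "of_real n * (2 * F (csqrt \<beta> * of_real (sqrt r)) / csqrt \<beta>) - of_real n * L / csqrt \<beta>
       = of_real n / csqrt \<beta> * (2 * F (csqrt \<beta> * of_real (sqrt r)) - L)"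
      by (simp add: diff_divide_distrib right_diff_distrib)
    then have "cmod (of_real n * (2 * F (csqrt \<beta> * of_real (sqrt r)) / csqrt \<beta>) - of_real n * L / csqrt \<beta>)
       = n / cmod (csqrt \<beta>) * cmod (2 * F (csqrt \<beta> * of_real (sqrt r)) - L)"
      using n by (simp add: norm_mult norm_divide)
    also have "\<dots> \<le> sqrt (real N) / (1 / 2) * (D / (real N * sqrt (real N)) + 4 * m * exp (- (r\<^sup>2 / 100) * real N))"
      by (rule mult_mono[OF ns L]) auto
    also have "\<dots> = 2 * sqrt (real N) * (D / (real N * sqrt (real N))) + 2 * 4 * (sqrt (real N) * exp (- (r\<^sup>2 / 100 * real N))) * m"
      by (simp add: algebra_simps)
    also have "\<dots> \<le> 2 * sqrt (real N) * (D / (real N * sqrt (real N))) + 2 * 4 * (2 / k\<^sup>2 / real N) * m"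
      by (intro add_left_mono mult_right_mono mult_left_mono expk) (use N k m in auto)
    finally have 2: "cmod (of_real n * (2 * F (csqrt \<beta> * of_real (sqrt r)) / csqrt \<beta>) - of_real n * L / csqrt \<beta>)
       \<le> 2 * sqrt (real N) * (D / (real N * sqrt (real N))) + 2 * 4 * (2 / k\<^sup>2 / real N) * m" .
    have "cw_partition N \<beta> - of_real n * L / csqrt \<beta> = (of_real n * (2 * F (csqrt \<beta> * of_real (sqrt r)) / csqrt \<beta>) - of_real n * L / csqrt \<beta>)
       + (cw_partition N \<beta> - of_real n * (2 * F (csqrt \<beta> * of_real (sqrt r)) / csqrt \<beta>))" by simp
    then show ?thesis unfolding n_def[symmetric]
      using norm_triangle_ineq 1 2 by (smt (verit, best))
  qed
  have sN: "2 * sqrt (real N) * (D / (real N * sqrt (real N))) = 2 * D / real N" if "1 \<le> N" for D :: real and N :: nat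
    using that by (simp add: field_simps)
  show thesis
  proof (rule that[OF c(1,2)])
    fix \<delta> :: real assume \<delta>: "0 < \<delta>"
    \<comment> \<open>In either sector the quadratic coefficient is at least (1/10 - 1/500)
      \<delta>, which exceeds 2 \<delta> / 25.\<close>
    have \<kappa>: "0 < \<delta> / 25" using \<delta> by simp
    show "\<exists>C>0. \<forall>\<beta>\<in>ball 1 c. \<forall>N\<ge>1. \<delta> \<le> cmod (\<beta> - 1) \<longrightarrow> 0 < Im \<beta> \<longrightarrow> cmod (\<beta> - 1) / 10 \<le> Re (\<beta> - 1) \<longrightarrow>
       cmod (cw_partition N \<beta> - (A \<beta> + B \<beta> * exp (- of_nat N * hs \<beta>))) \<le> C / real N * (1 + exp (- real N * Re (hs \<beta>)))"
    proof (rule saddle_zero_asymptotics[OF \<kappa>])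
    fix C1 :: real assume C1: "0 < C1" and z: "\<And>\<beta> N F d. \<beta> \<in> ball 1 c1 \<Longrightarrow> 1 \<le> N \<Longrightarrow> (\<And>u. (F has_field_derivative gaussian_cosh \<beta> N u) (at u)) \<Longrightarrow> F 0 = 0 \<Longrightarrow>
     cmod d = 1 \<Longrightarrow> 1 / 4 \<le> Re (d ^ 4) \<Longrightarrow> 2 * (\<delta> / 25) \<le> Re ((1 / \<beta> - 1) * d\<^sup>2) \<Longrightarrow>
     cmod (2 * F (d * of_real (sqrt r)) - d * of_real (sqrt pi) / csqrt (of_nat N * ((1 / \<beta> - 1) * d\<^sup>2 / 2))) \<le> C1 / (real N * sqrt (real N))"
    show ?thesis
    proof (rule saddle_u_asymptotics[OF \<delta>])
    fix C2 :: real assume C2: "0 < C2" and uu: "\<And>\<beta> N F. \<beta> \<in> ball 1 c1 \<Longrightarrow> 1 \<le> N \<Longrightarrow> (\<And>u. (F has_field_derivative gaussian_cosh \<beta> N u) (at u)) \<Longrightarrow>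
     \<delta> \<le> cmod (\<beta> - 1) \<Longrightarrow> 0 < Im \<beta> \<Longrightarrow> cmod (\<beta> - 1) / 10 \<le> Re (\<beta> - 1) \<Longrightarrow>
     cmod (2 * (F (csqrt (zs \<beta> + of_real r)) - F (csqrt (zs \<beta> - of_real r)))
        - exp (- of_nat N * hs \<beta>) * (of_real (sqrt pi) / (csqrt (zs \<beta>) * csqrt (of_nat N * (- deriv (deriv lc) (zs \<beta>) / 2)))))
       \<le> C2 / (real N * sqrt (real N)) * exp (- real N * Re (hs \<beta>))"
    define K where "K = 2 * 4 * (2 / k\<^sup>2) * 2 + C' * (2 / k\<^sup>2)"
    have K: "0 < K" unfolding K_def using C' k by (intro add_pos_pos mult_pos_pos) auto
    define C where "C = 2 * (C1 + C2) + K"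
    have "0 < C" using C1 C2 K by (simp add: C_def)
    moreover have "cmod (cw_partition N \<beta> - (A \<beta> + B \<beta> * exp (- of_nat N * hs \<beta>))) \<le> C / real N * (1 + exp (- real N * Re (hs \<beta>)))"
      if \<beta>: "\<beta> \<in> ball 1 c" and N: "1 \<le> N" and \<beta>\<delta>: "\<delta> \<le> cmod (\<beta> - 1)" and im: "0 < Im \<beta>" and re: "cmod (\<beta> - 1) / 10 \<le> Re (\<beta> - 1)" for \<beta> N
    proof -
      have b: "\<beta> \<in> ball 1 c1" using \<beta> c by auto
      obtain F where F: "\<And>u. (F has_field_derivative gaussian_cosh \<beta> N u) (at u)" and F0: "F 0 = 0"
        using gaussian_cosh_primitive_exists by blast
      define X where "X = exp (- of_nat N * hs \<beta>)"
      have cX: "cmod X = exp (- real N * Re (hs \<beta>))" by (simp add: X_def)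
      define L1 where "L1 = \<i> * of_real (sqrt pi) / csqrt (of_nat N * ((1 / \<beta> - 1) * \<i>\<^sup>2 / 2))"
      define L2 where "L2 = X * (of_real (sqrt pi) / (csqrt (zs \<beta>) * csqrt (of_nat N * (- deriv (deriv lc) (zs \<beta>) / 2))))"
      define e where "e = exp (- (r\<^sup>2 / 100) * real N)"
      have "Re ((1 / \<beta> - 1) + (\<beta> - 1)) \<le> cmod (\<beta> - 1) / 500"
        using inverse_eps_approx[OF b] complex_Re_le_cmod order_trans by blast
      then have "2 * (\<delta> / 25) \<le> - Re (1 / \<beta> - 1)" using re \<beta>\<delta> \<delta> by simp
      then have k1: "2 * (\<delta> / 25) \<le> Re ((1 / \<beta> - 1) * \<i>\<^sup>2)" by simp
      have "cmod (2 * F (\<i> * of_real (sqrt r)) - L1) \<le> C1 / (real N * sqrt (real N))"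
        unfolding L1_def by (rule z[of \<beta> N F \<i>, OF b N F F0 _ _ k1]) auto
      moreover have "cmod (2 * (F (csqrt (zs \<beta> + of_real r)) - F (csqrt (zs \<beta> - of_real r))) - L2) \<le> C2 / (real N * sqrt (real N)) * cmod X"
        unfolding L2_def cX unfolding X_def by (rule uu[OF b N F \<beta>\<delta> im re])
      moreover have "cmod (2 * (F (csqrt (zs \<beta> - of_real r)) - F (\<i> * of_real (sqrt r)))) \<le> 4 * e"
      proof -
        have w: "- \<i> * csqrt (zs \<beta> - of_real r) \<in> wedge (sqrt r)"
          using endpoint_in_wedge(3)[OF b] Im_zs_pos[OF b im] by auto
        have "cmod (F (\<i> * (- \<i> * csqrt (zs \<beta> - of_real r))) - F (\<i> * of_real (sqrt r))) \<le> e * cmod (- \<i> * csqrt (zs \<beta> - of_real r) - of_real (sqrt r))"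
          unfolding e_def by (rule primitive_edge(2)[OF b F w endpoint_in_wedge(4)[OF b]])
        also have "\<dots> \<le> e * 2" using wedge_dist[OF w endpoint_in_wedge(4)[OF b]] by (rule mult_left_mono) (simp add: e_def)
        finally have "cmod (F (\<i> * (- \<i> * csqrt (zs \<beta> - of_real r))) - F (\<i> * of_real (sqrt r))) \<le> e * 2" .
        moreover have "\<i> * (- \<i> * csqrt (zs \<beta> - of_real r)) = csqrt (zs \<beta> - of_real r)" by simp
        ultimately show ?thesis unfolding norm_mult norm_numeral by simp
      qed
      moreover have "cmod (2 * (F (csqrt \<beta> * of_real (sqrt r)) - F (csqrt (zs \<beta> + of_real r)))) \<le> 4 * e"
      proof -
        have "cmod (F (csqrt \<beta> * of_real (sqrt r)) - F (csqrt (zs \<beta> + of_real r))) \<le> e * cmod (csqrt \<beta> * of_real (sqrt r) - csqrt (zs \<beta> + of_real r))"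
          unfolding e_def by (rule primitive_edge(1)[OF b F endpoint_in_wedge(1,2)[OF b]])
        also have "\<dots> \<le> e * 2" using wedge_dist[OF endpoint_in_wedge(1,2)[OF b]] by (rule mult_left_mono) (simp add: e_def)
        finally show ?thesis unfolding norm_mult norm_numeral by linarith
      qed
      \<comment> \<open>The contour goes from 0 to i sqrt r, on to the left end of the line, through
        u_\<beta> to its right end, and from there to the end of the original ray.\<close>
      moreover have "2 * F (csqrt \<beta> * of_real (sqrt r)) - (L1 + L2) =
          (2 * F (\<i> * of_real (sqrt r)) - L1) + (2 * (F (csqrt (zs \<beta> + of_real r)) - F (csqrt (zs \<beta> - of_real r))) - L2)
          + (2 * (F (csqrt (zs \<beta> - of_real r)) - F (\<i> * of_real (sqrt r))) + 2 * (F (csqrt \<beta> * of_real (sqrt r)) - F (csqrt (zs \<beta> + of_real r))))"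
        by (simp add: algebra_simps)
      ultimately have "cmod (2 * F (csqrt \<beta> * of_real (sqrt r)) - (L1 + L2)) \<le>
          (C1 / (real N * sqrt (real N)) + C2 / (real N * sqrt (real N)) * cmod X) + (4 * e + 4 * e)"
        by (simp only:) (intro norm_triangle_le add_mono)
      also have "\<dots> = (C1 + C2 * cmod X) / (real N * sqrt (real N)) + 4 * 2 * e" by (simp add: add_divide_distrib)
      finally have "cmod (2 * F (csqrt \<beta> * of_real (sqrt r)) - (L1 + L2)) \<le> (C1 + C2 * cmod X) / (real N * sqrt (real N)) + 4 * 2 * e" .
      from transfer[OF \<beta> N F F0 this[unfolded e_def]]
      have "cmod (cw_partition N \<beta> - of_real (sqrt (real N / (2 * pi))) * (L1 + L2) / csqrt \<beta>)
          \<le> 2 * (C1 + C2 * cmod X) / real N + 2 * 4 * (2 / k\<^sup>2 / real N) * 2 + C' * (2 / k\<^sup>2 / real N)"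
        unfolding sN[OF N] by simp
      also have "\<dots> = (2 * (C1 + C2 * cmod X) + K) / real N" by (simp add: K_def add_divide_distrib)
      also have "\<dots> \<le> C / real N * (1 + cmod X)"
      proof -
        have "0 \<le> C1 * cmod X" "0 \<le> K * cmod X" using C1 K by auto
        then have "2 * (C1 + C2 * cmod X) + K \<le> C * (1 + cmod X)" using C2 by (simp add: C_def algebra_simps)
        then show ?thesis by (simp add: divide_right_mono)
      qed
      also have "of_real (sqrt (real N / (2 * pi))) * (L1 + L2) / csqrt \<beta> = A \<beta> + B \<beta> * X"
        unfolding saddle_zero_coefficient[OF b im N, symmetric] saddle_u_coefficient[OF b im re N, symmetric] L1_def L2_def
        by (simp add: algebra_simps add_divide_distrib)
      finally show ?thesis unfolding cX unfolding X_def .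
    qed
    ultimately show ?thesis by blast
    qed
    qed
  next
    fix \<delta> :: real assume \<delta>: "0 < \<delta>"
    have \<kappa>: "0 < \<delta> / 25" using \<delta> by simp
    show "\<exists>C>0. \<forall>\<beta>\<in>ball 1 c. \<forall>N\<ge>1. \<delta> \<le> cmod (\<beta> - 1) \<longrightarrow> 0 < Im \<beta> \<longrightarrow> Re (\<beta> - 1) \<le> Im \<beta> / 2 \<longrightarrow>
       1 - C / real N \<le> cmod (cw_partition N \<beta>)"
    proof (rule saddle_zero_asymptotics[OF \<kappa>])
    fix C1 :: real assume C1: "0 < C1" and z: "\<And>\<beta> N F d. \<beta> \<in> ball 1 c1 \<Longrightarrow> 1 \<le> N \<Longrightarrow> (\<And>u. (F has_field_derivative gaussian_cosh \<beta> N u) (at u)) \<Longrightarrow> F 0 = 0 \<Longrightarrow>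
     cmod d = 1 \<Longrightarrow> 1 / 4 \<le> Re (d ^ 4) \<Longrightarrow> 2 * (\<delta> / 25) \<le> Re ((1 / \<beta> - 1) * d\<^sup>2) \<Longrightarrow>
     cmod (2 * F (d * of_real (sqrt r)) - d * of_real (sqrt pi) / csqrt (of_nat N * ((1 / \<beta> - 1) * d\<^sup>2 / 2))) \<le> C1 / (real N * sqrt (real N))"
    define K where "K = 2 * 4 * (2 / k\<^sup>2) + C' * (2 / k\<^sup>2)"
    have K: "0 < K" unfolding K_def using C' k by (intro add_pos_pos mult_pos_pos) auto
    define C where "C = 2 * C1 + K"
    \<comment> \<open>Since d^2 = (4 + 3 i) / 5, the real part of - (\<beta> - 1) d^2 is (3 Im
      \<beta> - 4 Re (\<beta> - 1)) / 5, positive in this sector, while Re (d^4) = 7/25 is still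
      above 1/4.\<close>
    define d :: complex where "d = (3 + \<i>) / of_real (sqrt 10)"
    have s10: "(complex_of_real (sqrt 10))\<^sup>2 = 10" by (simp flip: of_real_power)
    have d2: "d\<^sup>2 = (4 + 3 * \<i>) / 5" unfolding d_def power_divide s10 by (simp add: power2_eq_square complex_eq_iff)
    have cd: "cmod d = 1"
    proof -
      have "(cmod (3 + \<i>))\<^sup>2 = 10" by (simp add: cmod_power2)
      then have "cmod (3 + \<i>) = sqrt 10" by (metis norm_ge_zero real_sqrt_unique)
      then show ?thesis by (simp add: d_def norm_divide)
    qed
    have d4: "1 / 4 \<le> Re (d ^ 4)"
    proof -
      have "d ^ 4 = (d\<^sup>2)\<^sup>2" by (simp add: power_mult[symmetric])
      moreover have "(d\<^sup>2)\<^sup>2 = Complex (7 / 25) (24 / 25)"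
        unfolding d2 by (simp add: complex_eq_iff power2_eq_square)
      ultimately show ?thesis by simp
    qed
    have "0 < C" using C1 K by (simp add: C_def)
    moreover have "1 - C / real N \<le> cmod (cw_partition N \<beta>)"
      if \<beta>: "\<beta> \<in> ball 1 c" and N: "1 \<le> N" and \<beta>\<delta>: "\<delta> \<le> cmod (\<beta> - 1)" and im: "0 < Im \<beta>" and re: "Re (\<beta> - 1) \<le> Im \<beta> / 2" for \<beta> N
    proof -
      have b: "\<beta> \<in> ball 1 c1" using \<beta> c by auto
      have b0: "\<beta> \<noteq> 0" and b1: "\<beta> \<noteq> 1" using im by auto
      obtain F where F: "\<And>u. (F has_field_derivative gaussian_cosh \<beta> N u) (at u)" and F0: "F 0 = 0"
        using gaussian_cosh_primitive_exists by blast
      define L where "L = d * of_real (sqrt pi) / csqrt (of_nat N * ((1 / \<beta> - 1) * d\<^sup>2 / 2))"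
      define e where "e = exp (- (r\<^sup>2 / 100) * real N)"
      have "Re (((1 / \<beta> - 1) + (\<beta> - 1)) * d\<^sup>2) \<ge> - (cmod (\<beta> - 1) / 500)"
      proof -
        have "cmod (((1 / \<beta> - 1) + (\<beta> - 1)) * d\<^sup>2) \<le> cmod (\<beta> - 1) / 500"
          using inverse_eps_approx[OF b] by (simp add: norm_mult norm_power cd)
        then show ?thesis using abs_Re_le_cmod[of "((1 / \<beta> - 1) + (\<beta> - 1)) * d\<^sup>2"] by linarith
      qed
      moreover have "Re (((1 / \<beta> - 1) + (\<beta> - 1)) * d\<^sup>2) = Re ((1 / \<beta> - 1) * d\<^sup>2) + Re ((\<beta> - 1) * d\<^sup>2)"
        by (simp only: distrib_right plus_complex.sel)
      moreover have "Re ((\<beta> - 1) * d\<^sup>2) = (4 * Re (\<beta> - 1) - 3 * Im \<beta>) / 5"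
        unfolding d2 by (simp add: field_simps)
      moreover have "4 * Re (\<beta> - 1) - 3 * Im \<beta> \<le> - cmod (\<beta> - 1) / 2"
        using cmod_le[of "\<beta> - 1"] im re by (simp add: abs_if split: if_splits)
      moreover have "2 * (\<delta> / 25) \<le> S" if "- (q / 500) \<le> R" "R = S + T" "T = (4 * u - 3 * v) / 5" "4 * u - 3 * v \<le> - q / 2" "\<delta> \<le> q"
        for q R S T u v :: real
      proof -
        have "T \<le> - (q / 10)" unfolding that(3) using that(4) by simp
        then have "q / 10 - q / 500 \<le> S" using that(1,2) by linarith
        moreover have "2 * (\<delta> / 25) \<le> q / 10 - q / 500" using that(5) \<delta> by simp
        ultimately show ?thesis by linarith
      qed
      ultimately have k1: "2 * (\<delta> / 25) \<le> Re ((1 / \<beta> - 1) * d\<^sup>2)" using \<beta>\<delta> by blast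
      have 1: "cmod (2 * F (d * of_real (sqrt r)) - L) \<le> C1 / (real N * sqrt (real N))"
        unfolding L_def by (rule z[OF b N F F0 cd d4 k1])
      have 2: "cmod (2 * (F (csqrt \<beta> * of_real (sqrt r)) - F (d * of_real (sqrt r)))) \<le> 4 * e"
      proof -
        note w = endpoint_in_wedge(1,5)[OF b, folded d_def]
        have "cmod (F (csqrt \<beta> * of_real (sqrt r)) - F (d * of_real (sqrt r))) \<le> e * cmod (csqrt \<beta> * of_real (sqrt r) - d * of_real (sqrt r))"
          unfolding e_def by (rule primitive_edge(1)[OF b F w])
        also have "\<dots> \<le> e * 2" using wedge_dist[OF w] by (rule mult_left_mono) (simp add: e_def)
        finally show ?thesis unfolding norm_mult norm_numeral by linarith
      qed
      have "2 * F (csqrt \<beta> * of_real (sqrt r)) - L = (2 * F (d * of_real (sqrt r)) - L) + 2 * (F (csqrt \<beta> * of_real (sqrt r)) - F (d * of_real (sqrt r)))"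
        by (simp add: algebra_simps)
      then have "cmod (2 * F (csqrt \<beta> * of_real (sqrt r)) - L) \<le> C1 / (real N * sqrt (real N)) + 4 * 1 * exp (- (r\<^sup>2 / 100) * real N)"
        unfolding e_def[symmetric] using 1 2 by (simp only: mult_1_right) (intro norm_triangle_le add_mono)
      from transfer[OF \<beta> N F F0 this]
      have "cmod (cw_partition N \<beta> - of_real (sqrt (real N / (2 * pi))) * L / csqrt \<beta>)
          \<le> 2 * C1 / real N + 2 * 4 * (2 / k\<^sup>2 / real N) * 1 + C' * (2 / k\<^sup>2 / real N)"
        unfolding sN[OF N] by simp
      also have "\<dots> = C / real N" by (simp add: C_def K_def add_divide_distrib)
      finally have 3: "cmod (cw_partition N \<beta> - of_real (sqrt (real N / (2 * pi))) * L / csqrt \<beta>) \<le> C / real N" .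
      \<comment> \<open>Only the modulus of the leading term is needed, so no branch has to be
        identified: it is |1 - \<beta>|^(-1/2), at least 1 near \<beta> = 1.\<close>
      have "cmod (of_real (sqrt (real N / (2 * pi))) * L / csqrt \<beta>) = sqrt (real N / (2 * pi)) * sqrt pi / (sqrt (real N * cmod (1 / \<beta> - 1) / 2) * sqrt (cmod \<beta>))"
        unfolding L_def by (simp add: norm_mult norm_divide norm_csqrt norm_power cd)
      also have "\<dots> = sqrt ((real N / 2) / (real N * cmod (1 / \<beta> - 1) / 2 * cmod \<beta>))"
        unfolding sqrt_half by (simp only: real_sqrt_mult[symmetric] real_sqrt_divide[symmetric])
      also have "(real N / 2) / (real N * cmod (1 / \<beta> - 1) / 2 * cmod \<beta>) = 1 / cmod ((1 / \<beta> - 1) * \<beta>)"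
      proof -
        have "(real N / 2) / (real N * x / 2 * y) = 1 / (x * y)" for x y :: real
          using N by (cases "x * y = 0") (auto simp: field_simps)
        then show ?thesis unfolding norm_mult .
      qed
      also have "(1 / \<beta> - 1) * \<beta> = 1 - \<beta>" using b0 by (simp add: field_simps)
      also have "1 \<le> sqrt (1 / cmod (1 - \<beta>))"
        using ballD(2)[OF b] b1 by (simp add: norm_minus_commute)
      finally have 4: "1 \<le> cmod (of_real (sqrt (real N / (2 * pi))) * L / csqrt \<beta>)" .
      then show ?thesis using 3 norm_triangle_ineq2[of "of_real (sqrt (real N / (2 * pi))) * L / csqrt \<beta>" "cw_partition N \<beta>"]
        by (simp add: norm_minus_commute)
    qed
    ultimately show ?thesis by blast
    qed
  qed
qed

end

section \<open>Reflection to the lower half plane, and the real axis\<close>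

lemma cw_partition_cnj: "cw_partition N (cnj \<beta>) = cnj (cw_partition N \<beta>)"
  unfolding cw_partition_def by (simp add: exp_cnj)

text \<open>All summands are positive for real \<beta>. This disposes of the real axis, which the
  asymptotics leave out.\<close>

lemma cw_partition_real_pos:
  assumes "Im \<beta> = 0"
  shows "cw_partition N \<beta> \<noteq> 0"
proof -
  define P where "P = ({1..N} \<rightarrow>\<^sub>E {-1, 1 :: real})"
  have \<beta>: "\<beta> = of_real (Re \<beta>)" using assms by (simp add: complex_eq_iff)
  have "cw_partition N \<beta> = of_real (1 / 2 ^ N * (\<Sum>\<sigma>\<in>P. exp (- Re \<beta> * cw_hamiltonian N \<sigma>)))"
    unfolding cw_partition_def P_def by (subst \<beta>) (simp add: exp_of_real[symmetric])
  moreover have "0 < (\<Sum>\<sigma>\<in>P. exp (- Re \<beta> * cw_hamiltonian N \<sigma>))"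
    by (rule sum_pos) (auto simp: P_def finite_PiE PiE_eq_empty_iff)
  ultimately show ?thesis by (simp only: of_real_eq_0_iff) simp
qed

context local_saddle
begin

text \<open>\<open>cw_Psi\<close> with u_\<beta>^2 replaced by the holomorphic \<open>zs\<close>:
  the signs chosen by \<open>ub\<close> are arbitrary, so \<open>ub\<close> need not even be
  continuous.\<close>

definition \<Psi> :: "nat \<Rightarrow> complex \<Rightarrow> complex" where
  "\<Psi> N \<beta> = A \<beta> + B \<beta> * exp (- of_nat N * hs \<beta>)"

text \<open>Principal roots commute with conjugation only off the negative axis. For the root in A
  this follows from Im \<beta> \<noteq> 0, for that in B from the sector condition and
  \<open>Re_B_radicand\<close>.\<close>

lemma \<Psi>_cnj:
  assumes \<beta>: "\<beta> \<in> ball 1 c1" and im: "Im \<beta> \<noteq> 0" and re: "cmod (\<beta> - 1) / 10 \<le> Re (\<beta> - 1)"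
  shows "\<Psi> N (cnj \<beta>) = cnj (\<Psi> N \<beta>)"
proof -
  have "1 - \<beta> \<notin> \<real>\<^sub>\<le>\<^sub>0" using im by (auto simp: complex_nonpos_Reals_iff)
  from cnj_csqrt[OF this] have A: "A (cnj \<beta>) = cnj (A \<beta>)" by (simp add: A_def)
  have "\<beta> \<noteq> 1" using im by auto
  from Re_B_radicand[OF \<beta> re this] have "\<beta> / (\<beta> - \<beta>\<^sup>2 + zs \<beta>) \<notin> \<real>\<^sub>\<le>\<^sub>0" by (auto simp: complex_nonpos_Reals_iff)
  from cnj_csqrt[OF this] have B: "B (cnj \<beta>) = cnj (B \<beta>)" by (simp add: B_def zs_cnj[OF \<beta>])
  show ?thesis by (simp add: \<Psi>_def A B hs_cnj[OF \<beta>] exp_cnj)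
qed

lemma cnj_ball: "cnj \<beta> \<in> ball 1 d \<longleftrightarrow> \<beta> \<in> ball 1 d"
  by (metis complex_cnj_diff complex_cnj_one complex_mod_cnj dist_norm mem_ball)

lemma norm_cnj_minus_1: "cmod (cnj \<beta> - 1) = cmod (\<beta> - 1)"
  by (metis complex_cnj_diff complex_cnj_one complex_mod_cnj)

lemma partition_asymptotics:
  obtains c where "0 < c" "c \<le> c1"
    and "\<And>\<delta>. 0 < \<delta> \<Longrightarrow> \<exists>C>0. \<forall>\<beta>\<in>ball 1 c. \<forall>N\<ge>1. \<delta> \<le> cmod (\<beta> - 1) \<longrightarrow> Im \<beta> \<noteq> 0 \<longrightarrow> cmod (\<beta> - 1) / 10 \<le> Re (\<beta> - 1) \<longrightarrow>
       cmod (cw_partition N \<beta> - \<Psi> N \<beta>) \<le> C / real N * (1 + exp (- real N * Re (hs \<beta>)))"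
    and "\<And>\<delta>. 0 < \<delta> \<Longrightarrow> \<exists>C>0. \<forall>\<beta>\<in>ball 1 c. \<forall>N\<ge>1. \<delta> \<le> cmod (\<beta> - 1) \<longrightarrow> Im \<beta> \<noteq> 0 \<longrightarrow> Re (\<beta> - 1) \<le> \<bar>Im \<beta>\<bar> / 2 \<longrightarrow>
       1 - C / real N \<le> cmod (cw_partition N \<beta>)"
proof (rule partition_asymptotics_sector)
  fix c assume c: "0 < c" "c \<le> c1"
    and a1: "\<And>\<delta>. 0 < \<delta> \<Longrightarrow> \<exists>C>0. \<forall>\<beta>\<in>ball 1 c. \<forall>N\<ge>1. \<delta> \<le> cmod (\<beta> - 1) \<longrightarrow> 0 < Im \<beta> \<longrightarrow> cmod (\<beta> - 1) / 10 \<le> Re (\<beta> - 1) \<longrightarrow>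
       cmod (cw_partition N \<beta> - (A \<beta> + B \<beta> * exp (- of_nat N * hs \<beta>))) \<le> C / real N * (1 + exp (- real N * Re (hs \<beta>)))"
    and a2: "\<And>\<delta>. 0 < \<delta> \<Longrightarrow> \<exists>C>0. \<forall>\<beta>\<in>ball 1 c. \<forall>N\<ge>1. \<delta> \<le> cmod (\<beta> - 1) \<longrightarrow> 0 < Im \<beta> \<longrightarrow> Re (\<beta> - 1) \<le> Im \<beta> / 2 \<longrightarrow>
       1 - C / real N \<le> cmod (cw_partition N \<beta>)"
  show thesis
  proof (rule that[OF c])
    fix \<delta> :: real assume \<delta>: "0 < \<delta>"
    from a1[OF \<delta>] obtain C where C: "0 < C" and a: "\<And>\<beta> N. \<beta> \<in> ball 1 c \<Longrightarrow> 1 \<le> N \<Longrightarrow> \<delta> \<le> cmod (\<beta> - 1) \<Longrightarrow> 0 < Im \<beta> \<Longrightarrow> cmod (\<beta> - 1) / 10 \<le> Re (\<beta> - 1) \<Longrightarrow>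
       cmod (cw_partition N \<beta> - \<Psi> N \<beta>) \<le> C / real N * (1 + exp (- real N * Re (hs \<beta>)))"
      unfolding \<Psi>_def by blast
    have "cmod (cw_partition N \<beta> - \<Psi> N \<beta>) \<le> C / real N * (1 + exp (- real N * Re (hs \<beta>)))"
      if \<beta>: "\<beta> \<in> ball 1 c" and N: "1 \<le> N" and d: "\<delta> \<le> cmod (\<beta> - 1)" and im: "Im \<beta> \<noteq> 0" and re: "cmod (\<beta> - 1) / 10 \<le> Re (\<beta> - 1)" for \<beta> N
    proof (cases "0 < Im \<beta>")
      case True
      then show ?thesis using a[OF \<beta> N d] re by blast
    next
      case False
      have b: "\<beta> \<in> ball 1 c1" using \<beta> c by auto
      have "cmod (cw_partition N (cnj \<beta>) - \<Psi> N (cnj \<beta>)) \<le> C / real N * (1 + exp (- real N * Re (hs (cnj \<beta>))))"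
        by (rule a) (use \<beta> N d im re False in \<open>simp_all only: cnj_ball norm_cnj_minus_1, simp_all\<close>)
      moreover have "cw_partition N (cnj \<beta>) - \<Psi> N (cnj \<beta>) = cnj (cw_partition N \<beta> - \<Psi> N \<beta>)"
        by (simp add: cw_partition_cnj \<Psi>_cnj[OF b im re])
      ultimately show ?thesis by (simp only: complex_mod_cnj hs_cnj[OF b]) simp
    qed
    then show "\<exists>C>0. \<forall>\<beta>\<in>ball 1 c. \<forall>N\<ge>1. \<delta> \<le> cmod (\<beta> - 1) \<longrightarrow> Im \<beta> \<noteq> 0 \<longrightarrow> cmod (\<beta> - 1) / 10 \<le> Re (\<beta> - 1) \<longrightarrow>
       cmod (cw_partition N \<beta> - \<Psi> N \<beta>) \<le> C / real N * (1 + exp (- real N * Re (hs \<beta>)))" using C by blast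
  next
    fix \<delta> :: real assume \<delta>: "0 < \<delta>"
    from a2[OF \<delta>] obtain C where C: "0 < C" and a: "\<And>\<beta> N. \<beta> \<in> ball 1 c \<Longrightarrow> 1 \<le> N \<Longrightarrow> \<delta> \<le> cmod (\<beta> - 1) \<Longrightarrow> 0 < Im \<beta> \<Longrightarrow> Re (\<beta> - 1) \<le> Im \<beta> / 2 \<Longrightarrow>
       1 - C / real N \<le> cmod (cw_partition N \<beta>)"
      by blast
    have "1 - C / real N \<le> cmod (cw_partition N \<beta>)"
      if \<beta>: "\<beta> \<in> ball 1 c" and N: "1 \<le> N" and d: "\<delta> \<le> cmod (\<beta> - 1)" and im: "Im \<beta> \<noteq> 0" and re: "Re (\<beta> - 1) \<le> \<bar>Im \<beta>\<bar> / 2" for \<beta> N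
    proof (cases "0 < Im \<beta>")
      case True
      then show ?thesis using a[OF \<beta> N d] re by simp
    next
      case False
      have "1 - C / real N \<le> cmod (cw_partition N (cnj \<beta>))"
        by (rule a) (use \<beta> N d im re False in \<open>simp_all only: cnj_ball norm_cnj_minus_1, simp_all\<close>)
      then show ?thesis by (simp add: cw_partition_cnj)
    qed
    then show "\<exists>C>0. \<forall>\<beta>\<in>ball 1 c. \<forall>N\<ge>1. \<delta> \<le> cmod (\<beta> - 1) \<longrightarrow> Im \<beta> \<noteq> 0 \<longrightarrow> Re (\<beta> - 1) \<le> \<bar>Im \<beta>\<bar> / 2 \<longrightarrow>
       1 - C / real N \<le> cmod (cw_partition N \<beta>)" using C by blast
  qed
qed

section \<open>Location of the zeros\<close>

text \<open>With q = |A| \<ge> 1, q \<le> |B| \<le> 2 q and X the modulus of the exponential, the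
  triangle inequality gives q \<le> q (1 + X) / 4 + 2 q X and q X \<le> q (1 + X) / 4 + q. The
  hypothesis is an inequality so that it covers zeros of Z too, where \<Psi> is only small.\<close>

lemma exponential_bounds_near_zero:
  assumes \<beta>: "\<beta> \<in> ball 1 c1" and \<beta>1: "\<beta> \<noteq> 1"
    and small: "cmod (\<Psi> N \<beta>) \<le> 1 / 4 * (1 + exp (- real N * Re (hs \<beta>)))"
  shows "1 / 3 \<le> exp (- real N * Re (hs \<beta>))" "exp (- real N * Re (hs \<beta>)) \<le> 2" "\<bar>real N * Re (hs \<beta>)\<bar> \<le> 2"
proof -
  define X where "X = exp (- real N * Re (hs \<beta>))"
  define q where "q = 1 / sqrt (cmod (\<beta> - 1))"
  have "0 < cmod (\<beta> - 1)" using \<beta>1 by simp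
  moreover have "cmod (\<beta> - 1) \<le> 1" using ballD(2)[OF \<beta>] by linarith
  ultimately have q: "1 \<le> q" by (simp add: q_def)
  have X: "0 < X" "cmod (exp (- of_nat N * hs \<beta>)) = X" by (auto simp: X_def)
  have A: "cmod (A \<beta>) = q" by (simp add: norm_A q_def)
  have B: "q \<le> cmod (B \<beta>)" "cmod (B \<beta>) \<le> 2 * q" using norm_B[OF \<beta> \<beta>1] by (auto simp: q_def)
  have BX: "cmod (B \<beta> * exp (- of_nat N * hs \<beta>)) = cmod (B \<beta>) * X" by (simp only: norm_mult X)
  have s: "cmod (\<Psi> N \<beta>) \<le> q / 4 * (1 + X)"
  proof -
    have "1 / 4 * (1 + X) \<le> q / 4 * (1 + X)" using q X by (intro mult_right_mono) auto
    then show ?thesis using small by (simp add: X_def)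
  qed
  have "cmod (A \<beta>) \<le> cmod (\<Psi> N \<beta>) + cmod (B \<beta>) * X"
    using norm_triangle_ineq4[of "\<Psi> N \<beta>" "B \<beta> * exp (- of_nat N * hs \<beta>)"] unfolding BX by (simp add: \<Psi>_def)
  also have "\<dots> \<le> q / 4 * (1 + X) + 2 * q * X" using s B X by (intro add_mono mult_right_mono) auto
  finally have "q \<le> q / 4 * (1 + X) + 2 * q * X" unfolding A .
  moreover have "q * (9 / 4 * X) - q * (3 / 4) = q / 4 * (1 + X) + 2 * q * X - q" by (simp add: field_simps)
  ultimately have "q * (3 / 4) \<le> q * (9 / 4 * X)" by linarith
  then have "3 / 4 \<le> 9 / 4 * X" using q by (simp only: mult_le_cancel_left_pos)
  then show X1: "1 / 3 \<le> exp (- real N * Re (hs \<beta>))" by (simp add: X_def)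
  have "q * X \<le> cmod (B \<beta>) * X" using B X by (intro mult_right_mono) auto
  also have "\<dots> \<le> cmod (\<Psi> N \<beta>) + cmod (A \<beta>)"
    using norm_triangle_ineq4[of "\<Psi> N \<beta>" "A \<beta>"] unfolding BX[symmetric] by (simp add: \<Psi>_def)
  also have "\<dots> \<le> q / 4 * (1 + X) + q" using s A by simp
  finally have "q * X \<le> q / 4 * (1 + X) + q" .
  moreover have "q * (5 / 4) - q * (3 / 4 * X) = q / 4 * (1 + X) + q - q * X" by (simp add: field_simps)
  ultimately have "q * (3 / 4 * X) \<le> q * (5 / 4)" by linarith
  then have "3 / 4 * X \<le> 5 / 4" using q by (simp only: mult_le_cancel_left_pos)
  then show X2: "exp (- real N * Re (hs \<beta>)) \<le> 2" by (simp add: X_def)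
  have e2: "3 \<le> exp (2::real)" using exp_ge_add_one_self[of "2::real"] by simp
  have "exp (- real N * Re (hs \<beta>)) \<le> exp 2" using X2 e2 by linarith
  moreover have "exp (- 2) \<le> exp (- real N * Re (hs \<beta>))"
  proof -
    have "exp (- 2) \<le> (1 / 3 :: real)" using e2 by (simp add: exp_minus field_simps)
    then show ?thesis using X1 by linarith
  qed
  ultimately show "\<bar>real N * Re (hs \<beta>)\<bar> \<le> 2" by simp
qed

text \<open>The bound on N gives |Re h_\<beta>(u_\<beta>)| \<le> q^2 / 100 with q = |\<beta> - 1|;
  by \<open>hs_approx\<close> the squares of Re (\<beta> - 1) and Im \<beta> then differ by at most
  3/100 q^2, so both lie between 0.485 q^2 and 0.515 q^2. The constants 69/100, 9/10 and 11/10
  follow with room to spare.\<close>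

lemma critical_sector:
  assumes \<beta>: "\<beta> \<in> ball 1 c1" and \<delta>: "0 < \<delta>" "\<delta> \<le> cmod (\<beta> - 1)" and N: "200 / \<delta>\<^sup>2 \<le> real N" "1 \<le> N"
    and h: "\<bar>real N * Re (hs \<beta>)\<bar> \<le> 2" and re: "0 \<le> Re (\<beta> - 1)"
  shows "69 / 100 * cmod (\<beta> - 1) \<le> Re (\<beta> - 1)" "69 / 100 * cmod (\<beta> - 1) \<le> \<bar>Im \<beta>\<bar>"
    "\<bar>Im \<beta>\<bar> \<le> 11 / 10 * Re (\<beta> - 1)" "9 / 10 * Re (\<beta> - 1) \<le> \<bar>Im \<beta>\<bar>"
proof -
  define q where "q = cmod (\<beta> - 1)"
  define a where "a = Re (\<beta> - 1)"
  define b where "b = \<bar>Im \<beta>\<bar>"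
  have q2: "q\<^sup>2 = a\<^sup>2 + b\<^sup>2" by (simp add: q_def a_def b_def cmod_power2)
  have "\<bar>Re (hs \<beta>)\<bar> * real N \<le> 2" using h by (simp add: abs_mult mult.commute)
  moreover have "200 \<le> real N * \<delta>\<^sup>2" using N \<delta> by (simp add: pos_divide_le_eq)
  then have "2 \<le> \<delta>\<^sup>2 / 100 * real N" by (simp add: mult.commute)
  ultimately have "\<bar>Re (hs \<beta>)\<bar> * real N \<le> \<delta>\<^sup>2 / 100 * real N" by linarith
  then have "\<bar>Re (hs \<beta>)\<bar> \<le> \<delta>\<^sup>2 / 100" using N by (simp only: mult_le_cancel_right)
  also have "\<dots> \<le> q\<^sup>2 / 100" using \<delta> by (simp add: q_def power_mono)
  finally have 1: "\<bar>Re (hs \<beta>)\<bar> \<le> q\<^sup>2 / 100" .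
  have "\<bar>Re (hs \<beta> + 3 / 4 * (\<beta> - 1)\<^sup>2)\<bar> \<le> q\<^sup>2 / 100"
    using hs_approx[OF \<beta>] abs_Re_le_cmod order_trans unfolding q_def by blast
  moreover have "Re (hs \<beta> + 3 / 4 * (\<beta> - 1)\<^sup>2) = Re (hs \<beta>) + 3 / 4 * (a\<^sup>2 - b\<^sup>2)"
    by (simp add: Re_power2 a_def b_def)
  ultimately have 2: "\<bar>Re (hs \<beta>) + 3 / 4 * (a\<^sup>2 - b\<^sup>2)\<bar> \<le> q\<^sup>2 / 100" by (simp only:)
  have "\<bar>y\<bar> \<le> 3 / 100 * Q" if "\<bar>x + 3 / 4 * y\<bar> \<le> Q / 100" "\<bar>x\<bar> \<le> Q / 100" "0 \<le> Q" for x y Q :: real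
    using that by linarith
  from this[OF 2 1 zero_le_power2] have d: "\<bar>a\<^sup>2 - b\<^sup>2\<bar> \<le> 3 / 100 * q\<^sup>2" .
  then have ab: "485 / 1000 * q\<^sup>2 \<le> a\<^sup>2" "485 / 1000 * q\<^sup>2 \<le> b\<^sup>2" "a\<^sup>2 \<le> 515 / 1000 * q\<^sup>2" "b\<^sup>2 \<le> 515 / 1000 * q\<^sup>2"
    using q2 by linarith+
  have a0: "0 \<le> a" "0 \<le> b" "0 \<le> q" using re by (auto simp: a_def b_def q_def)
  have "(69 / 100 * q)\<^sup>2 \<le> a\<^sup>2" "(69 / 100 * q)\<^sup>2 \<le> b\<^sup>2"
    using ab zero_le_power2[of q] by (auto simp: power_mult_distrib power2_eq_square)
  then show "69 / 100 * cmod (\<beta> - 1) \<le> Re (\<beta> - 1)" "69 / 100 * cmod (\<beta> - 1) \<le> \<bar>Im \<beta>\<bar>"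
    unfolding q_def[symmetric] a_def[symmetric] b_def[symmetric] using a0 by (auto intro: power2_le_imp_le)
  have "b\<^sup>2 \<le> (11 / 10 * a)\<^sup>2" "(9 / 10 * a)\<^sup>2 \<le> b\<^sup>2"
    using ab zero_le_power2[of q] by (simp_all add: power_mult_distrib power2_eq_square)
  then show "\<bar>Im \<beta>\<bar> \<le> 11 / 10 * Re (\<beta> - 1)" "9 / 10 * Re (\<beta> - 1) \<le> \<bar>Im \<beta>\<bar>"
    unfolding a_def[symmetric] b_def[symmetric] using a0 by (auto intro: power2_le_imp_le)
qed

lemma A_holomorphic:
  assumes "\<And>z. z \<in> S \<Longrightarrow> Im z \<noteq> 0"
  shows "A holomorphic_on S"
  unfolding A_def[abs_def]
proof (intro holomorphic_intros)
  fix z assume "z \<in> S"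
  from assms[OF this] have "1 - z \<notin> \<real>\<^sub>\<le>\<^sub>0" "csqrt (1 - z) \<noteq> 0" by (auto simp: complex_nonpos_Reals_iff)
  then show "1 - z \<notin> \<real>\<^sub>\<le>\<^sub>0" "csqrt (1 - z) \<noteq> 0" .
qed

lemma B_holomorphic:
  assumes S: "S \<subseteq> ball 1 c1" and re: "\<And>z. z \<in> S \<Longrightarrow> cmod (z - 1) / 10 \<le> Re (z - 1)" "\<And>z. z \<in> S \<Longrightarrow> z \<noteq> 1"
  shows "B holomorphic_on S"
  unfolding B_def[abs_def]
proof (intro holomorphic_intros holomorphic_on_subset[OF zs_holomorphic S])
  fix z assume z: "z \<in> S"
  have "0 < Re (z / (z - z\<^sup>2 + zs z))" by (rule Re_B_radicand) (use z S re in auto)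
  then show "z / (z - z\<^sup>2 + zs z) \<notin> \<real>\<^sub>\<le>\<^sub>0" "z - z\<^sup>2 + zs z \<noteq> 0" by (auto simp: complex_nonpos_Reals_iff)
qed

text \<open>A relative displacement of one hundredth stays in the sector where \<Psi> is holomorphic
  and the asymptotics hold, so both are available on discs about a zero.\<close>

lemma sector_neighbourhood:
  assumes b: "69 / 100 * cmod (b - 1) \<le> Re (b - 1)" "69 / 100 * cmod (b - 1) \<le> \<bar>Im b\<bar>" "0 < cmod (b - 1)"
    and z: "cmod (b - z) \<le> cmod (b - 1) / 100"
  shows "cmod (z - 1) / 10 \<le> Re (z - 1)" "Im z \<noteq> 0" "z \<noteq> 1" "1 < Re z"
    "99 / 100 * cmod (b - 1) \<le> cmod (z - 1)" "cmod (z - 1) \<le> 101 / 100 * cmod (b - 1)"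
proof -
  have r: "\<bar>Re b - Re z\<bar> \<le> cmod (b - 1) / 100" and i: "\<bar>Im b - Im z\<bar> \<le> cmod (b - 1) / 100"
    using abs_Re_le_cmod[of "b - z"] abs_Im_le_cmod[of "b - z"] z by auto
  show z1: "cmod (z - 1) \<le> 101 / 100 * cmod (b - 1)" "99 / 100 * cmod (b - 1) \<le> cmod (z - 1)"
    using norm_triangle_ineq4[of "b - 1" "b - z"] norm_triangle_ineq[of "z - 1" "b - z"] z by auto
  have "Re b - Re z \<le> cmod (b - 1) / 100" using r by linarith
  then have re: "68 / 100 * cmod (b - 1) \<le> Re (z - 1)" using b by simp
  show "cmod (z - 1) / 10 \<le> Re (z - 1)" using re z1 norm_ge_zero[of "b - 1"] by linarith
  have "0 < Re (z - 1)" using re b(3) by linarith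
  then show "1 < Re z" by simp
  have "\<bar>Im b\<bar> - \<bar>Im z\<bar> \<le> cmod (b - 1) / 100" using i by linarith
  then have "0 < \<bar>Im z\<bar>" using b(2,3) by linarith
  then show im: "Im z \<noteq> 0" by simp
  then show "z \<noteq> 1" by auto
qed

end

lemma cw_partition_holomorphic: "cw_partition N holomorphic_on S"
  unfolding cw_partition_def[abs_def]
proof (rule holomorphic_on_mult[OF holomorphic_on_const holomorphic_on_sum])
  show "(\<lambda>\<beta>. exp (- \<beta> * complex_of_real (cw_hamiltonian N \<sigma>))) holomorphic_on S" for \<sigma>
    by (intro holomorphic_intros)
qed

context local_saddle
begin

text \<open>The slope is at most 151/100 |\<beta> - 1|. Hence N h_\<beta>(u_\<beta>) changes by at
  most 1 over a distance 1/N.\<close>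

lemma hs_lipschitz:
  assumes S: "convex S" "S \<subseteq> ball 1 c1" and z: "z \<in> S" "w \<in> S"
  shows "cmod (hs z - hs w) \<le> cmod (z - w)"
proof -
  have "cmod (hs z - hs w) \<le> 1 * cmod (z - w)"
  proof (rule field_differentiable_bound[OF S(1) _ _ z])
    fix x assume "x \<in> S"
    then have x: "x \<in> ball 1 c1" using S by blast
    show "(hs has_field_derivative - zs x / (2 * x\<^sup>2)) (at x within S)"
      using DERIV_hs[OF x] by (rule has_field_derivative_at_within)
    have "cmod (- zs x / (2 * x\<^sup>2)) \<le> cmod (x - 1) / 100 + cmod (3 / 2 * (x - 1))"
      using deriv_hs_approx[OF x] norm_triangle_ineq4[of "- zs x / (2 * x\<^sup>2) + 3 / 2 * (x - 1)" "3 / 2 * (x - 1)"] by simp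
    also have "cmod (3 / 2 * (x - 1)) = 3 / 2 * cmod (x - 1)" by (simp only: norm_mult) simp
    finally show "cmod (- zs x / (2 * x\<^sup>2)) \<le> 1" using ballD(2)[OF x] by linarith
  qed
  then show ?thesis by simp
qed

text \<open>Converts smallness of Re h_\<beta>(u_\<beta>) into distance from the critical curve.
  Along a vertical line the derivative of Re \<open>hs\<close> is - Im \<open>hs'\<close>, about 3/2
  R, and at least e in the cone; the mean value theorem does the rest.\<close>

lemma hs_vertical:
  assumes e: "0 < e" "3 * e \<le> c1" and R: "9 / 10 * e \<le> R" "R \<le> 11 / 10 * e" and R': "9 / 10 * e \<le> R'" "R' \<le> 11 / 10 * e"
  shows "e * \<bar>R - R'\<bar> \<le> \<bar>Re (hs (Complex (1 + e) R)) - Re (hs (Complex (1 + e) R'))\<bar>"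
  using R R'
proof (induction R R' rule: linorder_wlog)
  case (le x y)
  define \<beta> where "\<beta> t = 1 + of_real e + \<i> * of_real t" for t :: real
  have \<beta>C: "Complex (1 + e) t = \<beta> t" for t by (simp add: \<beta>_def complex_eq_iff)
  define g where "g t = - Im (- zs (\<beta> t) / (2 * (\<beta> t)\<^sup>2))" for t
  have D: "((\<lambda>t. Re (hs (\<beta> t))) has_real_derivative g t) (at t)" and ge: "e \<le> g t" if t: "9 / 10 * e \<le> t" "t \<le> 11 / 10 * e" for t
  proof -
    have eps: "\<beta> t - 1 = Complex e t" by (simp add: \<beta>_def complex_eq_iff)
    have q: "cmod (\<beta> t - 1) \<le> 21 / 10 * e" unfolding eps using cmod_le[of "Complex e t"] t e by simp
    have b: "\<beta> t \<in> ball 1 c1" using q e by (simp add: dist_norm norm_minus_commute)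
    have "((\<lambda>z. hs (1 + of_real e + \<i> * z)) has_field_derivative - zs (\<beta> t) / (2 * (\<beta> t)\<^sup>2) * \<i>) (at (of_real t))"
      by (rule DERIV_chain2[where f = hs and g = "\<lambda>z. 1 + of_real e + \<i> * z"])
         (use DERIV_hs[OF b] in \<open>auto intro!: derivative_eq_intros simp: \<beta>_def\<close>)
    from has_vector_derivative_real_field[OF this]
    have "((\<lambda>t. hs (\<beta> t)) has_vector_derivative - zs (\<beta> t) / (2 * (\<beta> t)\<^sup>2) * \<i>) (at t)" by (simp add: \<beta>_def)
    from bounded_linear.has_vector_derivative[OF bounded_linear_Re this]
    have "((\<lambda>t. Re (hs (\<beta> t))) has_vector_derivative Re (- zs (\<beta> t) / (2 * (\<beta> t)\<^sup>2) * \<i>)) (at t)" .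
    moreover have "Re (w * \<i>) = - Im w" for w by simp
    ultimately show "((\<lambda>t. Re (hs (\<beta> t))) has_real_derivative g t) (at t)"
      by (simp only: has_real_derivative_iff_has_vector_derivative g_def)
    have "\<bar>Im (- zs (\<beta> t) / (2 * (\<beta> t)\<^sup>2) + 3 / 2 * (\<beta> t - 1))\<bar> \<le> cmod (\<beta> t - 1) / 100"
      using deriv_hs_approx[OF b] abs_Im_le_cmod order_trans by blast
    moreover have "Im (- zs (\<beta> t) / (2 * (\<beta> t)\<^sup>2) + 3 / 2 * (\<beta> t - 1)) = - g t + 3 / 2 * t"
      unfolding eps by (simp add: g_def)
    ultimately have "\<bar>- g t + 3 / 2 * t\<bar> \<le> cmod (\<beta> t - 1) / 100" by (simp only:)
    then show "e \<le> g t" using q t e by linarith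
  qed
  show ?case
  proof (cases "x = y")
    case False
    then have xy: "x < y" using le by simp
    obtain t where t: "x < t" "t < y" and eq: "Re (hs (\<beta> y)) - Re (hs (\<beta> x)) = (y - x) * g t"
      using MVT2[OF xy, of "\<lambda>t. Re (hs (\<beta> t))" g] D le by force
    have "(y - x) * e \<le> (y - x) * g t" using xy ge[of t] t le by (intro mult_left_mono) auto
    then have "e * \<bar>x - y\<bar> \<le> \<bar>Re (hs (\<beta> y)) - Re (hs (\<beta> x))\<bar>" unfolding eq 
      using xy order_trans[OF _ abs_ge_self[of "(y - x) * g t"], of "(y - x) * e"] by (simp add: mult.commute[of e])
    then show ?thesis unfolding \<beta>C abs_minus_commute[of "Re (hs (\<beta> x))"] .
  qed simp
next
  case (sym x y)
  then show ?case unfolding abs_minus_commute[of y] abs_minus_commute[of "Re (hs (Complex (1 + e) y))"] by blast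
qed

section \<open>One-to-one correspondence between the zeros of Z and of \<Psi>\<close>

text \<open>The centre b may be a zero of either function: \<open>unique_zero_rescaled\<close>
  applies to both at b, and one lemma yields both directions. The main term of the derivative is - N
  hs' B exp (- N hs); the derivatives of A and B stay bounded, and Cauchy's bound at scale 1/N turns
  Z - \<Psi> = O(1/N) into a bounded difference of derivatives.\<close>

lemma zero_correspondence:
  assumes c: "0 < c" "c \<le> c1" and \<delta>: "0 < \<delta>"
    and C1: "0 < C1" and asym: "\<forall>\<beta>\<in>ball 1 c. \<forall>N\<ge>1. \<delta> / 2 \<le> cmod (\<beta> - 1) \<longrightarrow> Im \<beta> \<noteq> 0 \<longrightarrow> cmod (\<beta> - 1) / 10 \<le> Re (\<beta> - 1) \<longrightarrow>
       cmod (cw_partition N \<beta> - \<Psi> N \<beta>) \<le> C1 / real N * (1 + exp (- real N * Re (hs \<beta>)))"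
  shows "\<exists>C0>0. \<forall>C\<ge>C0. \<exists>N0\<ge>1. \<forall>N\<ge>N0. C / (real N)\<^sup>2 < \<delta> / 100 \<and> (\<forall>b. cmod (b - 1) < c / 2 \<longrightarrow> \<delta> \<le> cmod (b - 1) \<longrightarrow>
     69 / 100 * cmod (b - 1) \<le> Re (b - 1) \<longrightarrow> 69 / 100 * cmod (b - 1) \<le> \<bar>Im b\<bar> \<longrightarrow>
     1 / 3 \<le> exp (- real N * Re (hs b)) \<longrightarrow> exp (- real N * Re (hs b)) \<le> 2 \<longrightarrow> cw_partition N b = 0 \<or> \<Psi> N b = 0 \<longrightarrow>
     (\<exists>!z. \<Psi> N z = 0 \<and> cmod (b - z) < C / (real N)\<^sup>2) \<and> (\<exists>!z. cw_partition N z = 0 \<and> cmod (b - z) < C / (real N)\<^sup>2))"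
proof -
  define Q where "Q = 1 / sqrt (\<delta> / 2)"
  have Q: "0 < Q" using \<delta> by (simp add: Q_def)
  \<comment> \<open>On the small disc |A| \<le> Q, |B| \<le> 2 Q and the exponential is at most 6,
    so |\<Psi>| \<le> 13 Q; the difference Z - \<Psi> adds at most 7 C1.\<close>
  define M where "M = 13 * Q + 10 * C1"
  have M: "0 < M" using Q C1 by (simp add: M_def)
  have k: "0 < \<delta> / 8" using \<delta> by simp
  have "\<exists>C0>0. \<forall>C\<ge>C0. \<exists>N0\<ge>1. \<forall>N\<ge>N0. \<forall>F b.
    F holomorphic_on ball b (1 / real N) \<and> (\<forall>z\<in>ball b (1 / real N). cmod (F z) \<le> M) \<and>
    cmod (F b) \<le> M / real N \<and> \<delta> / 8 * real N \<le> cmod (deriv F b) \<longrightarrow>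
    (\<exists>!z. F z = 0 \<and> cmod (b - z) < C / (real N)\<^sup>2)"
    by (rule unique_zero_rescaled[OF M k])
  then show ?thesis
  proof (elim exE conjE)
    fix C0 :: real
    assume C0: "0 < C0" and nz: "\<forall>C\<ge>C0. \<exists>N0\<ge>1. \<forall>N\<ge>N0. \<forall>F b.
      F holomorphic_on ball b (1 / real N) \<and> (\<forall>z\<in>ball b (1 / real N). cmod (F z) \<le> M) \<and>
      cmod (F b) \<le> M / real N \<and> \<delta> / 8 * real N \<le> cmod (deriv F b) \<longrightarrow>
      (\<exists>!z. F z = 0 \<and> cmod (b - z) < C / (real N)\<^sup>2)"
    show ?thesis
    proof (rule exI[of _ C0], intro conjI C0 allI impI)
      fix C assume C: "C0 \<le> C"
      have "\<exists>N0\<ge>1. \<forall>N\<ge>N0. \<forall>F b.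
        F holomorphic_on ball b (1 / real N) \<and> (\<forall>z\<in>ball b (1 / real N). cmod (F z) \<le> M) \<and>
        cmod (F b) \<le> M / real N \<and> \<delta> / 8 * real N \<le> cmod (deriv F b) \<longrightarrow>
        (\<exists>!z. F z = 0 \<and> cmod (b - z) < C / (real N)\<^sup>2)"
        by (rule nz[THEN spec, THEN mp, OF C])
      then obtain N1 where N1: "1 \<le> N1" and nz0: "\<forall>N\<ge>N1. \<forall>F b.
        F holomorphic_on ball b (1 / real N) \<and> (\<forall>z\<in>ball b (1 / real N). cmod (F z) \<le> M) \<and>
        cmod (F b) \<le> M / real N \<and> \<delta> / 8 * real N \<le> cmod (deriv F b) \<longrightarrow>
        (\<exists>!z. F z = 0 \<and> cmod (b - z) < C / (real N)\<^sup>2)"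
        by (elim exE conjE) (rule that)
      have nz1: "\<exists>!z. F z = 0 \<and> cmod (b - z) < C / (real N)\<^sup>2"
        if "N1 \<le> N" "F holomorphic_on ball b (1 / real N)" "\<And>z. z \<in> ball b (1 / real N) \<Longrightarrow> cmod (F z) \<le> M"
          "cmod (F b) \<le> M / real N" "\<delta> / 8 * real N \<le> cmod (deriv F b)" for N F b
        by (rule nz0[THEN spec, THEN mp, THEN spec, THEN spec, THEN mp, OF that(1)]) (intro conjI ballI that)
      \<comment> \<open>In order: 1/N and C / N^2 stay below \<delta>/100, and N times \<delta>
        dominates the bounded part of the derivative of \<Psi> and the derivative of Z -
        \<Psi>.\<close>
      define K where "K = 100 / \<delta> + 100 * C / \<delta> + 10000 * Q / \<delta>\<^sup>2 + 224 * C1 / \<delta>"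
      define N0 where "N0 = max N1 (nat \<lceil>K\<rceil> + 1)"
      show "\<exists>N0\<ge>1. \<forall>N\<ge>N0. C / (real N)\<^sup>2 < \<delta> / 100 \<and> (\<forall>b. cmod (b - 1) < c / 2 \<longrightarrow> \<delta> \<le> cmod (b - 1) \<longrightarrow>
         69 / 100 * cmod (b - 1) \<le> Re (b - 1) \<longrightarrow> 69 / 100 * cmod (b - 1) \<le> \<bar>Im b\<bar> \<longrightarrow>
         1 / 3 \<le> exp (- real N * Re (hs b)) \<longrightarrow> exp (- real N * Re (hs b)) \<le> 2 \<longrightarrow> cw_partition N b = 0 \<or> \<Psi> N b = 0 \<longrightarrow>
         (\<exists>!z. \<Psi> N z = 0 \<and> cmod (b - z) < C / (real N)\<^sup>2) \<and> (\<exists>!z. cw_partition N z = 0 \<and> cmod (b - z) < C / (real N)\<^sup>2))"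
      proof (rule exI[of _ N0], intro conjI allI impI)
        show "1 \<le> N0" using N1 by (simp add: N0_def)
      next
        fix N assume N: "N0 \<le> N"
        have Np: "1 \<le> N" "N1 \<le> N" using N N1 by (auto simp: N0_def)
        have "K < real N" using N unfolding N0_def by linarith
        moreover have "0 < 100 / \<delta>" "0 < 100 * C / \<delta>" "0 < 10000 * Q / \<delta>\<^sup>2" "0 < 224 * C1 / \<delta>" using \<delta> C C0 Q C1 by auto
        ultimately have NK: "100 / \<delta> < real N" "100 * C / \<delta> < real N" "10000 * Q / \<delta>\<^sup>2 < real N" "224 * C1 / \<delta> < real N"
          unfolding K_def by linarith+
        have N\<delta>: "1 / real N \<le> \<delta> / 100" using NK(1) \<delta> Np by (simp add: field_simps)
        have "100 * C < \<delta> * real N" using NK(2) \<delta> by (simp add: field_simps)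
        also have "\<dots> \<le> \<delta> * (real N)\<^sup>2" using Np \<delta> by (intro mult_left_mono self_le_power) auto
        finally show "C / (real N)\<^sup>2 < \<delta> / 100" using Np by (simp add: field_simps)
        fix b assume bc: "cmod (b - 1) < c / 2" and b\<delta>: "\<delta> \<le> cmod (b - 1)"
          and sec: "69 / 100 * cmod (b - 1) \<le> Re (b - 1)" "69 / 100 * cmod (b - 1) \<le> \<bar>Im b\<bar>"
          and X: "1 / 3 \<le> exp (- real N * Re (hs b))" "exp (- real N * Re (hs b)) \<le> 2"
          and zero: "cw_partition N b = 0 \<or> \<Psi> N b = 0"
        let ?U = "ball b (\<delta> / 100)"
        have q: "0 < cmod (b - 1)" using b\<delta> \<delta> by linarith
        have U: "cmod (z - 1) / 10 \<le> Re (z - 1)" "Im z \<noteq> 0" "z \<noteq> 1" "\<delta> / 2 \<le> cmod (z - 1)" "z \<in> ball 1 c" "z \<in> ball 1 c1"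
          if z: "z \<in> ?U" for z
        proof -
          have "cmod (b - z) \<le> cmod (b - 1) / 100" using z b\<delta> by (simp add: dist_norm)
          note s = sector_neighbourhood[OF sec q this]
          show "cmod (z - 1) / 10 \<le> Re (z - 1)" "Im z \<noteq> 0" "z \<noteq> 1" by (fact s(1) s(2) s(3))+
          show "\<delta> / 2 \<le> cmod (z - 1)" using s(5) b\<delta> \<delta> by linarith
          have "cmod (z - 1) < c" using s(6) bc q by linarith
          then show "z \<in> ball 1 c" by (simp add: dist_norm norm_minus_commute)
          then show "z \<in> ball 1 c1" using c by auto
        qed
        have bU: "b \<in> ?U" using \<delta> by simp
        have VU: "ball b (1 / real N) \<subseteq> ?U" using N\<delta> by (rule subset_ball)
        have hA: "A holomorphic_on ?U" by (rule A_holomorphic) (rule U(2))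
        have hB: "B holomorphic_on ?U" by (rule B_holomorphic) (use U in auto)
        have hh: "hs holomorphic_on ?U" by (rule holomorphic_on_subset[OF hs_holomorphic]) (use U in blast)
        have hP: "\<Psi> N holomorphic_on ?U" unfolding \<Psi>_def[abs_def] by (intro holomorphic_intros hA hB hh)
        have sq: "1 / sqrt (cmod (z - 1)) \<le> Q" if "z \<in> ?U" for z
          unfolding Q_def using U(4)[OF that] \<delta> by (intro divide_left_mono real_sqrt_le_mono mult_pos_pos) auto
        have bA: "cmod (A z) \<le> Q" if "z \<in> ?U" for z using sq[OF that] by (simp add: norm_A)
        have bB: "cmod (B z) \<le> 2 * Q" if "z \<in> ?U" for z using norm_B(2)[OF U(6)[OF that] U(3)[OF that]] sq[OF that] by simp
        \<comment> \<open>At b the exponential is at most 2, and a displacement of 1/N multiplies it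
          by at most e \<le> 3.\<close>
        have bX: "exp (- real N * Re (hs z)) \<le> 6" if z: "z \<in> ball b (1 / real N)" for z
        proof -
          have "cmod (hs b - hs z) \<le> cmod (b - z)"
            by (rule hs_lipschitz[of ?U]) (use U z VU bU in auto)
          also have "\<dots> \<le> 1 / real N" using z by (simp add: dist_norm)
          finally have "Re (hs b - hs z) \<le> 1 / real N" using complex_Re_le_cmod order_trans by blast
          then have "real N * Re (hs b - hs z) \<le> real N * (1 / real N)" by (rule mult_left_mono) simp
          then have "- real N * Re (hs z) \<le> - real N * Re (hs b) + 1" using Np by (simp add: algebra_simps)
          then have "exp (- real N * Re (hs z)) \<le> exp (- real N * Re (hs b) + 1)" by (simp only: exp_le_cancel_iff)
          also have "\<dots> = exp (- real N * Re (hs b)) * exp 1" by (rule exp_add)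
          also have "\<dots> \<le> 2 * 3" using X exp_le by (intro mult_mono) auto
          finally show ?thesis by simp
        qed
        have nE: "cmod (exp (- of_nat N * hs z)) = exp (- real N * Re (hs z))" for z by simp
        have b\<Psi>: "cmod (\<Psi> N z) \<le> 13 * Q" if z: "z \<in> ball b (1 / real N)" for z
        proof -
          have zU: "z \<in> ?U" using z VU by blast
          have "cmod (\<Psi> N z) \<le> cmod (A z) + cmod (B z) * exp (- real N * Re (hs z))"
            unfolding \<Psi>_def nE[symmetric] norm_mult[symmetric] by (rule norm_triangle_ineq)
          also have "\<dots> \<le> Q + 2 * Q * 6"
            using bA[OF zU] bB[OF zU] bX[OF z] Q by (intro add_mono mult_mono) auto
          finally show ?thesis by simp
        qed
        have diff: "cmod (cw_partition N z - \<Psi> N z) \<le> 7 * C1 / real N" if z: "z \<in> ball b (1 / real N)" for z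
        proof -
          have zU: "z \<in> ?U" using z VU by blast
          have "cmod (cw_partition N z - \<Psi> N z) \<le> C1 / real N * (1 + exp (- real N * Re (hs z)))"
            using asym[THEN bspec, OF U(5)[OF zU], THEN spec, THEN mp, OF Np(1), THEN mp, OF U(4)[OF zU], THEN mp, OF U(2)[OF zU], THEN mp, OF U(1)[OF zU]] .
          also have "\<dots> \<le> C1 / real N * 7" using bX[OF z] C1 by (intro mult_left_mono) auto
          finally show ?thesis by (simp add: mult.commute)
        qed
        have CN: "7 * C1 / real N \<le> 7 * C1" using Np C1 by (simp add: divide_le_eq mult_le_cancel_left1)
        have bZ: "cmod (cw_partition N z) \<le> M" if z: "z \<in> ball b (1 / real N)" for z
          using b\<Psi>[OF z] diff[OF z] CN norm_triangle_ineq2[of "cw_partition N z" "\<Psi> N z"] C1 by (simp add: M_def)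
        have bV: "b \<in> ball b (1 / real N)" using Np by simp
        have db: "cmod (cw_partition N b - \<Psi> N b) \<le> M / real N"
        proof -
          have "7 * C1 / real N \<le> M / real N" using Q C1 by (intro divide_right_mono) (auto simp: M_def)
          then show ?thesis using diff[OF bV] by linarith
        qed
        have M0: "0 \<le> M / real N" using M by simp
        have \<Psi>b: "cmod (\<Psi> N b) \<le> M / real N" and Zb: "cmod (cw_partition N b) \<le> M / real N"
          using zero db M0 by auto
        have D\<Psi>: "(\<Psi> N has_field_derivative deriv A b + (deriv B b * exp (- of_nat N * hs b) + exp (- of_nat N * hs b) * (- of_nat N * (- zs b / (2 * b\<^sup>2))) * B b)) (at b)"
        proof -
          have 1: "(A has_field_derivative deriv A b) (at b)" "(B has_field_derivative deriv B b) (at b)"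
            using holomorphic_derivI[OF hA open_ball bU] holomorphic_derivI[OF hB open_ball bU] by auto
          have "((\<lambda>z. - of_nat N * hs z) has_field_derivative - of_nat N * (- zs b / (2 * b\<^sup>2))) (at b)"
            by (rule DERIV_cmult[OF DERIV_hs[OF U(6)[OF bU]]])
          then have 2: "((\<lambda>z. exp (- of_nat N * hs z)) has_field_derivative exp (- of_nat N * hs b) * (- of_nat N * (- zs b / (2 * b\<^sup>2)))) (at b)"
            by (rule DERIV_chain2[OF DERIV_exp])
          show ?thesis unfolding \<Psi>_def[abs_def] by (rule DERIV_add[OF 1(1) DERIV_mult[OF 1(2) 2]])
        qed
        have dA: "cmod (deriv A b) \<le> 400 * Q / \<delta>"
          using higher_deriv_bound_ball[OF hA bA, of b 1] \<delta> by (simp add: mult.commute)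
        have dB: "cmod (deriv B b) \<le> 800 * Q / \<delta>"
          using higher_deriv_bound_ball[OF hB bB, of b 1] \<delta> by (simp add: mult.commute)
        define e where "e = exp (- of_nat N * hs b)"
        have ce: "cmod e = exp (- real N * Re (hs b))" by (simp add: e_def)
        define G where "G = e * (- of_nat N * (- zs b / (2 * b\<^sup>2))) * B b"
        \<comment> \<open>The factors are 1/3 from the exponential, (3/2 - 3/100) \<delta> from hs',
          and 1 from B.\<close>
        have "49 / 100 * \<delta> * real N \<le> cmod G"
        proof -
          have "cmod (3 / 2 * (b - 1)) - cmod (b - 1) / 100 \<le> cmod (- zs b / (2 * b\<^sup>2))"
            using deriv_hs_approx[OF U(6)[OF bU]] norm_triangle_ineq4[of "- zs b / (2 * b\<^sup>2) + 3 / 2 * (b - 1)" "- zs b / (2 * b\<^sup>2)"] by simp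
          moreover have "cmod (3 / 2 * (b - 1)) = 3 / 2 * cmod (b - 1)" by (simp only: norm_mult) simp
          ultimately have h: "147 / 100 * \<delta> \<le> cmod (- zs b / (2 * b\<^sup>2))" using b\<delta> \<delta> by linarith
          have "1 \<le> 1 / sqrt (cmod (b - 1))" using q ballD(2)[OF U(6)[OF bU]] by simp
          then have B1: "1 \<le> cmod (B b)" using norm_B(1)[OF U(6)[OF bU] U(3)[OF bU]] by linarith
          have "1 / 3 * (real N * (147 / 100 * \<delta>)) * 1 \<le> cmod e * (real N * cmod (- zs b / (2 * b\<^sup>2))) * cmod (B b)"
            using X h B1 \<delta> unfolding ce by (intro mult_mono) auto
          also have "\<dots> = cmod G" by (simp add: G_def norm_mult norm_divide)
          finally show ?thesis by simp
        qed
        moreover have d\<Psi>: "deriv (\<Psi> N) b = deriv A b + (deriv B b * e + G)"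
          unfolding G_def e_def by (rule DERIV_imp_deriv[OF D\<Psi>])
        moreover have "cmod (deriv B b * e) \<le> 800 * Q / \<delta> * 2"
          unfolding norm_mult ce using dB X(2) Q \<delta> by (intro mult_mono) auto
        ultimately have "49 / 100 * \<delta> * real N - 2000 * Q / \<delta> \<le> cmod (deriv (\<Psi> N) b)"
          using dA norm_triangle_ineq4[of "deriv (\<Psi> N) b" "deriv A b + deriv B b * e"] norm_triangle_ineq[of "deriv A b" "deriv B b * e"]
          by (simp add: add_divide_distrib)
        moreover have "2000 * Q / \<delta> \<le> 6 / 25 * (\<delta> * real N)"
        proof -
          have "10000 * Q \<le> real N * \<delta>\<^sup>2" using NK(3) \<delta> by (simp add: divide_less_eq)
          then have "10000 * Q / \<delta> \<le> real N * \<delta>" using \<delta> by (simp add: divide_le_eq power2_eq_square)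
          moreover have "2000 * Q / \<delta> = 1 / 5 * (10000 * Q / \<delta>)" by simp
          moreover have "0 \<le> real N * \<delta>" using \<delta> by simp
          ultimately show ?thesis unfolding mult.commute[of \<delta>] by linarith
        qed
        ultimately have "49 / 100 * (\<delta> * real N) - 6 / 25 * (\<delta> * real N) \<le> cmod (deriv (\<Psi> N) b)" by (simp only: mult.assoc)
        then have d1: "1 / 4 * \<delta> * real N \<le> cmod (deriv (\<Psi> N) b)" by simp
        have hd: "(\<lambda>z. cw_partition N z - \<Psi> N z) holomorphic_on ball b (1 / real N)"
          by (intro holomorphic_intros cw_partition_holomorphic holomorphic_on_subset[OF hP VU])
        \<comment> \<open>7 C1 / N over a radius 1/N, with the factor 4 of the Cauchy bound, gives
          28 C1, at most half of the lower bound \<delta> N / 4 for \<Psi>.\<close>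
        have "cmod ((deriv ^^ 1) (\<lambda>z. cw_partition N z - \<Psi> N z) b) \<le> fact 1 * (7 * C1 / real N) * (4 / (1 / real N)) ^ 1"
          by (rule higher_deriv_bound_ball[OF hd diff]) (use Np in auto)
        then have "cmod (deriv (\<lambda>z. cw_partition N z - \<Psi> N z) b) \<le> 28 * C1" using Np by simp
        moreover have "deriv (\<lambda>z. cw_partition N z - \<Psi> N z) b = deriv (cw_partition N) b - deriv (\<Psi> N) b"
        proof (rule deriv_diff)
          show "cw_partition N field_differentiable at b"
            using cw_partition_holomorphic[of N UNIV] by (simp add: holomorphic_on_imp_differentiable_at)
          show "\<Psi> N field_differentiable at b" using D\<Psi> by (auto simp: field_differentiable_def)
        qed
        moreover have "28 * C1 \<le> 1 / 8 * \<delta> * real N" using NK(4) \<delta> by (simp add: divide_less_eq mult.commute)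
        ultimately have d2: "\<delta> / 8 * real N \<le> cmod (deriv (cw_partition N) b)"
          using d1 norm_triangle_ineq2[of "deriv (\<Psi> N) b" "deriv (cw_partition N) b"] by (simp add: norm_minus_commute)
        have d1': "\<delta> / 8 * real N \<le> cmod (deriv (\<Psi> N) b)" using d1 norm_ge_zero[of "deriv (\<Psi> N) b"] by linarith
        have b\<Psi>M: "cmod (\<Psi> N z) \<le> M" if z: "z \<in> ball b (1 / real N)" for z
          using b\<Psi>[OF z] C1 by (simp add: M_def)
        show "\<exists>!z. \<Psi> N z = 0 \<and> cmod (b - z) < C / (real N)\<^sup>2"
          by (rule nz1[OF Np(2) holomorphic_on_subset[OF hP VU] b\<Psi>M \<Psi>b d1'])
        show "\<exists>!z. cw_partition N z = 0 \<and> cmod (b - z) < C / (real N)\<^sup>2"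
          by (rule nz1[OF Np(2) cw_partition_holomorphic bZ Zb d2])
      qed
    qed
  qed
qed

end

section \<open>Transfer to the given u_\<beta> and to the critical curve\<close>

context local_saddle
begin

lemma cw_Psi_zeros_iff:
  assumes "saddle_points c0 ub" "c1 \<le> c0" "z \<in> ball 1 c1" "z \<noteq> 1" "1 \<le> Re z"
  shows "z \<in> cw_Psi_zeros c0 ub N \<longleftrightarrow> \<Psi> N z = 0"
proof -
  have "cmod (z - 1) \<le> c0" "0 < cmod (z - 1)" using assms(2,3,4) by (auto simp: dist_norm norm_minus_commute)
  moreover have "cw_Psi ub N z = \<Psi> N z" unfolding \<Psi>_def by (rule cw_Psi_eq[OF assms(1-4)])
  ultimately show ?thesis using assms(5) by (simp add: cw_Psi_zeros_def)
qed

lemma Re_hs_Complex_abs: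
  assumes "b \<in> ball 1 c1"
  shows "Re (hs (Complex (Re b) \<bar>Im b\<bar>)) = Re (hs b)"
proof (cases "0 \<le> Im b")
  case True
  then have "Complex (Re b) \<bar>Im b\<bar> = b" by (simp add: complex_eq_iff)
  then show ?thesis by simp
next
  case False
  then have "Complex (Re b) \<bar>Im b\<bar> = cnj b" by (simp add: complex_eq_iff)
  then show ?thesis using hs_cnj[OF assms] by simp
qed

end

theorem corollary1p5:
  fixes c0 c :: real and ub :: "complex \<Rightarrow> complex" and R0 :: "real \<Rightarrow> real"
  assumes "c0 > 0"
    and "saddle_points c0 ub"
    and "critical_curve_fun c0 ub c R0"
  shows "\<exists>c'. 0 < c' \<and> c' \<le> c0 \<and>
    (\<forall>\<delta>::real. \<delta> > 0 \<longrightarrow> (\<exists>N0::nat. \<exists>C\<delta>::real. N0 \<ge> 1 \<and> C\<delta> > 0 \<and> (\<forall>N\<ge>N0.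
       (\<forall>\<beta>. \<delta> < cmod (\<beta> - 1) \<and> cmod (\<beta> - 1) < c' \<and> cw_partition N \<beta> = 0 \<longrightarrow>
          Re \<beta> > 1 \<and>
          (\<exists>!\<beta>'. \<beta>' \<in> cw_Psi_zeros c0 ub N \<and> cmod (\<beta> - \<beta>') < C\<delta> / (real N)\<^sup>2)) \<and>
       (\<forall>\<beta>'. \<beta>' \<in> cw_Psi_zeros c0 ub N \<and> \<delta> < cmod (\<beta>' - 1) \<and> cmod (\<beta>' - 1) < c' \<longrightarrow>
          (\<exists>!\<beta>. cw_partition N \<beta> = 0 \<and> cmod (\<beta> - \<beta>') < C\<delta> / (real N)\<^sup>2)) \<and>
       (\<forall>\<beta>. \<delta> < cmod (\<beta> - 1) \<and> cmod (\<beta> - 1) < c' \<and> cw_partition N \<beta> = 0 \<longrightarrow>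
          (\<exists>\<gamma>\<in>critical_curve c R0. cmod (\<beta> - \<gamma>) \<le> C\<delta> / real N)))))"
proof -
  obtain r c1 zs where ls: "local_saddle r c1 zs" and c10: "c1 \<le> c0"
    using local_saddle_exists[OF assms(1)] by (elim exE conjE)
  interpret local_saddle r c1 zs by (rule ls)
  note sp = assms(2)
  from assms(3) obtain CR \<rho> where c: "0 < c" and CR: "0 < CR" and R0: "\<forall>e\<in>{-c..c}. \<bar>R0 e - e\<bar> \<le> CR * e\<^sup>2"
    and \<rho>: "0 < \<rho>" and cr: "\<forall>e\<in>{-c..c}. \<forall>R \<beta>. \<beta> = Complex (1 + e) R \<and> 0 < cmod (\<beta> - 1) \<and> cmod (\<beta> - 1) < \<rho> \<longrightarrow>
      (\<forall>v\<in>{ub \<beta>, - ub \<beta>}. (\<bar>R\<bar> < \<bar>R0 e\<bar> \<longrightarrow> Re (cw_h \<beta> v) < 0) \<and>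
         (\<bar>R\<bar> = \<bar>R0 e\<bar> \<longrightarrow> Re (cw_h \<beta> v) = 0) \<and> (\<bar>R\<bar> > \<bar>R0 e\<bar> \<longrightarrow> Re (cw_h \<beta> v) > 0))"
    unfolding critical_curve_fun_def by (elim exE conjE bexE) (rule that)
  show ?thesis
  proof (rule partition_asymptotics)
    fix c2 assume c2: "0 < c2" "c2 \<le> c1"
      and asym: "\<And>\<delta>. 0 < \<delta> \<Longrightarrow> \<exists>C>0. \<forall>\<beta>\<in>ball 1 c2. \<forall>N\<ge>1. \<delta> \<le> cmod (\<beta> - 1) \<longrightarrow> Im \<beta> \<noteq> 0 \<longrightarrow> cmod (\<beta> - 1) / 10 \<le> Re (\<beta> - 1) \<longrightarrow>
       cmod (cw_partition N \<beta> - \<Psi> N \<beta>) \<le> C / real N * (1 + exp (- real N * Re (hs \<beta>)))"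
      and nonzero: "\<And>\<delta>. 0 < \<delta> \<Longrightarrow> \<exists>C>0. \<forall>\<beta>\<in>ball 1 c2. \<forall>N\<ge>1. \<delta> \<le> cmod (\<beta> - 1) \<longrightarrow> Im \<beta> \<noteq> 0 \<longrightarrow> Re (\<beta> - 1) \<le> \<bar>Im \<beta>\<bar> / 2 \<longrightarrow>
       1 - C / real N \<le> cmod (cw_partition N \<beta>)"
    \<comment> \<open>\<open>c2 / 4\<close> and \<open>\<rho> / 4\<close> leave room for the nearby
      point of the curve, at distance up to 3 e from 1 with e < c'; c keeps e in the domain of R0,
      and \<open>1 / (20 * CR)\<close> gives |R0 e - e| \<le> e / 20.\<close>
    define c' where "c' = Min {c2 / 4, c, \<rho> / 4, c0, 1 / (20 * CR)}"
    have c': "0 < c'" "c' \<le> c2 / 4" "c' \<le> c" "c' \<le> \<rho> / 4" "c' \<le> c0" "c' \<le> 1 / (20 * CR)"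
      using c2 c \<rho> CR assms(1) by (simp_all add: c'_def)
    \<comment> \<open>The point of the curve is taken on the vertical through b, on the same side of
      the real axis. There Re \<open>hs\<close> vanishes, so \<open>hs_vertical\<close> measures the
      distance; the lower half plane is folded up by conjugation.\<close>
    have curve: "\<exists>\<gamma>\<in>critical_curve c R0. Re (b - 1) * cmod (b - \<gamma>) \<le> \<bar>Re (hs b)\<bar>"
      if b: "cmod (b - 1) < c'" "0 < Re (b - 1)" "\<bar>Im b\<bar> \<le> 11 / 10 * Re (b - 1)" "9 / 10 * Re (b - 1) \<le> \<bar>Im b\<bar>" for b
    proof -
      define e where "e = Re (b - 1)"
      have e: "0 < e" "e < c'" using b complex_Re_le_cmod[of "b - 1"] by (auto simp: e_def)
      have ec: "e \<in> {-c..c}" using e c c' by auto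
      have "e < 1 / (20 * CR)" using e c' by linarith
      then have "CR * e < 1 / 20" using CR by (simp add: field_simps)
      then have "CR * e * e \<le> 1 / 20 * e" using e by (intro mult_right_mono) auto
      moreover have "\<bar>R0 e - e\<bar> \<le> CR * e * e" using bspec[OF R0 ec] by (simp only: power2_eq_square mult.assoc)
      ultimately have "\<bar>R0 e - e\<bar> \<le> 1 / 20 * e" by linarith
      then have Rb: "9 / 10 * e \<le> R0 e" "R0 e \<le> 11 / 10 * e" using e by linarith+
      define g where "g = Complex (1 + e) (R0 e)"
      have "cmod (g - 1) \<le> \<bar>Re (g - 1)\<bar> + \<bar>Im (g - 1)\<bar>" by (rule cmod_le)
      also have "\<dots> \<le> 3 * e" using Rb e by (simp add: g_def)
      finally have g3: "cmod (g - 1) \<le> 3 * e" .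
      have "Re g \<noteq> Re 1" using e by (simp add: g_def)
      then have g1: "g \<noteq> 1" by metis
      have "3 * e < c1" "3 * e < \<rho>" using e c' c2 \<rho> by linarith+
      then have gr: "cmod (g - 1) < \<rho>" and gb: "cmod (g - 1) < c1" and e3: "3 * e \<le> c1" using g3 by linarith+
      have "0 < cmod (g - 1)" using g1 by simp
      then have "Re (cw_h g (ub g)) = 0" using cr[rule_format, OF ec, of g "R0 e" "ub g"] gr g_def by blast
      moreover have "cw_h g (ub g) = hs g"
        by (rule ub_power2(2)[OF sp c10 _ g1]) (use gb in \<open>simp add: dist_norm norm_minus_commute\<close>)
      ultimately have h0: "Re (hs (Complex (1 + e) (R0 e))) = 0" unfolding g_def by simp
      have bb: "b \<in> ball 1 c1" using b c' c2 by (simp add: dist_norm norm_minus_commute)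
      have "Complex (1 + e) \<bar>Im b\<bar> = Complex (Re b) \<bar>Im b\<bar>" by (simp add: e_def)
      then have "Re (hs (Complex (1 + e) \<bar>Im b\<bar>)) = Re (hs b)" using Re_hs_Complex_abs[OF bb] by simp
      then have dist: "e * \<bar>\<bar>Im b\<bar> - R0 e\<bar> \<le> \<bar>Re (hs b)\<bar>"
        using hs_vertical[OF e(1) e3 b(4,3)[folded e_def] Rb] h0 by simp
      define \<gamma> where "\<gamma> = Complex (1 + e) (if 0 \<le> Im b then R0 e else - R0 e)"
      have "\<gamma> \<in> critical_curve c R0" unfolding critical_curve_def \<gamma>_def using e c' by force
      moreover have "cmod (b - \<gamma>) = \<bar>\<bar>Im b\<bar> - R0 e\<bar>"
      proof -
        have "b - \<gamma> = \<i> * of_real (Im b - Im \<gamma>)" by (simp add: complex_eq_iff \<gamma>_def e_def)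
        then have "cmod (b - \<gamma>) = \<bar>Im b - Im \<gamma>\<bar>" by (simp only: norm_mult norm_ii norm_of_real mult_1)
        also have "\<dots> = \<bar>\<bar>Im b\<bar> - R0 e\<bar>" by (simp add: \<gamma>_def abs_if)
        finally show ?thesis .
      qed
      ultimately show ?thesis using dist unfolding e_def[symmetric] by metis
    qed
    show ?thesis
    proof (rule exI[of _ c'], intro conjI c' allI impI)
      fix \<delta> :: real assume \<delta>: "0 < \<delta>"
      have \<delta>2: "0 < \<delta> / 2" using \<delta> by simp
      obtain C1 where C1: "0 < C1" and as0: "\<forall>\<beta>\<in>ball 1 c2. \<forall>N\<ge>1. \<delta> / 2 \<le> cmod (\<beta> - 1) \<longrightarrow> Im \<beta> \<noteq> 0 \<longrightarrow> cmod (\<beta> - 1) / 10 \<le> Re (\<beta> - 1) \<longrightarrow>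
         cmod (cw_partition N \<beta> - \<Psi> N \<beta>) \<le> C1 / real N * (1 + exp (- real N * Re (hs \<beta>)))"
        using asym[OF \<delta>2] by (elim exE conjE)
      have as: "cmod (cw_partition N \<beta> - \<Psi> N \<beta>) \<le> C1 / real N * (1 + exp (- real N * Re (hs \<beta>)))"
        if "\<beta> \<in> ball 1 c2" "1 \<le> N" "\<delta> / 2 \<le> cmod (\<beta> - 1)" "Im \<beta> \<noteq> 0" "cmod (\<beta> - 1) / 10 \<le> Re (\<beta> - 1)" for \<beta> N
        using as0 that by blast
      obtain C2 where C2: "0 < C2" and nz0: "\<forall>\<beta>\<in>ball 1 c2. \<forall>N\<ge>1. \<delta> \<le> cmod (\<beta> - 1) \<longrightarrow> Im \<beta> \<noteq> 0 \<longrightarrow> Re (\<beta> - 1) \<le> \<bar>Im \<beta>\<bar> / 2 \<longrightarrow>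
         1 - C2 / real N \<le> cmod (cw_partition N \<beta>)"
        using nonzero[OF \<delta>] by (elim exE conjE)
      obtain C0 where "0 < C0" and corr: "\<forall>C\<ge>C0. \<exists>N0\<ge>1. \<forall>N\<ge>N0. C / (real N)\<^sup>2 < \<delta> / 100 \<and> (\<forall>b. cmod (b - 1) < c2 / 2 \<longrightarrow> \<delta> \<le> cmod (b - 1) \<longrightarrow>
         69 / 100 * cmod (b - 1) \<le> Re (b - 1) \<longrightarrow> 69 / 100 * cmod (b - 1) \<le> \<bar>Im b\<bar> \<longrightarrow>
         1 / 3 \<le> exp (- real N * Re (hs b)) \<longrightarrow> exp (- real N * Re (hs b)) \<le> 2 \<longrightarrow> cw_partition N b = 0 \<or> \<Psi> N b = 0 \<longrightarrow>
         (\<exists>!z. \<Psi> N z = 0 \<and> cmod (b - z) < C / (real N)\<^sup>2) \<and> (\<exists>!z. cw_partition N z = 0 \<and> cmod (b - z) < C / (real N)\<^sup>2))"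
        using zero_correspondence[OF c2 \<delta> C1 as0] by (elim exE conjE)
      \<comment> \<open>\<open>4 / \<delta>\<close> is for the curve: N |Re hs| \<le> 2 and Re (b -
        1) \<ge> \<delta>/2 bound the distance by 4 / (\<delta> N).\<close>
      define C where "C = max C0 (4 / \<delta>)"
      have C: "C0 \<le> C" "4 / \<delta> \<le> C" "0 < C" using \<delta> by (auto simp: C_def less_max_iff_disj)
      obtain N1 where N1: "1 \<le> N1" and corr1: "\<forall>N\<ge>N1. C / (real N)\<^sup>2 < \<delta> / 100 \<and> (\<forall>b. cmod (b - 1) < c2 / 2 \<longrightarrow> \<delta> \<le> cmod (b - 1) \<longrightarrow>
         69 / 100 * cmod (b - 1) \<le> Re (b - 1) \<longrightarrow> 69 / 100 * cmod (b - 1) \<le> \<bar>Im b\<bar> \<longrightarrow>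
         1 / 3 \<le> exp (- real N * Re (hs b)) \<longrightarrow> exp (- real N * Re (hs b)) \<le> 2 \<longrightarrow> cw_partition N b = 0 \<or> \<Psi> N b = 0 \<longrightarrow>
         (\<exists>!z. \<Psi> N z = 0 \<and> cmod (b - z) < C / (real N)\<^sup>2) \<and> (\<exists>!z. cw_partition N z = 0 \<and> cmod (b - z) < C / (real N)\<^sup>2))"
        using corr[THEN spec, THEN mp, OF C(1)] by (elim exE conjE)
      \<comment> \<open>\<open>200 / \<delta>\<^sup>2\<close> is the bound of
        \<open>critical_sector\<close>, 4 C1 gives C1 / N \<le> 1/4, and C2 makes 1 - C2 / N
        positive.\<close>
      define K where "K = 200 / \<delta>\<^sup>2 + 4 * C1 + C2"
      define N0 where "N0 = max N1 (nat \<lceil>K\<rceil> + 1)"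
      show "\<exists>N0. \<exists>C\<delta>. N0 \<ge> 1 \<and> C\<delta> > 0 \<and> (\<forall>N\<ge>N0.
       (\<forall>\<beta>. \<delta> < cmod (\<beta> - 1) \<and> cmod (\<beta> - 1) < c' \<and> cw_partition N \<beta> = 0 \<longrightarrow>
          Re \<beta> > 1 \<and>
          (\<exists>!\<beta>'. \<beta>' \<in> cw_Psi_zeros c0 ub N \<and> cmod (\<beta> - \<beta>') < C\<delta> / (real N)\<^sup>2)) \<and>
       (\<forall>\<beta>'. \<beta>' \<in> cw_Psi_zeros c0 ub N \<and> \<delta> < cmod (\<beta>' - 1) \<and> cmod (\<beta>' - 1) < c' \<longrightarrow>
          (\<exists>!\<beta>. cw_partition N \<beta> = 0 \<and> cmod (\<beta> - \<beta>') < C\<delta> / (real N)\<^sup>2)) \<and>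
       (\<forall>\<beta>. \<delta> < cmod (\<beta> - 1) \<and> cmod (\<beta> - 1) < c' \<and> cw_partition N \<beta> = 0 \<longrightarrow>
          (\<exists>\<gamma>\<in>critical_curve c R0. cmod (\<beta> - \<gamma>) \<le> C\<delta> / real N)))"
      proof (intro exI[of _ N0] exI[of _ C] conjI[OF _ conjI[OF C(3)]] allI[of "\<lambda>N. N0 \<le> N \<longrightarrow> _ N"] impI)
        show "1 \<le> N0" using N1 by (simp add: N0_def)
      next
        fix N assume N: "N0 \<le> N"
        have Np: "1 \<le> N" "N1 \<le> N" using N N1 by (auto simp: N0_def)
        have "K < real N" using N unfolding N0_def by linarith
        moreover have "0 < 200 / \<delta>\<^sup>2" using \<delta> by simp
        ultimately have NK: "200 / \<delta>\<^sup>2 \<le> real N" "4 * C1 \<le> real N" "C2 < real N" using C1 C2 unfolding K_def by linarith+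
        note corr2 = corr1[THEN spec, THEN mp, OF Np(2)]
        note small = corr2[THEN conjunct1]
        \<comment> \<open>Treats zeros of Z and of \<Psi> together, once \<Psi> is small enough to
          control the exponential.\<close>
        have located: "69 / 100 * cmod (b - 1) \<le> Re (b - 1) \<and> 69 / 100 * cmod (b - 1) \<le> \<bar>Im b\<bar> \<and> \<bar>Im b\<bar> \<le> 11 / 10 * Re (b - 1) \<and>
            9 / 10 * Re (b - 1) \<le> \<bar>Im b\<bar> \<and> \<bar>real N * Re (hs b)\<bar> \<le> 2 \<and>
            (\<exists>!z. \<Psi> N z = 0 \<and> cmod (b - z) < C / (real N)\<^sup>2) \<and> (\<exists>!z. cw_partition N z = 0 \<and> cmod (b - z) < C / (real N)\<^sup>2)"
          if b: "\<delta> < cmod (b - 1)" "cmod (b - 1) < c'" and re: "0 \<le> Re (b - 1)" and zero: "cw_partition N b = 0 \<or> \<Psi> N b = 0"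
            and sm: "cmod (\<Psi> N b) \<le> 1 / 4 * (1 + exp (- real N * Re (hs b)))" for b
        proof -
          have bb: "b \<in> ball 1 c1" using b c' c2 by (simp add: dist_norm norm_minus_commute)
          have b1: "b \<noteq> 1" using b \<delta> by auto
          note X = exponential_bounds_near_zero[OF bb b1 sm]
          have "\<delta> \<le> cmod (b - 1)" using b by simp
          note s = critical_sector[OF bb \<delta> this NK(1) Np(1) X(3) re]
          have "cmod (b - 1) < c2 / 2" using b c' c2 by linarith
          with corr2[THEN conjunct2, THEN spec, of b] \<open>\<delta> \<le> cmod (b - 1)\<close> s X zero show ?thesis by blast
        qed
        \<comment> \<open>A zero of Z is not real and not in the sector governed by the saddle 0
          alone, so the full asymptotics apply to it, and there |\<Psi>| = |Z - \<Psi>|.\<close>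
        have cwz: "0 \<le> Re (b - 1) \<and> cmod (\<Psi> N b) \<le> 1 / 4 * (1 + exp (- real N * Re (hs b)))"
          if b: "\<delta> < cmod (b - 1)" "cmod (b - 1) < c'" and zero: "cw_partition N b = 0" for b
        proof -
          have bb: "b \<in> ball 1 c2" using b c' c2 by (simp add: dist_norm norm_minus_commute)
          have im: "Im b \<noteq> 0" using cw_partition_real_pos zero by blast
          have "C2 / real N < 1" using NK(3) C2 by simp
          then have "\<not> Re (b - 1) \<le> \<bar>Im b\<bar> / 2"
            using bspec[OF nz0 bb] Np(1) b(1) im zero by force
          moreover have "cmod (b - 1) \<le> \<bar>Re (b - 1)\<bar> + \<bar>Im b\<bar>" using cmod_le[of "b - 1"] by simp
          ultimately have re: "0 \<le> Re (b - 1)" "cmod (b - 1) / 10 \<le> Re (b - 1)" by linarith+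
          have "cmod (cw_partition N b - \<Psi> N b) \<le> C1 / real N * (1 + exp (- real N * Re (hs b)))"
            by (rule as[OF bb Np(1) _ im re(2)]) (use b \<delta> in linarith)
          moreover have "C1 / real N \<le> 1 / 4" using NK(2) Np by (simp add: divide_le_eq)
          then have "C1 / real N * (1 + exp (- real N * Re (hs b))) \<le> 1 / 4 * (1 + exp (- real N * Re (hs b)))"
            by (rule mult_right_mono) (simp add: add_nonneg_nonneg)
          moreover have "cmod (cw_partition N b - \<Psi> N b) = cmod (\<Psi> N b)" unfolding zero by simp
          ultimately have "cmod (\<Psi> N b) \<le> 1 / 4 * (1 + exp (- real N * Re (hs b)))" by linarith
          then show ?thesis using re by blast
        qed
        show "(\<forall>\<beta>. \<delta> < cmod (\<beta> - 1) \<and> cmod (\<beta> - 1) < c' \<and> cw_partition N \<beta> = 0 \<longrightarrow>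
          Re \<beta> > 1 \<and>
          (\<exists>!\<beta>'. \<beta>' \<in> cw_Psi_zeros c0 ub N \<and> cmod (\<beta> - \<beta>') < C / (real N)\<^sup>2)) \<and>
         (\<forall>\<beta>'. \<beta>' \<in> cw_Psi_zeros c0 ub N \<and> \<delta> < cmod (\<beta>' - 1) \<and> cmod (\<beta>' - 1) < c' \<longrightarrow>
          (\<exists>!\<beta>. cw_partition N \<beta> = 0 \<and> cmod (\<beta> - \<beta>') < C / (real N)\<^sup>2)) \<and>
         (\<forall>\<beta>. \<delta> < cmod (\<beta> - 1) \<and> cmod (\<beta> - 1) < c' \<and> cw_partition N \<beta> = 0 \<longrightarrow>
          (\<exists>\<gamma>\<in>critical_curve c R0. cmod (\<beta> - \<gamma>) \<le> C / real N))"
        proof (intro conjI allI impI; elim conjE)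
          fix b assume b: "\<delta> < cmod (b - 1)" "cmod (b - 1) < c'" and zero: "cw_partition N b = 0"
          note l = located[OF b cwz[OF b zero, THEN conjunct1] disjI1[OF zero] cwz[OF b zero, THEN conjunct2]]
          have "69 / 100 * cmod (b - 1) \<le> Re b - 1" using l by simp
          then show "1 < Re b" using b \<delta> by linarith
          \<comment> \<open>Near b the constraints in \<open>cw_Psi_zeros\<close> hold
            automatically, so uniqueness among all zeros of \<Psi> is uniqueness in that
            set.\<close>
          have *: "z \<in> cw_Psi_zeros c0 ub N \<and> cmod (b - z) < C / (real N)\<^sup>2 \<longleftrightarrow> \<Psi> N z = 0 \<and> cmod (b - z) < C / (real N)\<^sup>2" for z
          proof (cases "cmod (b - z) < C / (real N)\<^sup>2")
            case True
            have "cmod (b - z) \<le> cmod (b - 1) / 100" using True small b by linarith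
            moreover have "0 < cmod (b - 1)" using b \<delta> by linarith
            ultimately have z: "z \<noteq> 1" "1 < Re z" "cmod (z - 1) \<le> 101 / 100 * cmod (b - 1)"
              using sector_neighbourhood(3,4,6)[of b z] l by auto
            have "cmod (z - 1) < c1" using z(3) b c' c2 by linarith
            then have "z \<in> ball 1 c1" by (simp add: dist_norm norm_minus_commute)
            then show ?thesis using cw_Psi_zeros_iff[OF sp c10 _ z(1)] z(2) by simp
          qed simp
          show "\<exists>!\<beta>'. \<beta>' \<in> cw_Psi_zeros c0 ub N \<and> cmod (b - \<beta>') < C / (real N)\<^sup>2" unfolding * using l by blast
        next
          fix b assume bz: "b \<in> cw_Psi_zeros c0 ub N" and b: "\<delta> < cmod (b - 1)" "cmod (b - 1) < c'"
          have bb: "b \<in> ball 1 c1" using b c' c2 by (simp add: dist_norm norm_minus_commute)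
          have b1: "b \<noteq> 1" using b \<delta> by auto
          have re: "0 \<le> Re (b - 1)" using bz by (simp add: cw_Psi_zeros_def)
          have zero: "\<Psi> N b = 0" using cw_Psi_zeros_iff[OF sp c10 bb b1] bz re by simp
          have "cmod (\<Psi> N b) \<le> 1 / 4 * (1 + exp (- real N * Re (hs b)))" unfolding zero by (simp add: add_nonneg_nonneg)
          from located[OF b re disjI2[OF zero] this]
          show "\<exists>!\<beta>. cw_partition N \<beta> = 0 \<and> cmod (\<beta> - b) < C / (real N)\<^sup>2"
            unfolding norm_minus_commute[of _ b] by blast
        next
          fix b assume b: "\<delta> < cmod (b - 1)" "cmod (b - 1) < c'" and zero: "cw_partition N b = 0"
          note l = located[OF b cwz[OF b zero, THEN conjunct1] disjI1[OF zero] cwz[OF b zero, THEN conjunct2]]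
          have "\<delta> / 2 \<le> Re (b - 1)" using l b \<delta> by linarith
          then obtain \<gamma> where \<gamma>: "\<gamma> \<in> critical_curve c R0" "Re (b - 1) * cmod (b - \<gamma>) \<le> \<bar>Re (hs b)\<bar>"
            using curve[OF b(2)] l \<delta> by auto
          have "\<delta> / 2 * cmod (b - \<gamma>) \<le> Re (b - 1) * cmod (b - \<gamma>)"
            using \<open>\<delta> / 2 \<le> Re (b - 1)\<close> by (rule mult_right_mono) simp
          then have "\<delta> / 2 * cmod (b - \<gamma>) \<le> \<bar>Re (hs b)\<bar>" using \<gamma>(2) by linarith
          then have "real N * (\<delta> / 2 * cmod (b - \<gamma>)) \<le> real N * \<bar>Re (hs b)\<bar>" by (rule mult_left_mono) simp
          also have "\<dots> \<le> 2" using l by (simp add: abs_mult)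
          finally have "cmod (b - \<gamma>) \<le> 4 / \<delta> / real N" using \<delta> Np by (simp add: field_simps)
          also have "\<dots> \<le> C / real N" using C(2) by (rule divide_right_mono) simp
          finally show "\<exists>\<gamma>\<in>critical_curve c R0. cmod (b - \<gamma>) \<le> C / real N" using \<gamma>(1) by blast
        qed
      qed
    qed
  qed
qed

end
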